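(* Let $\mathbb{F}$ be an algebraically closed field, $G(\lambda)\in\mathbb{F}(\lambda)^{p\times m}$, $g$ an integer, $s\ge0$ an integer, and let $$\mathcal{L}(\lambda)=\begin{bmatrix}A_1\lambda+A_0&B_1\lambda+B_0\\-(C_1\lambda+C_0)&D_1\lambda+D_0\end{bmatrix}\in\mathbb{F}[\lambda]^{(n+(p+s))\times(n+(m+s))}$$ be a linear polynomial system matrix, with $n\times n$ state matrix $A_1\lambda+A_0$, such that $\operatorname{rev}\mathcal{L}(\lambda)$ is minimal at $0$, and let $\ell=\deg(\mathcal{L}(\lambda))$. Then $\mathcal{L}(\lambda)$ is a linearization of $G(\lambda)$ at $\infty$ of grade $g$ if and only if the following three conditions hold: (a) $\operatorname{rank}\mathcal{L}(\lambda)=\operatorname{rank}G(\lambda)+n+s$; (b) the pole elementary divisors of $\operatorname{rev}_gG(\lambda)$ at $0$ are the elementary divisors of $\operatorname{rev}_\ell(A_1\lambda+A_0)$ at $0$; (c) the zero elementary divisors of $\operatorname{rev}_gG(\lambda)$ at $0$ are the elementary divisors of $\operatorname{rev}\mathcal{L}(\lambda)$ at $0$.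
   Context: $\operatorname{rank}$ of a rational matrix is its normal rank (rank over $\mathbb{F}(\lambda)$). For a rational matrix $G(\lambda)$ and an integer $g$, $\operatorname{rev}_gG(\lambda):=\lambda^gG(1/\lambda)$. For a polynomial matrix $P(\lambda)$ of degree $d$ (largest exponent of $\lambda$ with nonzero matrix coefficient; $d=0$ for the zero matrix), $\operatorname{rev}P(\lambda):=\operatorname{rev}_dP(\lambda)$. A square rational matrix is regular at $\lambda_0\in\mathbb{F}$ if none of its entries has a pole at $\lambda_0$ and its determinant is nonzero at $\lambda_0$. Every $G(\lambda)\in\mathbb{F}(\lambda)^{p\times m}$ of normal rank $r$ can be written $G=R_1\,\mathrm{diag}\left((\lambda-\lambda_0)^{\nu_1},\ldots,(\lambda-\lambda_0)^{\nu_r},0_{(p-r)\times(m-r)}\right)R_2$ with $R_1,R_2$ rational and regular at $\lambda_0$, and with unique integers $\nu_1\le\cdots\le\nu_r$. The pole elementary divisors of $G$ at $\lambda_0$ are $(\lambda-\lambda_0)^{-\nu_i}$ for all $i$ with $\nu_i<0$; the zero elementary divisors are $(\lambda-\lambda_0)^{\nu_i}$ for all $i$ with $\nu_i>0$. For a polynomial matrix, its elementary divisors at $\lambda_0$ are the $(\lambda-\lambda_0)^{\nu_i}$ with $\nu_i\ne0$. A polynomial system matrix is a partitioned polynomial matrix $\begin{bmatrix}A&B\\-C&D\end{bmatrix}$ with $A(\lambda)$ of size $n\times n$ and $\det A(\lambda)\not\equiv0$ (if $n>0$); $A$ is its state matrix and $D+CA^{-1}B$ its transfer function matrix; if $n=0$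 the blocks $A,B,C$ are empty. It is linear if all blocks have degree at most $1$. For $n>0$ it is minimal at $\lambda_0$ if $\operatorname{rank}\begin{bmatrix}A(\lambda_0)\\C(\lambda_0)\end{bmatrix}=\operatorname{rank}\begin{bmatrix}A(\lambda_0)&B(\lambda_0)\end{bmatrix}=n$; for $n=0$ it is by convention minimal at every point of $\mathbb{F}$. If $\mathcal{L}$ is a linear polynomial system matrix of degree $\ell$, then $\operatorname{rev}\mathcal{L}=\operatorname{rev}_\ell\mathcal{L}$, with the same block partition, is a linear polynomial system matrix with state matrix $\operatorname{rev}_\ell(A_1\lambda+A_0)$. A linear polynomial system matrix $\mathcal{L}(\lambda)\in\mathbb{F}[\lambda]^{(n+q)\times(n+t)}$ (with transfer function matrix $\widehat G(\lambda)\in\mathbb{F}(\lambda)^{q\times t}$ and $\ell=\deg\mathcal{L}(\lambda)$) is a linearization of $G(\lambda)\in\mathbb{F}(\lambda)^{p\times m}$ at $\infty$ of grade $g$ if $\operatorname{rev}\mathcal{L}(\lambda)$ is minimal at $0$ and there exist nonnegative integers $s_1,s_2$ with $s_1-s_2=q-p=t-m$ and rational matrices $Q_1,Q_2$ regular at $0$, of sizes $p+s_1$ and $m+s_1$, such that $Q_1\,\mathrm{diag}(\operatorname{rev}_gG,I_{s_1})\,Q_2=\mathrm{diag}(\operatorname{rev}_\ell\widehat G,I_{s_2})$. *)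

theory Defs
  imports
    "Jordan_Normal_Form.Gauss_Jordan_Elimination"
    "Jordan_Normal_Form.DL_Rank"
    "HOL-Library.Multiset"
    "HOL-Computational_Algebra.Computational_Algebra"
begin

text \<open>
  \<open>F(\<lambda>)\<close> is the type \<open>'a poly fract\<close>. Polynomial matrices are of type \<open>'a poly mat\<close>, and are
  embedded into the rational ones by \<open>rat_mat\<close> where needed.
\<close>

type_synonym 'a ratfun = "'a poly fract"

section \<open>Rational functions\<close>

definition rf_var :: "'a::field ratfun" where
  "rf_var = to_fract [:0, 1:]"

definition rf_const :: "'a::field \<Rightarrow> 'a ratfun" where
  "rf_const c = to_fract [:c:]"

definition has_pole :: "'a::field ratfun \<Rightarrow> 'a \<Rightarrow> bool" where
  "has_pole f a \<longleftrightarrow> \<not> (\<exists>p q. poly q a \<noteq> 0 \<and> f = Fraction_Field.Fract p q)"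

text \<open>The value of a rational function at a point that is not a pole.\<close>

definition rf_eval :: "'a::field ratfun \<Rightarrow> 'a \<Rightarrow> 'a" where
  "rf_eval f a =
     (THE y. \<exists>p q. poly q a \<noteq> 0 \<and> f = Fraction_Field.Fract p q \<and> y = poly p a / poly q a)"

text \<open>\<open>p(1/\<lambda>)\<close> for a polynomial \<open>p\<close>, and \<open>f(1/\<lambda>)\<close> for a rational function \<open>f\<close>.\<close>

definition poly_recip :: "'a::field poly \<Rightarrow> 'a ratfun" where
  "poly_recip p = poly (map_poly rf_const p) (inverse rf_var)"

definition rf_recip :: "'a::field ratfun \<Rightarrow> 'a ratfun" where
  "rf_recip f =
     (THE y. \<exists>p q. q \<noteq> 0 \<and> f = Fraction_Field.Fract p q \<and> y = poly_recip p / poly_recip q)"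

definition rf_rev :: "int \<Rightarrow> 'a::field ratfun \<Rightarrow> 'a ratfun" where
  "rf_rev g f = rf_var powi g * rf_recip f"

text \<open>\<open>\<lambda>\<^sup>k p(1/\<lambda>)\<close> as a polynomial, provided that \<open>degree p \<le> k\<close>; see \<open>to_fract_rev_poly\<close> below.\<close>

definition rev_poly :: "nat \<Rightarrow> 'a::field poly \<Rightarrow> 'a poly" where
  "rev_poly k p = (\<Sum>i\<le>k. monom (coeff p i) (k - i))"

lemma rf_eval_Fract:
  assumes "poly q a \<noteq> 0"
  shows "rf_eval (Fraction_Field.Fract p q) a = poly p a / poly q a"
  unfolding rf_eval_def
proof (rule the_equality)
  show "\<exists>p' q'. poly q' a \<noteq> 0 \<and> Fraction_Field.Fract p q = Fraction_Field.Fract p' q' \<and>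
      poly p a / poly q a = poly p' a / poly q' a"
    using assms by blast
next
  fix y
  assume "\<exists>p' q'. poly q' a \<noteq> 0 \<and> Fraction_Field.Fract p q = Fraction_Field.Fract p' q' \<and>
      y = poly p' a / poly q' a"
  then obtain p' q' where *: "poly q' a \<noteq> 0"
    "Fraction_Field.Fract p q = Fraction_Field.Fract p' q'" "y = poly p' a / poly q' a" by blast
  have "q \<noteq> 0" "q' \<noteq> 0" using assms * by auto
  with * have "p * q' = p' * q" by (simp add: eq_fract)
  then have "poly p a * poly q' a = poly p' a * poly q a" by (metis poly_mult)
  with * assms show "y = poly p a / poly q a" by (simp add: frac_eq_eq)
qed

lemma rf_const_hom:
  "rf_const 0 = 0" "rf_const (c + d) = rf_const c + rf_const d"
  "rf_const (c * d) = rf_const c * rf_const d" "rf_const 1 = 1"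
  unfolding rf_const_def
  by (simp_all flip: to_fract_add to_fract_mult one_pCons)

lemma poly_recip_0: "poly_recip 0 = 0"
  by (simp add: poly_recip_def)

lemma poly_recip_pCons: "poly_recip (pCons c p) = rf_const c + inverse rf_var * poly_recip p"
proof (cases "c = 0 \<and> p = 0")
  case True
  then show ?thesis by (simp add: poly_recip_def rf_const_hom)
next
  case False
  then have "map_poly rf_const (pCons c p) = pCons (rf_const c) (map_poly rf_const p)"
    by (intro map_poly_pCons) (auto simp: rf_const_hom)
  then show ?thesis by (simp add: poly_recip_def)
qed

lemma poly_recip_add: "poly_recip (p + q) = poly_recip p + poly_recip q"
  by (induction p q rule: poly_induct2)
     (simp_all add: poly_recip_0 poly_recip_pCons rf_const_hom algebra_simps)

lemma poly_recip_smult: "poly_recip (smult c p) = rf_const c * poly_recip p"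
  by (induction p) (simp_all add: poly_recip_0 poly_recip_pCons rf_const_hom algebra_simps)

lemma poly_recip_mult: "poly_recip (p * q) = poly_recip p * poly_recip q"
  by (induction p)
     (simp_all add: poly_recip_0 poly_recip_pCons poly_recip_add poly_recip_smult rf_const_hom
        algebra_simps)

lemma rf_var_nonzero: "(rf_var :: 'a::field ratfun) \<noteq> 0"
  unfolding rf_var_def by simp

lemma to_fract_monom: "to_fract (monom c k) = rf_const c * rf_var ^ k"
proof (induction k)
  case 0
  show ?case by (simp add: rf_const_def monom_0)
next
  case (Suc k)
  have "monom c (Suc k) = [:0, 1:] * monom c k" by (simp add: monom_Suc)
  then have "to_fract (monom c (Suc k)) = rf_var * to_fract (monom c k)"
    unfolding rf_var_def by (simp only: to_fract_mult)
  then show ?case using Suc by simp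
qed

lemma to_fract_rev_poly_aux:
  assumes "degree p \<le> k"
  shows "to_fract (rev_poly k p) = rf_var ^ k * poly_recip p"
proof -
  have c0: "rf_const (0::'a) = 0" by (simp add: rf_const_hom)
  have deg: "degree (map_poly rf_const p) \<le> k"
    using assms by (intro degree_le) (auto simp: coeff_map_poly c0 coeff_eq_0)
  have "poly_recip p = (\<Sum>i\<le>k. rf_const (coeff p i) * inverse rf_var ^ i)"
  proof -
    have "poly_recip p = (\<Sum>i\<le>degree (map_poly rf_const p).
        rf_const (coeff p i) * inverse rf_var ^ i)"
      unfolding poly_recip_def poly_altdef by (simp add: coeff_map_poly c0)
    also have "\<dots> = (\<Sum>i\<le>k. rf_const (coeff p i) * inverse rf_var ^ i)"
    proof (rule sum.mono_neutral_left)
      show "\<forall>i\<in>{..k} - {..degree (map_poly rf_const p)}.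
          rf_const (coeff p i) * inverse rf_var ^ i = 0"
        using coeff_eq_0[of "map_poly rf_const p"] by (auto simp: coeff_map_poly c0)
    qed (use deg in auto)
    finally show ?thesis .
  qed
  also have "rf_var ^ k * \<dots> = (\<Sum>i\<le>k. rf_const (coeff p i) * rf_var ^ (k - i))"
    unfolding sum_distrib_left
    by (intro sum.cong refl)
       (simp add: power_diff rf_var_nonzero field_simps)
  finally show ?thesis unfolding rev_poly_def by (simp add: to_fract_monom)
qed

lemma poly_recip_eq_0_iff: "poly_recip p = 0 \<longleftrightarrow> p = 0"
proof
  assume "poly_recip p = 0"
  then have "to_fract (rev_poly (degree p) p) = 0"
    by (simp add: to_fract_rev_poly_aux)
  then have "coeff (rev_poly (degree p) p) 0 = 0" by simp
  moreover have "coeff (rev_poly (degree p) p) 0 = coeff p (degree p)"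
  proof -
    have "coeff (rev_poly (degree p) p) 0
        = (\<Sum>i\<le>degree p. if i = degree p then coeff p i else 0)"
      unfolding rev_poly_def coeff_sum by (intro sum.cong refl) auto
    then show ?thesis by simp
  qed
  ultimately show "p = 0" by simp
qed (simp add: poly_recip_def)

lemma rf_recip_Fract:
  assumes "q \<noteq> 0"
  shows "rf_recip (Fraction_Field.Fract p q) = poly_recip p / poly_recip q"
  unfolding rf_recip_def
proof (rule the_equality)
  show "\<exists>p' q'. q' \<noteq> 0 \<and> Fraction_Field.Fract p q = Fraction_Field.Fract p' q' \<and>
      poly_recip p / poly_recip q = poly_recip p' / poly_recip q'"
    using assms by blast
next
  fix y
  assume "\<exists>p' q'. q' \<noteq> 0 \<and> Fraction_Field.Fract p q = Fraction_Field.Fract p' q' \<and>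
      y = poly_recip p' / poly_recip q'"
  then obtain p' q' where *: "q' \<noteq> 0"
    "Fraction_Field.Fract p q = Fraction_Field.Fract p' q'"
    "y = poly_recip p' / poly_recip q'" by blast
  with assms have "p * q' = p' * q" by (simp add: eq_fract)
  then have "poly_recip p * poly_recip q' = poly_recip p' * poly_recip q"
    by (metis poly_recip_mult)
  with * assms show "y = poly_recip p / poly_recip q"
    by (simp add: poly_recip_eq_0_iff frac_eq_eq)
qed

lemma rf_recip_to_fract: "rf_recip (to_fract p) = poly_recip p"
proof -
  have "poly_recip 1 = (1 :: 'a ratfun)"
    by (simp add: poly_recip_def one_pCons map_poly_pCons rf_const_hom)
  then show ?thesis using rf_recip_Fract[of 1 p] by (simp add: to_fract_def)
qed

lemma to_fract_rev_poly:
  assumes "degree p \<le> k"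
  shows "to_fract (rev_poly k p) = rf_rev (int k) (to_fract p)"
  using to_fract_rev_poly_aux[OF assms] by (simp add: rf_rev_def rf_recip_to_fract)


section \<open>Polynomial and rational matrices\<close>

abbreviation mat_rank :: "'b::field mat \<Rightarrow> nat" where
  "mat_rank M \<equiv> vec_space.rank (dim_row M) M"

abbreviation rat_mat :: "'a::field poly mat \<Rightarrow> 'a ratfun mat" where
  "rat_mat \<equiv> map_mat to_fract"

abbreviation eval_pmat :: "'a::field poly mat \<Rightarrow> 'a \<Rightarrow> 'a mat" where
  "eval_pmat P a \<equiv> map_mat (\<lambda>p. poly p a) P"

abbreviation diag2 :: "'b::zero mat \<Rightarrow> 'b mat \<Rightarrow> 'b mat" where
  "diag2 M N \<equiv> diag_block_mat [M, N]"

definition rev_rmat :: "int \<Rightarrow> 'a::field ratfun mat \<Rightarrow> 'a ratfun mat" where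
  "rev_rmat g = map_mat (rf_rev g)"

definition rev_pmat :: "nat \<Rightarrow> 'a::field poly mat \<Rightarrow> 'a poly mat" where
  "rev_pmat k = map_mat (rev_poly k)"

definition coeff_mat :: "'a::field poly mat \<Rightarrow> nat \<Rightarrow> 'a mat" where
  "coeff_mat P k = map_mat (\<lambda>p. coeff p k) P"

definition mat_degree :: "'a::field poly mat \<Rightarrow> nat" where
  "mat_degree P = (if P = 0\<^sub>m (dim_row P) (dim_col P) then 0
     else GREATEST k. coeff_mat P k \<noteq> 0\<^sub>m (dim_row P) (dim_col P))"

text \<open>The matrix polynomial \<open>M\<^sub>1\<lambda> + M\<^sub>0\<close>.\<close>

definition pencil :: "'a::field mat \<Rightarrow> 'a mat \<Rightarrow> 'a poly mat" where
  "pencil M1 M0 = [:0, 1:] \<cdot>\<^sub>m map_mat (\<lambda>c. [:c:]) M1 + map_mat (\<lambda>c. [:c:]) M0"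

definition regular_at :: "'a::field \<Rightarrow> 'a ratfun mat \<Rightarrow> bool" where
  "regular_at a R \<longleftrightarrow> square_mat R \<and> (\<forall>f \<in> elements_mat R. \<not> has_pole f a)
     \<and> rf_eval (det R) a \<noteq> 0"


section \<open>Invariant orders and elementary divisors\<close>

definition rf_lin :: "'a::field \<Rightarrow> 'a ratfun" where
  "rf_lin a = to_fract [:- a, 1:]"

definition local_smith_mcmillan :: "'a::field \<Rightarrow> 'a ratfun mat \<Rightarrow> int list \<Rightarrow> bool" where
  "local_smith_mcmillan a G \<nu> \<longleftrightarrow> length \<nu> = mat_rank G \<and> sorted \<nu> \<and>
     (\<exists>R1 \<in> carrier_mat (dim_row G) (dim_row G). \<exists>R2 \<in> carrier_mat (dim_col G) (dim_col G).
        regular_at a R1 \<and> regular_at a R2 \<and>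
        G = R1 * diag2 (mat_diag (length \<nu>) (\<lambda>i. rf_lin a powi (\<nu> ! i)))
                       (0\<^sub>m (dim_row G - length \<nu>) (dim_col G - length \<nu>)) * R2)"

definition invariant_orders :: "'a::field \<Rightarrow> 'a ratfun mat \<Rightarrow> int list" where
  "invariant_orders a G = (THE \<nu>. local_smith_mcmillan a G \<nu>)"

text \<open>
  Elementary divisors are collected with multiplicity, as elements of \<open>F(\<lambda>)\<close>; they are all powers
  of \<open>\<lambda> - a\<close> with positive exponent (a polynomial matrix has no negative invariant orders).
\<close>

definition pole_elementary_divisors :: "'a::field \<Rightarrow> 'a ratfun mat \<Rightarrow> 'a ratfun multiset" where
  "pole_elementary_divisors a G =
     {# rf_lin a powi (- k). k \<in># filter_mset (\<lambda>k. k < 0) (mset (invariant_orders a G)) #}"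

definition zero_elementary_divisors :: "'a::field \<Rightarrow> 'a ratfun mat \<Rightarrow> 'a ratfun multiset" where
  "zero_elementary_divisors a G =
     {# rf_lin a powi k. k \<in># filter_mset (\<lambda>k. k > 0) (mset (invariant_orders a G)) #}"

definition elementary_divisors :: "'a::field \<Rightarrow> 'a poly mat \<Rightarrow> 'a ratfun multiset" where
  "elementary_divisors a P =
     {# rf_lin a powi k. k \<in># filter_mset (\<lambda>k. k \<noteq> 0) (mset (invariant_orders a (rat_mat P))) #}"


section \<open>Polynomial system matrices\<close>

text \<open>
  A polynomial system matrix is given by its blocks \<open>A, B, C, D\<close>; note the sign in the lower left
  block. For \<open>n = 0\<close> the condition on the determinant is void, the empty determinant being \<open>1\<close>.
\<close>

definition system_matrix ::
  "'a::field poly mat \<Rightarrow> 'a poly mat \<Rightarrow> 'a poly mat \<Rightarrow> 'a poly mat \<Rightarrow> 'a poly mat" where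
  "system_matrix A B C D = four_block_mat A B (- C) D"

definition polynomial_system_matrix ::
  "nat \<Rightarrow> nat \<Rightarrow> nat \<Rightarrow> 'a::field poly mat \<Rightarrow> 'a poly mat \<Rightarrow> 'a poly mat \<Rightarrow> 'a poly mat \<Rightarrow> bool"
where
  "polynomial_system_matrix n q t A B C D \<longleftrightarrow>
     A \<in> carrier_mat n n \<and> B \<in> carrier_mat n t \<and> C \<in> carrier_mat q n \<and> D \<in> carrier_mat q t \<and>
     det A \<noteq> 0"

definition linear_system_matrix ::
  "nat \<Rightarrow> nat \<Rightarrow> nat \<Rightarrow> 'a::field poly mat \<Rightarrow> 'a poly mat \<Rightarrow> 'a poly mat \<Rightarrow> 'a poly mat \<Rightarrow> bool"
where
  "linear_system_matrix n q t A B C D \<longleftrightarrow> polynomial_system_matrix n q t A B C D \<and>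
     mat_degree A \<le> 1 \<and> mat_degree B \<le> 1 \<and> mat_degree C \<le> 1 \<and> mat_degree D \<le> 1"

definition transfer_function ::
  "'a::field poly mat \<Rightarrow> 'a poly mat \<Rightarrow> 'a poly mat \<Rightarrow> 'a poly mat \<Rightarrow> 'a ratfun mat" where
  "transfer_function A B C D =
     rat_mat D + rat_mat C * the (mat_inverse (rat_mat A)) * rat_mat B"

definition minimal_at ::
  "'a::field \<Rightarrow> 'a poly mat \<Rightarrow> 'a poly mat \<Rightarrow> 'a poly mat \<Rightarrow> 'a poly mat \<Rightarrow> bool" where
  "minimal_at a A B C D \<longleftrightarrow> dim_row A = 0 \<or>
     mat_rank (eval_pmat A a @\<^sub>r eval_pmat C a) = dim_row A \<and>
     mat_rank (four_block_mat (eval_pmat A a) (eval_pmat B a)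
                 (0\<^sub>m 0 (dim_col A)) (0\<^sub>m 0 (dim_col B))) = dim_row A"

text \<open>Minimality at \<open>a\<close> of the reversal of grade \<open>k\<close>, taken blockwise with the same partition.\<close>

definition rev_minimal_at ::
  "nat \<Rightarrow> 'a::field \<Rightarrow> 'a poly mat \<Rightarrow> 'a poly mat \<Rightarrow> 'a poly mat \<Rightarrow> 'a poly mat \<Rightarrow> bool" where
  "rev_minimal_at k a A B C D \<longleftrightarrow>
     minimal_at a (rev_pmat k A) (rev_pmat k B) (rev_pmat k C) (rev_pmat k D)"

lemma rev_poly_uminus: "rev_poly k (- p) = - rev_poly k p"
  unfolding rev_poly_def by (simp add: minus_monom flip: sum_negf)

lemma rev_pmat_system_matrix:
  assumes "A \<in> carrier_mat n n" "B \<in> carrier_mat n t" "C \<in> carrier_mat q n" "D \<in> carrier_mat q t"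
  shows "rev_pmat k (system_matrix A B C D)
    = system_matrix (rev_pmat k A) (rev_pmat k B) (rev_pmat k C) (rev_pmat k D)"
  using assms unfolding system_matrix_def rev_pmat_def
  by (intro eq_matI) (auto simp: rev_poly_uminus)

definition linearization_at_infinity ::
  "'a::field poly mat \<Rightarrow> 'a poly mat \<Rightarrow> 'a poly mat \<Rightarrow> 'a poly mat \<Rightarrow> 'a ratfun mat \<Rightarrow> int \<Rightarrow> bool"
where
  "linearization_at_infinity A B C D G g \<longleftrightarrow>
     (let n = dim_row A; q = dim_row D; t = dim_col D; p = dim_row G; m = dim_col G;
          d = mat_degree (system_matrix A B C D)
      in linear_system_matrix n q t A B C D \<and>
         rev_minimal_at d 0 A B C D \<and>
         (\<exists>s1 s2 :: nat.
            int s1 - int s2 = int q - int p \<and> int s1 - int s2 = int t - int m \<and>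
            (\<exists>Q1 \<in> carrier_mat (p + s1) (p + s1). \<exists>Q2 \<in> carrier_mat (m + s1) (m + s1).
               regular_at 0 Q1 \<and> regular_at 0 Q2 \<and>
               Q1 * diag2 (rev_rmat g G) (1\<^sub>m s1) * Q2 =
                 diag2 (rev_rmat (int d) (transfer_function A B C D)) (1\<^sub>m s2))))"

end

theory Submission
  imports Defs
begin

text \<open>
  The rational functions without a pole at a point form a discrete valuation ring, over which every
  rational matrix has a Smith--McMillan form that determines it up to multiplication by regular
  matrices. Hence being a linearization at infinity means that \<open>rev\<^sub>g G\<close> and the transfer function
  \<open>H\<close> of \<open>rev \<L>\<close> have the same invariant orders at \<open>0\<close>, up to \<open>s\<close> additional zeros.

  Minimality of \<open>rev \<L>\<close> at \<open>0\<close> completes its block row \<open>[A B]\<close> to a regular matrix and gives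
  \<open>[A; C]\<close> a left inverse. This produces a coprime fraction \<open>H = N D\<^sub>r\<inverse>\<close> in which \<open>N\<close> is equivalent
  to the system matrix and \<open>D\<^sub>r\<close> to the state matrix, up to identity blocks. As coprime fractions are
  unique up to a regular right factor, \<open>N\<close> and \<open>D\<^sub>r\<close> can be compared with the numerator and the
  denominator of the Smith--McMillan form of \<open>H\<close>: the former carries the zeros of \<open>H\<close> and the latter
  its poles.
\<close>

section \<open>The local ring of rational functions without a pole at a point\<close>

text \<open>Over \<open>F(\<lambda>)\<close> the Schur complement splits a system matrix into its
  state matrix and its transfer function, but the factors of that splitting involve
  \<open>A^-1\<close>, which may have a pole at the point, so the splitting says nothing about local
  orders. Minimality is the substitute: each of its two rank conditions provides factors without a
  pole, and the coprime fraction is what these factors leave behind. Elementary divisors record only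
  the nonzero orders. A multiset of orders is determined by its negative part, its positive part and
  its size, and the size is the normal rank; this is why (b) and (c) have to be accompanied by (a).
  In the reversal at grade \<open>l\<close>, the factors \<open>\<lambda>^l\<close> of two of the
  three terms in \<open>C A^-1 B\<close> cancel, since the one of \<open>A\<close> enters inverted.
  Hence reversing the transfer function gives the transfer function of the reversal, and the
  question at infinity becomes one at \<open>0\<close>.\<close>

lemma no_poleI:
  assumes "poly q a \<noteq> 0" "f = to_fract p / to_fract q"
  shows "\<not> has_pole f a" "rf_eval f a = poly p a / poly q a"
  using assms rf_eval_Fract[of q a p] by (auto simp: has_pole_def Fract_conv_to_fract)

lemma no_poleE:
  assumes "\<not> has_pole f a"
  obtains p q where "poly q a \<noteq> 0" "q \<noteq> 0" "f = to_fract p / to_fract q"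
  using assms by (force simp: has_pole_def Fract_conv_to_fract)

lemma no_pole_to_fract [simp]: "\<not> has_pole (to_fract p) a" "rf_eval (to_fract p) a = poly p a"
  using no_poleI[of 1 a "to_fract p" p] by auto

lemma no_pole_0_1 [simp]: "\<not> has_pole 0 a" "rf_eval 0 a = 0" "\<not> has_pole 1 a" "rf_eval 1 a = 1"
  using no_pole_to_fract[of 0 a] no_pole_to_fract[of 1 a] by auto

lemma no_pole_add:
  assumes "\<not> has_pole f a" "\<not> has_pole h a"
  shows "\<not> has_pole (f + h) a" "rf_eval (f + h) a = rf_eval f a + rf_eval h a"
proof -
  from assms(1) obtain p q where 1: "poly q a \<noteq> 0" "q \<noteq> 0" "f = to_fract p / to_fract q"
    by (rule no_poleE)
  from assms(2) obtain p' q' where 2: "poly q' a \<noteq> 0" "q' \<noteq> 0" "h = to_fract p' / to_fract q'"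
    by (rule no_poleE)
  have "f + h = to_fract (p * q' + p' * q) / to_fract (q * q')"
    using 1 2 by (simp add: field_simps)
  from no_poleI[OF _ this, of a] no_poleI[OF 1(1,3)] no_poleI[OF 2(1,3)] 1(1) 2(1)
  show "\<not> has_pole (f + h) a" "rf_eval (f + h) a = rf_eval f a + rf_eval h a"
    by (simp_all add: add_frac_eq)
qed

lemma no_pole_mult:
  assumes "\<not> has_pole f a" "\<not> has_pole h a"
  shows "\<not> has_pole (f * h) a" "rf_eval (f * h) a = rf_eval f a * rf_eval h a"
proof -
  from assms(1) obtain p q where 1: "poly q a \<noteq> 0" "q \<noteq> 0" "f = to_fract p / to_fract q"
    by (rule no_poleE)
  from assms(2) obtain p' q' where 2: "poly q' a \<noteq> 0" "q' \<noteq> 0" "h = to_fract p' / to_fract q'"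
    by (rule no_poleE)
  have "f * h = to_fract (p * p') / to_fract (q * q')"
    using 1 2 by simp
  from no_poleI[OF _ this, of a] no_poleI[OF 1(1,3)] no_poleI[OF 2(1,3)] 1(1) 2(1)
  show "\<not> has_pole (f * h) a" "rf_eval (f * h) a = rf_eval f a * rf_eval h a"
    by simp_all
qed

lemma no_pole_uminus:
  assumes "\<not> has_pole f a"
  shows "\<not> has_pole (- f) a" "rf_eval (- f) a = - rf_eval f a"
  using no_pole_mult[of "- 1" a f] no_pole_to_fract[of "- 1" a] assms by simp_all

lemma no_pole_diff: "\<not> has_pole f a \<Longrightarrow> \<not> has_pole h a \<Longrightarrow> \<not> has_pole (f - h) a"
  using no_pole_add(1)[of f a "- h"] no_pole_uminus(1)[of h a] by simp

lemma no_pole_sum: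
  assumes "\<And>i. i \<in> I \<Longrightarrow> \<not> has_pole (f i) a"
  shows "\<not> has_pole (sum f I) a \<and> rf_eval (sum f I) a = (\<Sum>i\<in>I. rf_eval (f i) a)"
  using assms by (induction I rule: infinite_finite_induct) (auto simp: no_pole_add)

lemma no_pole_prod:
  assumes "\<And>i. i \<in> I \<Longrightarrow> \<not> has_pole (f i) a"
  shows "\<not> has_pole (prod f I) a \<and> rf_eval (prod f I) a = (\<Prod>i\<in>I. rf_eval (f i) a)"
  using assms by (induction I rule: infinite_finite_induct) (auto simp: no_pole_mult)

lemma no_pole_power: "\<not> has_pole f a \<Longrightarrow> \<not> has_pole (f ^ k) a"
  by (induction k) (auto simp: no_pole_mult)

lemma no_pole_inverse:
  assumes "\<not> has_pole f a" "rf_eval f a \<noteq> 0"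
  shows "\<not> has_pole (inverse f) a"
proof -
  from assms(1) obtain p q where 1: "poly q a \<noteq> 0" "q \<noteq> 0" "f = to_fract p / to_fract q"
    by (rule no_poleE)
  with no_poleI[OF 1(1,3)] assms(2) have "poly p a \<noteq> 0" by auto
  from no_poleI(1)[OF this, of "inverse f" q] 1 show ?thesis by simp
qed

lemma rf_eval_nonzero:
  assumes "f * h = 1" "\<not> has_pole f a" "\<not> has_pole h a"
  shows "rf_eval f a \<noteq> 0"
  using no_pole_mult(2)[OF assms(2,3)] assms(1) by auto

lemma rf_lin_nonzero [simp]: "rf_lin a \<noteq> 0"
  by (simp add: rf_lin_def)

lemma no_pole_rf_lin_powi: "k \<ge> 0 \<Longrightarrow> \<not> has_pole (rf_lin a powi k) a"
  by (simp add: power_int_def no_pole_power rf_lin_def)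

lemma rf_eval_rf_lin_powi:
  assumes "k \<ge> 0"
  shows "rf_eval (rf_lin a powi k) a = 0 powi k"
proof -
  have "rf_eval (rf_lin a ^ n) a = 0 ^ n" for n
    by (induction n) (auto simp: no_pole_mult no_pole_power rf_lin_def)
  with assms show ?thesis by (simp add: power_int_def)
qed

text \<open>A negative power without a pole would be the inverse of a positive power, which vanishes
  at \<open>a\<close>; \<open>rf_eval_nonzero\<close> excludes this.\<close>

lemma no_pole_rf_lin_powi_iff: "\<not> has_pole (rf_lin a powi k) a \<longleftrightarrow> k \<ge> 0"
proof
  assume *: "\<not> has_pole (rf_lin a powi k) a"
  show "k \<ge> 0"
  proof (rule ccontr)
    assume k: "\<not> k \<ge> 0"
    have "rf_lin a powi (- k) * rf_lin a powi k = 1" 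
      by (simp flip: power_int_add)
    from rf_eval_nonzero[OF this _ *] k
    show False by (simp add: no_pole_rf_lin_powi rf_eval_rf_lin_powi)
  qed
qed (rule no_pole_rf_lin_powi)

lemma rf_lin_powi_inj: "rf_lin a powi k = rf_lin a powi l \<longleftrightarrow> k = l"
proof
  assume *: "rf_lin a powi k = rf_lin a powi l"
  have "rf_lin a powi (k - l) = 1" "rf_lin a powi (l - k) = 1" 
    using * by (simp_all add: power_int_diff)
  then have "k - l \<ge> 0" "l - k \<ge> 0"
    using no_pole_rf_lin_powi_iff[of a "k - l"] no_pole_rf_lin_powi_iff[of a "l - k"] by auto
  then show "k = l" by simp
qed simp

text \<open>Splitting all factors \<open>[:- a, 1:]\<close> off numerator and denominator exhibits
  the discrete valuation: \<open>rf_lin a\<close> is the uniformizer, \<open>k\<close> the valuation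
  of \<open>f\<close> and \<open>u\<close> a unit of the local ring.\<close>

lemma rf_lin_decomposition:
  assumes "f \<noteq> 0"
  obtains k u where "f = rf_lin a powi k * u" "u \<noteq> 0" "\<not> has_pole u a" "\<not> has_pole (inverse u) a"
proof -
  have split: "\<exists>n r. p = [:- a, 1:] ^ n * r \<and> poly r a \<noteq> 0" if "p \<noteq> 0" for p :: "'a poly"
    using order_decomp[OF that, of a] by (metis dvd_iff_poly_eq_0 mult.commute poly_eq_0_iff_dvd)
  obtain p q where pq: "q \<noteq> 0" "f = to_fract p / to_fract q"
    by (cases f) (auto simp: Fract_conv_to_fract)
  with assms have "p \<noteq> 0" by auto
  from split[OF this] obtain n r where 1: "p = [:- a, 1:] ^ n * r" "poly r a \<noteq> 0" by auto
  from split[OF pq(1)] obtain n' r' where 2: "q = [:- a, 1:] ^ n' * r'" "poly r' a \<noteq> 0" by auto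
  have to_fract_power: "to_fract (x ^ k) = to_fract x ^ k" for x :: "'a poly" and k
    by (induction k) simp_all
  have pow: "to_fract ([:- a, 1:] ^ k) = rf_lin a powi int k" for k
    unfolding to_fract_power rf_lin_def by simp
  define u where "u = to_fract r / to_fract r'"
  have "f = rf_lin a powi (int n - int n') * u"
    by (simp add: pq(2) 1(1) 2(1) pow u_def power_int_diff)
  moreover have "u \<noteq> 0" "inverse u = to_fract r' / to_fract r" using 1 2 by (auto simp: u_def)
  ultimately show ?thesis
    using that no_poleI(1)[OF 2(2) u_def] no_poleI(1)[OF 1(2)] by blast
qed

section \<open>Matrices over the local ring\<close>

definition no_pole_mat :: "'a::field \<Rightarrow> 'a ratfun mat \<Rightarrow> bool" where
  "no_pole_mat a M \<longleftrightarrow> (\<forall>i<dim_row M. \<forall>j<dim_col M. \<not> has_pole (M $$ (i, j)) a)"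

text \<open>Evaluation at \<open>a\<close> is a ring homomorphism on the local ring. The second part
  is what lets a factorization over the local ring be specialized to one over the field in
  \<open>full_rank_loc_equiv\<close>.\<close>

lemma no_pole_mat_mult:
  assumes "M \<in> carrier_mat p n" "N \<in> carrier_mat n m" "no_pole_mat a M" "no_pole_mat a N"
  shows "no_pole_mat a (M * N)"
    "map_mat (\<lambda>f. rf_eval f a) (M * N) = map_mat (\<lambda>f. rf_eval f a) M * map_mat (\<lambda>f. rf_eval f a) N"
proof -
  have *: "\<not> has_pole ((M * N) $$ (i, j)) a \<and> rf_eval ((M * N) $$ (i, j)) a
      = (map_mat (\<lambda>f. rf_eval f a) M * map_mat (\<lambda>f. rf_eval f a) N) $$ (i, j)"
    if "i < p" "j < m" for i j
  proof -
    have "\<not> has_pole (M $$ (i, k) * N $$ (k, j)) a \<and>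
        rf_eval (M $$ (i, k) * N $$ (k, j)) a = rf_eval (M $$ (i, k)) a * rf_eval (N $$ (k, j)) a"
      if "k \<in> {0..<n}" for k
      using assms \<open>i < p\<close> \<open>j < m\<close> that by (auto simp: no_pole_mat_def no_pole_mult)
    with no_pole_sum[of "{0..<n}" "\<lambda>k. M $$ (i, k) * N $$ (k, j)" a] show ?thesis
      using assms(1,2) that by (auto simp: scalar_prod_def)
  qed
  then show "no_pole_mat a (M * N)"
    "map_mat (\<lambda>f. rf_eval f a) (M * N) = map_mat (\<lambda>f. rf_eval f a) M * map_mat (\<lambda>f. rf_eval f a) N"
    using assms(1,2) by (auto simp: no_pole_mat_def intro!: eq_matI simp del: index_mult_mat(1))
qed

lemma no_pole_mat_0 [simp]: "no_pole_mat a (0\<^sub>m p m)"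
  and no_pole_mat_1 [simp]: "no_pole_mat a (1\<^sub>m n)"
  and no_pole_mat_rat_mat [simp]: "no_pole_mat a (rat_mat P)"
  by (auto simp: no_pole_mat_def)

lemma no_pole_mat_uminus: "no_pole_mat a M \<Longrightarrow> no_pole_mat a (- M)"
  by (auto simp: no_pole_mat_def no_pole_uminus)

lemma no_pole_mat_add:
  "M \<in> carrier_mat p m \<Longrightarrow> N \<in> carrier_mat p m \<Longrightarrow> no_pole_mat a M \<Longrightarrow> no_pole_mat a N
    \<Longrightarrow> no_pole_mat a (M + N)"
  by (auto simp: no_pole_mat_def no_pole_add)

lemma no_pole_mat_four_block:
  assumes "A \<in> carrier_mat p m" "B \<in> carrier_mat p m'" "C \<in> carrier_mat p' m" "D \<in> carrier_mat p' m'"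
  shows "no_pole_mat a (four_block_mat A B C D) \<longleftrightarrow>
    no_pole_mat a A \<and> no_pole_mat a B \<and> no_pole_mat a C \<and> no_pole_mat a D"
  (is "?l \<longleftrightarrow> ?r")
proof
  assume l: ?l
  have *: "\<not> has_pole (four_block_mat A B C D $$ (i, j)) a" if "i < p + p'" "j < m + m'" for i j
    using l that assms by (auto simp: no_pole_mat_def)
  have "\<not> has_pole (A $$ (i, j)) a" if "i < p" "j < m" for i j
    using *[of i j] that assms by auto
  moreover have "\<not> has_pole (B $$ (i, j)) a" if "i < p" "j < m'" for i j
    using *[of i "m + j"] that assms by auto
  moreover have "\<not> has_pole (C $$ (i, j)) a" if "i < p'" "j < m" for i j
    using *[of "p + i" j] that assms by auto
  moreover have "\<not> has_pole (D $$ (i, j)) a" if "i < p'" "j < m'" for i j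
    using *[of "p + i" "m + j"] that assms by auto
  ultimately show ?r using assms by (auto simp: no_pole_mat_def)
next
  assume ?r
  with assms show ?l by (auto simp: no_pole_mat_def)
qed

lemma no_pole_det:
  assumes "M \<in> carrier_mat n n" "no_pole_mat a M"
  shows "\<not> has_pole (det M) a" "rf_eval (det M) a = det (map_mat (\<lambda>f. rf_eval f a) M)"
proof -
  have "\<not> has_pole (signof p * (\<Prod>i = 0..<n. M $$ (i, p i))) a \<and>
      rf_eval (signof p * (\<Prod>i = 0..<n. M $$ (i, p i))) a
        = signof p * (\<Prod>i = 0..<n. map_mat (\<lambda>f. rf_eval f a) M $$ (i, p i))"
    if "p \<in> {p. p permutes {0..<n}}" for p
  proof -
    have p: "p i < n" if "i < n" for i
      using permutes_in_image[of p "{0..<n}" i] \<open>p \<in> _\<close> that by auto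
    have "\<not> has_pole (\<Prod>i = 0..<n. M $$ (i, p i)) a \<and> rf_eval (\<Prod>i = 0..<n. M $$ (i, p i)) a
      = (\<Prod>i = 0..<n. rf_eval (M $$ (i, p i)) a)"
      using assms p by (intro no_pole_prod) (auto simp: no_pole_mat_def)
    moreover have "(\<Prod>i = 0..<n. map_mat (\<lambda>f. rf_eval f a) M $$ (i, p i))
      = (\<Prod>i = 0..<n. rf_eval (M $$ (i, p i)) a)"
      using assms p by (intro prod.cong) auto
    ultimately show ?thesis
      by (cases "evenperm p") (auto simp: sign_def no_pole_uminus)
  qed
  with no_pole_sum[of "{p. p permutes {0..<n}}"
      "\<lambda>p. signof p * (\<Prod>i = 0..<n. M $$ (i, p i))" a]
  show "\<not> has_pole (det M) a" "rf_eval (det M) a = det (map_mat (\<lambda>f. rf_eval f a) M)"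
    using assms(1) by (auto simp: det_def')
qed

text \<open>Units of the matrix ring over the local ring, with the inverse carried as a witness.
  Products, block matrices and cancellations can then be handled without determinants;
  \<open>regular_at_iff\<close> is the bridge to \<open>regular_at\<close>.\<close>

definition loc_inverse :: "'a::field \<Rightarrow> nat \<Rightarrow> 'a ratfun mat \<Rightarrow> 'a ratfun mat \<Rightarrow> bool" where
  "loc_inverse a n U V \<longleftrightarrow> U \<in> carrier_mat n n \<and> V \<in> carrier_mat n n \<and>
     no_pole_mat a U \<and> no_pole_mat a V \<and> U * V = 1\<^sub>m n \<and> V * U = 1\<^sub>m n"

lemma loc_inverseD:
  assumes "loc_inverse a n U V"
  shows "U \<in> carrier_mat n n" "V \<in> carrier_mat n n" "no_pole_mat a U" "no_pole_mat a V"
    "U * V = 1\<^sub>m n" "V * U = 1\<^sub>m n"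
  using assms by (auto simp: loc_inverse_def)

lemma loc_inverse_sym: "loc_inverse a n U V \<Longrightarrow> loc_inverse a n V U"
  by (auto simp: loc_inverse_def)

text \<open>Cramer's rule: if the determinant is a unit of the local ring, then the adjugate divided
  by it has no pole. Conversely the determinants of two mutually inverse pole-free matrices multiply
  to \<open>1\<close>, so neither vanishes at \<open>a\<close>.\<close>

lemma regular_at_iff:
  assumes U: "U \<in> carrier_mat n n"
  shows "regular_at a U \<longleftrightarrow> (\<exists>V. loc_inverse a n U V)"
proof
  assume reg: "regular_at a U"
  then have np: "no_pole_mat a U"
    using U by (auto simp: regular_at_def no_pole_mat_def)
  from reg have "rf_eval (det U) a \<noteq> 0" by (simp add: regular_at_def)
  then have inv: "\<not> has_pole (inverse (det U)) a" and nz: "det U \<noteq> 0"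
    using no_pole_inverse[OF no_pole_det(1)[OF U np]] by auto
  have "\<not> has_pole (cofactor U i j) a" if "i < n" "j < n" for i j
  proof -
    have c: "mat_delete U i j \<in> carrier_mat (n - 1) (n - 1)"
      using U mat_delete_carrier by blast
    have "no_pole_mat a (mat_delete U i j)"
      using np U that by (auto simp: no_pole_mat_def mat_delete_def)
    from no_pole_det(1)[OF c this] no_pole_power[of "- 1" a "i + j"] no_pole_uminus[of 1 a]
    show ?thesis unfolding cofactor_def by (auto simp: no_pole_mult)
  qed
  then have "no_pole_mat a (adj_mat U)"
    using U by (auto simp: no_pole_mat_def adj_mat_def)
  then have "no_pole_mat a (inverse (det U) \<cdot>\<^sub>m adj_mat U)"
    using inv by (auto simp: no_pole_mat_def no_pole_mult)
  moreover have "U * (inverse (det U) \<cdot>\<^sub>m adj_mat U) = 1\<^sub>m n" "(inverse (det U) \<cdot>\<^sub>m adj_mat U) * U = 1\<^sub>m n"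
    using adj_mat[OF U] U nz
    by (auto simp: mult_smult_distrib[OF U adj_mat(1)[OF U]] mult_smult_assoc_mat[OF adj_mat(1)[OF U] U]
        intro!: eq_matI)
  ultimately show "\<exists>V. loc_inverse a n U V"
    using U np adj_mat(1)[OF U] by (auto simp: loc_inverse_def intro!: exI[of _ "inverse (det U) \<cdot>\<^sub>m adj_mat U"])
next
  assume "\<exists>V. loc_inverse a n U V"
  then obtain V where V: "loc_inverse a n U V" ..
  note V = loc_inverseD[OF V]
  have "det U * det V = 1" using V by (metis det_mult det_one)
  from rf_eval_nonzero[OF this] no_pole_det(1)[OF V(1,3)] no_pole_det(1)[OF V(2,4)] V
  show "regular_at a U"
    by (auto simp: regular_at_def no_pole_mat_def elements_mat_def)
qed

lemma loc_inverse_1 [simp]: "loc_inverse a n (1\<^sub>m n) (1\<^sub>m n)"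
  by (simp add: loc_inverse_def)

lemma loc_inverse_mult:
  assumes "loc_inverse a n U U'" "loc_inverse a n V V'"
  shows "loc_inverse a n (U * V) (V' * U')"
proof -
  note U = loc_inverseD[OF assms(1)] and V = loc_inverseD[OF assms(2)]
  have "V * (V' * U') = (V * V') * U'" "U' * (U * V) = (U' * U) * V"
    using U(1,2) V(1,2) by simp_all
  then have "V * (V' * U') = U'" "U' * (U * V) = V" using U V by simp_all
  then have "U * V * (V' * U') = 1\<^sub>m n" "V' * U' * (U * V) = 1\<^sub>m n"
    using U V assoc_mult_mat[OF U(1) V(1) mult_carrier_mat[OF V(2) U(2)]]
      assoc_mult_mat[OF V(2) U(2) mult_carrier_mat[OF U(1) V(1)]] by simp_all
  then show ?thesis
    using U V no_pole_mat_mult(1) by (auto simp: loc_inverse_def)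
qed

section \<open>Block diagonal, block triangular and block permutation matrices\<close>

lemma diag2_eq:
  "diag2 M N = four_block_mat M (0\<^sub>m (dim_row M) (dim_col N)) (0\<^sub>m (dim_row N) (dim_col M)) N"
  by (simp only: diag_block_mat.simps(2)[of M "[N]"] diag_block_mat_singleton Let_def)

declare diag_block_mat.simps [simp del]

lemma diag2_carrier [simp]:
  "M \<in> carrier_mat p m \<Longrightarrow> N \<in> carrier_mat q t \<Longrightarrow> diag2 M N \<in> carrier_mat (p + q) (m + t)"
  unfolding diag2_eq by simp

lemma diag2_mult:
  assumes "A \<in> carrier_mat p n" "B \<in> carrier_mat q k" "C \<in> carrier_mat n m" "D \<in> carrier_mat k t"
  shows "diag2 A B * diag2 C (D :: 'b::comm_ring_1 mat) = diag2 (A * C) (B * D)"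
  using assms
    mult_four_block_mat[of A p n "0\<^sub>m p k" k "0\<^sub>m q n" q B C m "0\<^sub>m n t" t "0\<^sub>m k m" D]
  by (simp add: diag2_eq)

lemma no_pole_mat_diag2: "no_pole_mat a (diag2 M N) \<longleftrightarrow> no_pole_mat a M \<and> no_pole_mat a N"
  unfolding diag2_eq
  by (subst no_pole_mat_four_block[of _ "dim_row M" "dim_col M" _ "dim_col N" _ "dim_row N"]) auto

lemma diag2_1: "diag2 (1\<^sub>m n) (1\<^sub>m k) = (1\<^sub>m (n + k) :: 'b::zero_neq_one mat)"
  by (auto simp: diag2_eq)

lemma loc_inverse_diag2:
  assumes "loc_inverse a n U U'" "loc_inverse a k V V'"
  shows "loc_inverse a (n + k) (diag2 U V) (diag2 U' V')"
proof -
  note U = loc_inverseD[OF assms(1)] and V = loc_inverseD[OF assms(2)]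
  have "diag2 U V * diag2 U' V' = 1\<^sub>m (n + k)" "diag2 U' V' * diag2 U V = 1\<^sub>m (n + k)"
    using U V diag2_mult[OF U(1) V(1) U(2) V(2)] diag2_mult[OF U(2) V(2) U(1) V(1)]
    by (simp_all add: diag2_1)
  then show ?thesis using U V by (simp add: loc_inverse_def no_pole_mat_diag2)
qed

lemma loc_inverse_upper:
  assumes B: "B \<in> carrier_mat n k" and "no_pole_mat a B"
  shows "loc_inverse a (n + k) (four_block_mat (1\<^sub>m n) B (0\<^sub>m k n) (1\<^sub>m k))
    (four_block_mat (1\<^sub>m n) (- B) (0\<^sub>m k n) (1\<^sub>m k))"
proof -
  have "no_pole_mat a (four_block_mat (1\<^sub>m n) B (0\<^sub>m k n) (1\<^sub>m k))"
    "no_pole_mat a (four_block_mat (1\<^sub>m n) (- B) (0\<^sub>m k n) (1\<^sub>m k))"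
    using assms no_pole_mat_uminus[of a B] by (subst no_pole_mat_four_block; auto)+
  moreover have "- B + B = 0\<^sub>m n k" "B + - B = 0\<^sub>m n k" "- 0\<^sub>m k k = (0\<^sub>m k k :: 'a ratfun mat)"
    using B by auto
  then have "four_block_mat (1\<^sub>m n) B (0\<^sub>m k n) (1\<^sub>m k) *
      four_block_mat (1\<^sub>m n) (- B) (0\<^sub>m k n) (1\<^sub>m k) = 1\<^sub>m (n + k)"
    "four_block_mat (1\<^sub>m n) (- B) (0\<^sub>m k n) (1\<^sub>m k) *
      four_block_mat (1\<^sub>m n) B (0\<^sub>m k n) (1\<^sub>m k) = 1\<^sub>m (n + k)"
    using B mult_four_block_mat[of "1\<^sub>m n" n n B k "0\<^sub>m k n" k "1\<^sub>m k" "1\<^sub>m n" n "- B" k "0\<^sub>m k n" "1\<^sub>m k"]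
      mult_four_block_mat[of "1\<^sub>m n" n n "- B" k "0\<^sub>m k n" k "1\<^sub>m k" "1\<^sub>m n" n B k "0\<^sub>m k n" "1\<^sub>m k"]
    by simp_all
  ultimately show ?thesis by (simp add: loc_inverse_def)
qed

lemma loc_inverse_lower:
  assumes B: "B \<in> carrier_mat k n" and "no_pole_mat a B"
  shows "loc_inverse a (n + k) (four_block_mat (1\<^sub>m n) (0\<^sub>m n k) B (1\<^sub>m k))
    (four_block_mat (1\<^sub>m n) (0\<^sub>m n k) (- B) (1\<^sub>m k))"
proof -
  have "no_pole_mat a (four_block_mat (1\<^sub>m n) (0\<^sub>m n k) B (1\<^sub>m k))"
    "no_pole_mat a (four_block_mat (1\<^sub>m n) (0\<^sub>m n k) (- B) (1\<^sub>m k))"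
    using assms no_pole_mat_uminus[of a B] by (subst no_pole_mat_four_block; auto)+
  moreover have "- B + B = 0\<^sub>m k n" "B + - B = 0\<^sub>m k n" "- 0\<^sub>m n n = (0\<^sub>m n n :: 'a ratfun mat)"
    using B by auto
  then have "four_block_mat (1\<^sub>m n) (0\<^sub>m n k) B (1\<^sub>m k) *
      four_block_mat (1\<^sub>m n) (0\<^sub>m n k) (- B) (1\<^sub>m k) = 1\<^sub>m (n + k)"
    "four_block_mat (1\<^sub>m n) (0\<^sub>m n k) (- B) (1\<^sub>m k) *
      four_block_mat (1\<^sub>m n) (0\<^sub>m n k) B (1\<^sub>m k) = 1\<^sub>m (n + k)"
    using B mult_four_block_mat[of "1\<^sub>m n" n n "0\<^sub>m n k" k B k "1\<^sub>m k" "1\<^sub>m n" n "0\<^sub>m n k" k "- B" "1\<^sub>m k"]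
      mult_four_block_mat[of "1\<^sub>m n" n n "0\<^sub>m n k" k "- B" k "1\<^sub>m k" "1\<^sub>m n" n "0\<^sub>m n k" k B "1\<^sub>m k"]
    by simp_all
  ultimately show ?thesis by (simp add: loc_inverse_def)
qed

lemma loc_inverse_swap:
  "loc_inverse a (n + k) (four_block_mat (0\<^sub>m n k) (1\<^sub>m n) (1\<^sub>m k) (0\<^sub>m k n))
    (four_block_mat (0\<^sub>m k n) (1\<^sub>m k) (1\<^sub>m n) (0\<^sub>m n k))"
proof -
  let ?S = "\<lambda>n k. four_block_mat (0\<^sub>m n k) (1\<^sub>m n) (1\<^sub>m k) (0\<^sub>m k n) :: 'a ratfun mat"
  have "no_pole_mat a (?S n k)" for n k
    using no_pole_mat_four_block[of "0\<^sub>m n k" n k "1\<^sub>m n" n "1\<^sub>m k" k "0\<^sub>m k n" a] by simp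
  moreover have "?S n k * ?S k n = 1\<^sub>m (n + k)" for n k
    using mult_four_block_mat[of "0\<^sub>m n k :: 'a ratfun mat" n k "1\<^sub>m n" n "1\<^sub>m k" k "0\<^sub>m k n"
        "0\<^sub>m k n" n "1\<^sub>m k" k "1\<^sub>m n" "0\<^sub>m n k"]
    by simp
  moreover have "?S n k \<in> carrier_mat (n + k) (n + k)" for n k
    by (rule carrier_matI) simp_all
  moreover have "?S k n * ?S n k = 1\<^sub>m (n + k)" "?S k n \<in> carrier_mat (n + k) (n + k)"
    using calculation(2,3)[of k n] by (simp_all add: add.commute)
  ultimately show ?thesis by (simp add: loc_inverse_def)
qed

section \<open>Equivalence of rational matrices over the local ring\<close>

definition loc_equiv :: "'a::field \<Rightarrow> 'a ratfun mat \<Rightarrow> 'a ratfun mat \<Rightarrow> bool" where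
  "loc_equiv a X Y \<longleftrightarrow> (\<exists>P P' Q Q'. loc_inverse a (dim_row Y) P P' \<and> loc_inverse a (dim_col Y) Q Q' \<and>
     X = P * Y * Q)"

lemma loc_equivI:
  assumes "loc_inverse a p P P'" "loc_inverse a m Q Q'" "Y \<in> carrier_mat p m" "X = P * Y * Q"
  shows "loc_equiv a X Y"
  using assms by (auto simp: loc_equiv_def)

lemma loc_equivE:
  assumes "loc_equiv a X Y" "Y \<in> carrier_mat p m"
  obtains P P' Q Q' where "loc_inverse a p P P'" "loc_inverse a m Q Q'" "X = P * Y * Q"
    "X \<in> carrier_mat p m"
proof -
  from assms obtain P P' Q Q' where "loc_inverse a p P P'" "loc_inverse a m Q Q'" "X = P * Y * Q"
    unfolding loc_equiv_def by auto
  moreover from this have "X \<in> carrier_mat p m"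
    using assms(2) loc_inverseD(1) by (metis mult_carrier_mat)
  ultimately show ?thesis by (rule that)
qed

lemma loc_equiv_regular:
  assumes "Y \<in> carrier_mat p m"
  shows "loc_equiv a X Y \<longleftrightarrow> (\<exists>P \<in> carrier_mat p p. \<exists>Q \<in> carrier_mat m m.
    regular_at a P \<and> regular_at a Q \<and> X = P * Y * Q)"
proof
  assume "loc_equiv a X Y"
  then obtain P P' Q Q' where *: "loc_inverse a p P P'" "loc_inverse a m Q Q'" "X = P * Y * Q"
    using assms by (rule loc_equivE)
  moreover have "P \<in> carrier_mat p p" "Q \<in> carrier_mat m m" using * by (auto dest: loc_inverseD(1))
  moreover from this have "regular_at a P" "regular_at a Q" using * by (auto simp: regular_at_iff)
  ultimately show "\<exists>P \<in> carrier_mat p p. \<exists>Q \<in> carrier_mat m m.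
      regular_at a P \<and> regular_at a Q \<and> X = P * Y * Q"
    by (intro bexI[of _ P] bexI[of _ Q]) simp_all
next
  assume "\<exists>P \<in> carrier_mat p p. \<exists>Q \<in> carrier_mat m m.
      regular_at a P \<and> regular_at a Q \<and> X = P * Y * Q"
  then obtain P Q where *: "P \<in> carrier_mat p p" "Q \<in> carrier_mat m m" "regular_at a P"
    "regular_at a Q" "X = P * Y * Q" by auto
  then obtain P' Q' where "loc_inverse a p P P'" "loc_inverse a m Q Q'"
    by (auto simp: regular_at_iff)
  then show "loc_equiv a X Y" using *(5) by (rule loc_equivI[OF _ _ assms])
qed

lemma loc_equiv_carrier:
  assumes "loc_equiv a X Y"
  shows "X \<in> carrier_mat p m \<longleftrightarrow> Y \<in> carrier_mat p m"
  using loc_equivE[OF assms carrier_matI[OF refl refl]] by (metis carrier_matD carrier_matI)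

lemma loc_equiv_refl: "loc_equiv a X X"
  using loc_equivI[OF loc_inverse_1 loc_inverse_1 carrier_matI[OF refl refl], of X]
  by (metis carrier_matI left_mult_one_mat right_mult_one_mat)

lemma loc_equiv_sym:
  assumes "loc_equiv a X Y"
  shows "loc_equiv a Y X"
proof -
  define p m where "p = dim_row Y" "m = dim_col Y"
  then have Y: "Y \<in> carrier_mat p m" by auto
  from assms Y obtain P P' Q Q' where *: "loc_inverse a p P P'" "loc_inverse a m Q Q'"
    "X = P * Y * Q" "X \<in> carrier_mat p m" by (rule loc_equivE)
  note P = loc_inverseD[OF *(1)] and Q = loc_inverseD[OF *(2)]
  have "P' * X * Q' = (P' * P) * Y * (Q * Q')"
    unfolding *(3) using P(1-2) Q(1-2) Y
    by (simp add: assoc_mult_mat[of _ p p _ p _ m] assoc_mult_mat[of _ p p _ m _ m]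
        assoc_mult_mat[of _ p m _ m _ m])
  then have "Y = P' * X * Q'" using P Q Y by simp
  with loc_equivI[OF *(1,2)[THEN loc_inverse_sym] *(4)] show ?thesis by simp
qed

lemma loc_equiv_trans [trans]:
  assumes "loc_equiv a X Y" "loc_equiv a Y Z"
  shows "loc_equiv a X Z"
proof -
  define p m where "p = dim_row Z" "m = dim_col Z"
  then have Z: "Z \<in> carrier_mat p m" by auto
  from assms(2) Z obtain P P' Q Q' where *: "loc_inverse a p P P'" "loc_inverse a m Q Q'"
    "Y = P * Z * Q" "Y \<in> carrier_mat p m" by (rule loc_equivE)
  from assms(1) *(4) obtain R R' S S' where **: "loc_inverse a p R R'" "loc_inverse a m S S'"
    "X = R * Y * S" by (rule loc_equivE)
  have "X = (R * P) * Z * (Q * S)"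
    unfolding *(3) **(3) using *(1,2)[THEN loc_inverseD(1)] **(1,2)[THEN loc_inverseD(1)] Z
    by (simp add: assoc_mult_mat[of _ p p _ p _ m] assoc_mult_mat[of _ p p _ m _ m]
        assoc_mult_mat[of _ p m _ m _ m])
  with loc_equivI[OF loc_inverse_mult[OF **(1) *(1)] loc_inverse_mult[OF *(2) **(2)] Z]
  show ?thesis by simp
qed

lemma loc_equiv_left:
  assumes "loc_inverse a p P P'" "X \<in> carrier_mat p m"
  shows "loc_equiv a (P * X) X"
  using loc_equivI[OF assms(1) loc_inverse_1 assms(2)] loc_inverseD(1)[OF assms(1)] assms(2) by simp

lemma loc_equiv_right:
  assumes "loc_inverse a m Q Q'" "X \<in> carrier_mat p m"
  shows "loc_equiv a (X * Q) X"
  using loc_equivI[OF loc_inverse_1 assms] loc_inverseD(1)[OF assms(1)] assms(2) by simp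

lemma loc_equiv_diag2:
  assumes "loc_equiv a X Y"
  shows "loc_equiv a (diag2 (1\<^sub>m k) X) (diag2 (1\<^sub>m k) Y)"
proof -
  define p m where "p = dim_row Y" "m = dim_col Y"
  then have Y: "Y \<in> carrier_mat p m" by auto
  from assms Y obtain P P' Q Q' where *: "loc_inverse a p P P'" "loc_inverse a m Q Q'"
    "X = P * Y * Q" "X \<in> carrier_mat p m" by (rule loc_equivE)
  note P = loc_inverseD(1)[OF *(1)] and Q = loc_inverseD(1)[OF *(2)]
  have "diag2 (1\<^sub>m k) X = diag2 (1\<^sub>m k) P * diag2 (1\<^sub>m k) Y * diag2 (1\<^sub>m k) Q"
    using P Q Y 
    by (simp add: diag2_mult[of _ k k _ p p _ k _ m] diag2_mult[of _ k k _ p m _ k _ m] *(3)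
        mult_carrier_mat[of _ p p _ m])
  with loc_equivI[OF loc_inverse_diag2[OF loc_inverse_1 *(1)] loc_inverse_diag2[OF loc_inverse_1 *(2)]]
  show ?thesis using Y by simp
qed

text \<open>Block permutations on both sides move the identity to the front. Linearizations append
  it at the end, but only in front of an \<open>sdiag\<close> does it leave a matrix that is again
  an \<open>sdiag\<close> (\<open>diag2_1_sdiag\<close>).\<close>

lemma loc_equiv_diag2_swap: "loc_equiv a (diag2 X (1\<^sub>m k)) (diag2 (1\<^sub>m k) X)"
proof -
  define p m where "p = dim_row X" "m = dim_col X"
  then have X: "X \<in> carrier_mat p m" by auto
  have "four_block_mat (0\<^sub>m p k) (1\<^sub>m p) (1\<^sub>m k) (0\<^sub>m k p) * diag2 (1\<^sub>m k) X
      = four_block_mat (0\<^sub>m p k) X (1\<^sub>m k) (0\<^sub>m k m)"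
    using X mult_four_block_mat[of "0\<^sub>m p k" p k "1\<^sub>m p" p "1\<^sub>m k" k "0\<^sub>m k p"
        "1\<^sub>m k" k "0\<^sub>m k m" m "0\<^sub>m p k" X]
    by (simp add: diag2_eq)
  moreover have "four_block_mat (0\<^sub>m p k) X (1\<^sub>m k) (0\<^sub>m k m) *
      four_block_mat (0\<^sub>m k m) (1\<^sub>m k) (1\<^sub>m m) (0\<^sub>m m k) = diag2 X (1\<^sub>m k)"
    using X mult_four_block_mat[of "0\<^sub>m p k" p k X m "1\<^sub>m k" k "0\<^sub>m k m"
        "0\<^sub>m k m" m "1\<^sub>m k" k "1\<^sub>m m" "0\<^sub>m m k"]
    by (simp add: diag2_eq)
  moreover have "loc_inverse a (k + p) (four_block_mat (0\<^sub>m p k) (1\<^sub>m p) (1\<^sub>m k) (0\<^sub>m k p))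
    (four_block_mat (0\<^sub>m k p) (1\<^sub>m k) (1\<^sub>m p) (0\<^sub>m p k))"
    using loc_inverse_swap[of a p k] by (simp add: add.commute)
  moreover have "diag2 (1\<^sub>m k) X \<in> carrier_mat (k + p) (k + m)" using X by simp
  ultimately show ?thesis using loc_equivI[OF _ loc_inverse_swap] by metis
qed

section \<open>Local Smith--McMillan forms\<close>

text \<open>The entrywise form of the diagonal matrix in \<open>local_smith_mcmillan\<close>, see
  \<open>diag2_mat_diag\<close>. The cut-off \<open>r\<close> replaces the zero block, so that no
  truncated subtraction of dimensions occurs.\<close>

definition sdiag :: "nat \<Rightarrow> nat \<Rightarrow> nat \<Rightarrow> (nat \<Rightarrow> 'b::zero) \<Rightarrow> 'b mat" where
  "sdiag p m r f = mat p m (\<lambda>(i, j). if i = j \<and> i < r then f i else 0)"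

lemma sdiag_carrier [simp]: "sdiag p m r f \<in> carrier_mat p m"
  and sdiag_dim [simp]: "dim_row (sdiag p m r f) = p" "dim_col (sdiag p m r f) = m"
  and sdiag_index [simp]:
    "i < p \<Longrightarrow> j < m \<Longrightarrow> sdiag p m r f $$ (i, j) = (if i = j \<and> i < r then f i else 0)"
  by (auto simp: sdiag_def)

lemma diag2_mat_diag:
  assumes "r \<le> p" "r \<le> m"
  shows "diag2 (mat_diag r f) (0\<^sub>m (p - r) (m - r)) = sdiag p m r f"
  using assms by (auto simp: diag2_eq mat_diag_def)

lemma diag2_1_sdiag:
  "diag2 (1\<^sub>m k) (sdiag p m r f) = sdiag (k + p) (k + m) (k + r) (\<lambda>i. if i < k then 1 else f (i - k))"
  by (rule eq_matI) (auto simp: diag2_eq)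

lemma sdiag_mult:
  fixes f :: "nat \<Rightarrow> 'b::semiring_0"
  assumes M: "M \<in> carrier_mat m n" and r: "r \<le> p" "r \<le> m"
  shows "sdiag p m r f * M = mat p n (\<lambda>(i, j). if i < r then f i * M $$ (i, j) else 0)"
proof (rule eq_matI)
  fix i j assume "i < dim_row (mat p n (\<lambda>(i, j). if i < r then f i * M $$ (i, j) else 0))"
    "j < dim_col (mat p n (\<lambda>(i, j). if i < r then f i * M $$ (i, j) else 0))"
  then have ij: "i < p" "j < n" by auto
  have "(sdiag p m r f * M) $$ (i, j) = (\<Sum>k = 0..<m. sdiag p m r f $$ (i, k) * M $$ (k, j))"
    using ij M by (simp add: scalar_prod_def)
  also have "\<dots> = (\<Sum>k = 0..<m. if i = k then (if i < r then f i * M $$ (i, j) else 0) else 0)"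
    using ij by (intro sum.cong) auto
  finally have "(sdiag p m r f * M) $$ (i, j)
    = (\<Sum>k = 0..<m. if i = k then (if i < r then f i * M $$ (i, j) else 0) else 0)" .
  with ij r show "(sdiag p m r f * M) $$ (i, j) = mat p n (\<lambda>(i, j). if i < r then f i * M $$ (i, j) else 0) $$ (i, j)"
    by simp
qed (use M in auto)

lemma mult_sdiag:
  fixes f :: "nat \<Rightarrow> 'b::semiring_0"
  assumes M: "M \<in> carrier_mat n p" and r: "r \<le> p" "r \<le> m"
  shows "M * sdiag p m r f = mat n m (\<lambda>(i, j). if j < r then M $$ (i, j) * f j else 0)"
proof (rule eq_matI)
  fix i j assume "i < dim_row (mat n m (\<lambda>(i, j). if j < r then M $$ (i, j) * f j else 0))"
    "j < dim_col (mat n m (\<lambda>(i, j). if j < r then M $$ (i, j) * f j else 0))"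
  then have ij: "i < n" "j < m" by auto
  have "(M * sdiag p m r f) $$ (i, j) = (\<Sum>k = 0..<p. M $$ (i, k) * sdiag p m r f $$ (k, j))"
    using ij M by (simp add: scalar_prod_def)
  also have "\<dots> = (\<Sum>k = 0..<p. if k = j then (if j < r then M $$ (i, j) * f j else 0) else 0)"
    using ij by (intro sum.cong) auto
  finally have "(M * sdiag p m r f) $$ (i, j)
    = (\<Sum>k = 0..<p. if k = j then (if j < r then M $$ (i, j) * f j else 0) else 0)" .
  with ij r show "(M * sdiag p m r f) $$ (i, j) = mat n m (\<lambda>(i, j). if j < r then M $$ (i, j) * f j else 0) $$ (i, j)"
    by simp
qed (use M in auto)

lemma sdiag_mult_sdiag:
  fixes f :: "nat \<Rightarrow> 'b::semiring_0"
  assumes "r \<le> p" "r \<le> n" "r \<le> m"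
  shows "sdiag p n r f * sdiag n m r h = sdiag p m r (\<lambda>i. f i * h i)"
  using assms by (subst sdiag_mult[OF sdiag_carrier]) (auto intro!: eq_matI)

lemma map_mat_sdiag: "h 0 = 0 \<Longrightarrow> map_mat h (sdiag p m r f) = sdiag p m r (\<lambda>i. h (f i))"
  by (auto intro!: eq_matI)

lemma sdiag_cong: "(\<And>i. i < r \<Longrightarrow> f i = h i) \<Longrightarrow> sdiag p m r f = sdiag p m r h"
  by (auto intro!: eq_matI)

lemma inverse_mult_cancel:
  fixes U V M :: "'b::semiring_1 mat"
  assumes "U \<in> carrier_mat n n" "V \<in> carrier_mat n n" "U * V = 1\<^sub>m n" "M \<in> carrier_mat n m"
  shows "U * (V * M) = M"
  using assms(3,4) assoc_mult_mat[OF assms(1,2,4), symmetric] by simp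

subsection \<open>Rank\<close>

lemma (in vec_space) col_space_mult_subset:
  assumes "Y \<in> carrier_mat n k" "W \<in> carrier_mat k m"
  shows "col_space (Y * W) \<subseteq> col_space Y"
proof
  fix y assume "y \<in> col_space (Y * W)"
  then obtain x where "y \<in> carrier_vec n" "x \<in> carrier_vec m" "(Y * W) *\<^sub>v x = y"
    using assms col_space_eq[OF mult_carrier_mat[OF assms]] by auto
  then show "y \<in> col_space Y"
    using assms col_space_eq[OF assms(1)] by (auto intro!: bexI[of _ "W *\<^sub>v x"])
qed

lemma (in vec_space) rank_left_inverse:
  assumes Y: "Y \<in> carrier_mat n r" and Z: "Z \<in> carrier_mat r n" and ZY: "Z * Y = 1\<^sub>m r"
  shows "rank Y = r"
proof (rule lin_indpt_full_rank[OF Y])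
  \<comment> \<open>Independence is a property of the set of columns, so coinciding columns must be
    excluded separately; \<open>Z\<close> separates them by sending them to distinct unit
    vectors.\<close>
  have "Z *\<^sub>v col Y i = unit_vec r i" if "i < r" for i
    using col_mult2[OF Z Y that] ZY that by simp
  then have "col Y i \<noteq> col Y j" if "i < r" "j < r" "i \<noteq> j" for i j
    using that by (metis unit_vec_eq)
  then show dist: "distinct (cols Y)"
    using Y by (auto simp: distinct_conv_nth)
  show "lin_indpt (set (cols Y))"
  proof
    assume "lin_dep (set (cols Y))"
    then obtain v where v: "v \<in> carrier_vec r" "v \<noteq> 0\<^sub>v r" "Y *\<^sub>v v = 0\<^sub>v n"
      using lin_depE[OF Y _ dist] by blast
    have "Z * Y *\<^sub>v v = 0\<^sub>v r" using v Y Z by (subst assoc_mult_mat_vec) auto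
    with ZY v show False by simp
  qed
qed

text \<open>\<open>X\<close> and the matrix \<open>Y\<close> of the first \<open>r\<close> columns
  of \<open>P\<close> are right multiples of each other, the entries \<open>f i\<close> being
  invertible. So they have the same column space, and \<open>Y\<close> has rank \<open>r\<close>
  because it has a left inverse.\<close>

lemma mat_rank_diagonalization:
  fixes X :: "'b::field mat"
  assumes P: "P \<in> carrier_mat n n" "P' \<in> carrier_mat n n" "P' * P = 1\<^sub>m n"
    and Q: "Q \<in> carrier_mat m m" "Q' \<in> carrier_mat m m" "Q * Q' = 1\<^sub>m m"
    and X: "X = P * sdiag n m r f * Q" and r: "r \<le> n" "r \<le> m" and nz: "\<And>i. i < r \<Longrightarrow> f i \<noteq> 0"
  shows "mat_rank X = r"
proof -
  interpret vec_space "TYPE('b)" n .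
  define Y where "Y = P * sdiag n r r (\<lambda>_. 1)"
  have Y: "Y \<in> carrier_mat n r" using P by (simp add: Y_def)
  have XC: "X \<in> carrier_mat n m"
    unfolding X by (rule mult_carrier_mat[OF mult_carrier_mat[OF P(1) sdiag_carrier] Q(1)])
  have "(sdiag r n r (\<lambda>_. 1) * P') * Y = sdiag r n r (\<lambda>_. 1) * (P' * Y)"
    using P Y by (simp add: assoc_mult_mat[of _ r n _ n _ r])
  also have "P' * Y = sdiag n r r (\<lambda>_. 1)"
    unfolding Y_def by (rule inverse_mult_cancel[OF P(2,1,3) sdiag_carrier])
  also have "sdiag r n r (\<lambda>_. 1) * sdiag n r r (\<lambda>_. 1) = sdiag r r r (\<lambda>_. 1 :: 'b)"
    using r by (simp add: sdiag_mult_sdiag)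
  also have "\<dots> = 1\<^sub>m r" by (auto intro!: eq_matI)
  finally have rank_Y: "rank Y = r"
    by (rule rank_left_inverse[OF Y mult_carrier_mat[OF sdiag_carrier P(2)]])
  have "Y * (sdiag r m r f * Q) = P * (sdiag n r r (\<lambda>_. 1) * sdiag r m r f) * Q"
    unfolding assoc_mult_mat[OF Y sdiag_carrier Q(1), symmetric]
    unfolding Y_def assoc_mult_mat[OF P(1) sdiag_carrier sdiag_carrier] ..
  then have "X = Y * (sdiag r m r f * Q)" using r by (simp add: X sdiag_mult_sdiag)
  then have 1: "col_space X \<subseteq> col_space Y"
    using col_space_mult_subset[OF Y mult_carrier_mat[OF sdiag_carrier Q(1)]] by simp
  have "X * (Q' * sdiag m r r (\<lambda>i. inverse (f i)))
      = P * sdiag n m r f * (Q * (Q' * sdiag m r r (\<lambda>i. inverse (f i))))"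
    unfolding X by (rule assoc_mult_mat[OF mult_carrier_mat[OF P(1) sdiag_carrier] Q(1)
        mult_carrier_mat[OF Q(2) sdiag_carrier]])
  also have "\<dots> = P * (sdiag n m r f * sdiag m r r (\<lambda>i. inverse (f i)))"
    unfolding inverse_mult_cancel[OF Q sdiag_carrier] by (rule assoc_mult_mat[OF P(1) sdiag_carrier sdiag_carrier])
  also have "\<dots> = P * sdiag n r r (\<lambda>i. f i * inverse (f i))"
    using r by (simp add: sdiag_mult_sdiag)
  also have "\<dots> = Y"
    unfolding Y_def using nz by (intro arg_cong[of _ _ "(*) P"] sdiag_cong) simp
  finally have 2: "col_space Y \<subseteq> col_space X"
    using col_space_mult_subset[OF XC mult_carrier_mat[OF Q(2) sdiag_carrier[of m r r "\<lambda>i. inverse (f i)"]]]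
    by simp
  from 1 2 have "rank X = rank Y" by (simp add: rank_def col_space_def)
  with rank_Y XC show ?thesis by simp
qed

subsection \<open>Uniqueness\<close>

text \<open>The easy half of the Frobenius-Koenig theorem: by the pigeonhole principle every
  permutation sends some row of \<open>I\<close> to a column outside \<open>J\<close>, so every term
  of the Leibniz formula has a zero factor.\<close>

lemma det_zero_block:
  fixes M :: "'b::idom mat"
  assumes M: "M \<in> carrier_mat n n" and I: "I \<subseteq> {0..<n}" and J: "finite J" "card J < card I"
    and zero: "\<And>i j. i \<in> I \<Longrightarrow> j < n \<Longrightarrow> j \<notin> J \<Longrightarrow> M $$ (i, j) = 0"
  shows "det M = 0"
proof -
  have "(\<Prod>i = 0..<n. M $$ (i, p i)) = 0" if p: "p permutes {0..<n}" for p
  proof -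
    have "\<not> p ` I \<subseteq> J"
      using J card_mono[of J "p ` I"] card_image[OF inj_on_subset[OF permutes_inj_on[OF p] I]] by auto
    then obtain i where i: "i \<in> I" "p i \<notin> J" by auto
    with I have "i < n" by auto
    moreover from this have "p i < n" using permutes_in_image[OF p, of i] by simp
    ultimately show ?thesis using zero[OF i(1) _ i(2)] by (intro prod_zero) auto
  qed
  then show ?thesis unfolding det_def'[OF M] by (intro sum.neutral) auto
qed

text \<open>
  If \<open>S(\<nu>) Q = P S(\<mu>)\<close> and more of the \<open>\<nu>\<^sub>i\<close> than of the \<open>\<mu>\<^sub>j\<close> were at most \<open>c\<close>, then the block of \<open>Q\<close> with
  rows \<open>\<nu>\<^sub>i \<le> c\<close> and columns \<open>\<mu>\<^sub>j > c\<close> (or past the rank) would vanish at the point and be too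
  large for \<open>Q\<close> to be regular.
\<close>

lemma smith_count_le:
  assumes "loc_equiv a (sdiag p m (length \<nu>) (\<lambda>i. rf_lin a powi (\<nu> ! i)))
      (sdiag p m (length \<mu>) (\<lambda>i. rf_lin a powi (\<mu> ! i)))" (is "loc_equiv a ?S ?T")
    and len: "length \<nu> \<le> p" "length \<nu> \<le> m" "length \<mu> \<le> p" "length \<mu> \<le> m"
  shows "length (filter (\<lambda>k. k \<le> c) \<nu>) \<le> length (filter (\<lambda>k. k \<le> c) \<mu>)"
proof (rule ccontr)
  assume "\<not> ?thesis"
  define I J where "I = {i. i < length \<nu> \<and> \<nu> ! i \<le> c}" and "J = {j. j < length \<mu> \<and> \<mu> ! j \<le> c}"
  with \<open>\<not> ?thesis\<close> have card: "card J < card I" by (simp add: length_filter_conv_card)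
  from assms(1) sdiag_carrier obtain P P' Q Q' where *: "loc_inverse a p P P'" "loc_inverse a m Q Q'"
    "?S = P * ?T * Q" by (rule loc_equivE)
  note P = loc_inverseD[OF *(1)] and Q = loc_inverseD[OF *(2)]
  have "?S * Q' = P * ?T * (Q * Q')"
    unfolding *(3) by (rule assoc_mult_mat[OF mult_carrier_mat[OF P(1) sdiag_carrier] Q(1,2)])
  then have eq: "?S * Q' = P * ?T" using P(1) Q(5) by (simp add: right_mult_one_mat[of _ p])
  have zero: "rf_eval (Q' $$ (i, j)) a = 0" if i: "i \<in> I" and j: "j < m" "j \<notin> J" for i j
  proof -
    have i': "i < length \<nu>" "\<nu> ! i \<le> c" "i < p" "i < m" using i len by (auto simp: I_def)
    have "rf_lin a powi (\<nu> ! i) * Q' $$ (i, j) = (?S * Q') $$ (i, j)"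
      using i' j Q len by (simp add: sdiag_mult[of _ m m])
    also have "\<dots> = (if j < length \<mu> then P $$ (i, j) * rf_lin a powi (\<mu> ! j) else 0)"
      unfolding eq using i' j P len by (simp add: mult_sdiag[of _ p p])
    finally have e: "rf_lin a powi (\<nu> ! i) * Q' $$ (i, j)
      = (if j < length \<mu> then P $$ (i, j) * rf_lin a powi (\<mu> ! j) else 0)" .
    show ?thesis
    proof (cases "j < length \<mu>")
      case True
      with j have gt: "\<mu> ! j - \<nu> ! i > 0" using i' by (auto simp: J_def)
      have "Q' $$ (i, j) = P $$ (i, j) * rf_lin a powi (\<mu> ! j - \<nu> ! i)"
        using e True by (simp add: power_int_diff field_simps)
      moreover have "\<not> has_pole (P $$ (i, j)) a" 
        using P i' True len by (simp add: no_pole_mat_def)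
      ultimately show ?thesis
        using gt by (simp add: no_pole_mult no_pole_rf_lin_powi rf_eval_rf_lin_powi)
    next
      case False
      with e have "Q' $$ (i, j) = 0" by simp
      then show ?thesis by simp
    qed
  qed
  have "det (map_mat (\<lambda>f. rf_eval f a) Q') = 0"
    using Q(2) len card zero
    by (intro det_zero_block[of _ m I J]) (auto simp: I_def J_def)
  then have "rf_eval (det Q') a = 0" using no_pole_det(2)[OF Q(2,4)] by simp
  moreover have "regular_at a Q'"
    using regular_at_iff[OF Q(2)] loc_inverse_sym[OF *(2)] by auto
  ultimately show False by (simp add: regular_at_def)
qed

text \<open>Compared with \<open>local_smith_mcmillan\<close>, the list may be unsorted and its
  length is only bounded by the dimensions. A form can so be exhibited without sorting; it is unique
  up to \<open>mset\<close>, and its length is shown to be the rank in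
  \<open>mat_rank_smith_form\<close>.\<close>

definition smith_form :: "'a::field \<Rightarrow> 'a ratfun mat \<Rightarrow> int list \<Rightarrow> bool" where
  "smith_form a X \<nu> \<longleftrightarrow> length \<nu> \<le> dim_row X \<and> length \<nu> \<le> dim_col X \<and>
     loc_equiv a X (sdiag (dim_row X) (dim_col X) (length \<nu>) (\<lambda>i. rf_lin a powi (\<nu> ! i)))"

text \<open>\<open>smith_count_le\<close> in both directions fixes the number of orders below each
  threshold; the difference of these numbers at \<open>c\<close> and \<open>c - 1\<close> is the
  multiplicity of \<open>c\<close>.\<close>

lemma smith_form_unique:
  assumes "smith_form a X \<nu>" "smith_form a X \<mu>"
  shows "mset \<nu> = mset \<mu>"
proof -
  have le: "length (filter (\<lambda>k. k \<le> c) \<nu>) = length (filter (\<lambda>k. k \<le> c) \<mu>)" for c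
    using assms unfolding smith_form_def
    by (intro antisym smith_count_le[of a "dim_row X" "dim_col X"]) (auto intro: loc_equiv_trans loc_equiv_sym)
  have count: "int (count (mset xs) c) = int (length (filter (\<lambda>k. k \<le> c) xs)) - int (length (filter (\<lambda>k. k < c) xs))"
    for xs and c :: int
    by (induction xs) auto
  show ?thesis
  proof (rule multiset_eqI)
    fix c show "count (mset \<nu>) c = count (mset \<mu>) c"
      using count[of \<nu> c] count[of \<mu> c] le[of c] le[of "c - 1"] by simp
  qed
qed

lemma mat_rank_smith_form:
  assumes "smith_form a X \<nu>"
  shows "mat_rank X = length \<nu>"
proof -
  let ?S = "sdiag (dim_row X) (dim_col X) (length \<nu>) (\<lambda>i. rf_lin a powi (\<nu> ! i))"
  from assms have "loc_equiv a X ?S" and len: "length \<nu> \<le> dim_row X" "length \<nu> \<le> dim_col X"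
    by (auto simp: smith_form_def)
  from this(1) sdiag_carrier obtain P P' Q Q' where *: "loc_inverse a (dim_row X) P P'"
    "loc_inverse a (dim_col X) Q Q'" "X = P * ?S * Q" by (rule loc_equivE)
  note P = loc_inverseD[OF *(1)] and Q = loc_inverseD[OF *(2)]
  show ?thesis
    by (rule mat_rank_diagonalization[OF P(1,2,6) Q(1,2,5) *(3) len]) simp
qed

subsection \<open>Existence\<close>

lemma no_pole_mat_loc_equiv:
  assumes "loc_equiv a X Y" "no_pole_mat a Y"
  shows "no_pole_mat a X"
proof -
  from assms(1) obtain P P' Q Q' where *: "loc_inverse a (dim_row Y) P P'" "loc_inverse a (dim_col Y) Q Q'"
    "X = P * Y * Q" using carrier_matI[OF refl refl] by (rule loc_equivE)
  note P = loc_inverseD[OF *(1)] and Q = loc_inverseD[OF *(2)]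
  have "no_pole_mat a (P * Y)"
    using P(1,3) assms(2) by (intro no_pole_mat_mult(1)[of _ _ _ Y]) auto
  then show ?thesis
    unfolding *(3) using P(1) Q(1,3)
    by (intro no_pole_mat_mult(1)[of "P * Y" "dim_row Y" "dim_col Y" Q "dim_col Y"]) auto
qed

lemma loc_equiv_smult:
  assumes "loc_equiv a X Y"
  shows "loc_equiv a (c \<cdot>\<^sub>m X) (c \<cdot>\<^sub>m Y)"
proof -
  from assms obtain P P' Q Q' where *: "loc_inverse a (dim_row Y) P P'" "loc_inverse a (dim_col Y) Q Q'"
    "X = P * Y * Q" using carrier_matI[OF refl refl] by (rule loc_equivE)
  note P = loc_inverseD[OF *(1)] and Q = loc_inverseD[OF *(2)]
  have "c \<cdot>\<^sub>m X = P * (c \<cdot>\<^sub>m Y) * Q"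
    unfolding *(3) using P(1) Q(1)
    by (simp add: mult_smult_distrib[of _ "dim_row Y" "dim_row Y" _ "dim_col Y"]
        mult_smult_assoc_mat[of _ "dim_row Y" "dim_col Y" _ "dim_col Y"])
  then show ?thesis using loc_equivI[OF *(1,2)] by auto
qed

lemma no_pole_matD:
  "no_pole_mat a M \<Longrightarrow> i < dim_row M \<Longrightarrow> j < dim_col M \<Longrightarrow> \<not> has_pole (M $$ (i, j)) a"
  by (simp add: no_pole_mat_def)

text \<open>Being pole-free after division by the \<open>k\<close>-th power of
  \<open>rf_lin a\<close> is invariant under equivalence, hence can be read off the diagonal form.
  This keeps the list sorted in \<open>smith_form_exists\<close>, and with \<open>k = 0\<close> it
  shows that polynomial matrices have no negative orders.\<close>

lemma smith_form_lower_bound: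
  assumes "smith_form a X \<nu>" "no_pole_mat a (rf_lin a powi (- k) \<cdot>\<^sub>m X)" "l \<in> set \<nu>"
  shows "k \<le> l"
proof -
  let ?S = "sdiag (dim_row X) (dim_col X) (length \<nu>) (\<lambda>i. rf_lin a powi (\<nu> ! i))"
  from assms(1) have "loc_equiv a ?S X" and len: "length \<nu> \<le> dim_row X" "length \<nu> \<le> dim_col X"
    by (auto simp: smith_form_def loc_equiv_sym)
  then have np: "no_pole_mat a (rf_lin a powi (- k) \<cdot>\<^sub>m ?S)"
    using no_pole_mat_loc_equiv[OF loc_equiv_smult assms(2)] by blast
  from assms(3) obtain i where i: "i < length \<nu>" "l = \<nu> ! i" by (auto simp: in_set_conv_nth)
  with len have i': "i < dim_row X" "i < dim_col X" by auto
  have "\<not> has_pole (rf_lin a powi (- k) * rf_lin a powi l) a"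
    using no_pole_matD[OF np, of i i] i i' by simp
  then have "\<not> has_pole (rf_lin a powi (l - k)) a" by (simp flip: power_int_add)
  then show ?thesis by (simp add: no_pole_rf_lin_powi_iff)
qed

lemma loc_inverse_swaprows:
  assumes "k < n" "l < n"
  shows "loc_inverse a n (swaprows_mat n k l) (swaprows_mat n k l)"
  using swaprows_mat_inv[OF assms] by (auto simp: loc_inverse_def no_pole_mat_def)

text \<open>An entry of least valuation divides every entry over the local ring, which makes it a
  suitable pivot.\<close>

lemma minimal_order_entry:
  assumes X: "X \<in> carrier_mat p m" "X \<noteq> 0\<^sub>m p m"
  obtains i j v u where "i < p" "j < m" "X $$ (i, j) = rf_lin a powi v * u" "u \<noteq> 0"
    "\<not> has_pole (inverse u) a" "\<not> has_pole u a" "no_pole_mat a (rf_lin a powi (- v) \<cdot>\<^sub>m X)"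
proof -
  define ok where "ok f w \<longleftrightarrow> f = rf_lin a powi fst w * snd w \<and> snd w \<noteq> 0 \<and>
    \<not> has_pole (snd w) a \<and> \<not> has_pole (inverse (snd w)) a" for f and w :: "int \<times> 'a ratfun"
  have "\<exists>w. ok f w" if "f \<noteq> 0" for f
    using rf_lin_decomposition[OF that, of a] unfolding ok_def by (metis fst_conv snd_conv)
  then obtain w where w: "\<And>f. f \<noteq> 0 \<Longrightarrow> ok f (w f)" by metis
  define E where "E = {(i, j). i < p \<and> j < m \<and> X $$ (i, j) \<noteq> 0}"
  have fin: "finite E"
    by (rule finite_subset[of _ "{..<p} \<times> {..<m}"]) (auto simp: E_def)
  have "E \<noteq> {}"
  proof
    assume "E = {}"
    then have "X = 0\<^sub>m p m" using X by (intro eq_matI) (auto simp: E_def)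
    with X show False by simp
  qed
  define val where "val e = fst (w (X $$ e))" for e
  define v where "v = Min (val ` E)"
  have "v \<in> val ` E" using fin \<open>E \<noteq> {}\<close> by (auto simp: v_def)
  then obtain i j where ij: "(i, j) \<in> E" "v = val (i, j)" by auto
  have min: "v \<le> val e" if "e \<in> E" for e using fin that by (auto simp: v_def)
  have "\<not> has_pole (rf_lin a powi (- v) * X $$ (i, j)) a" if "i < p" "j < m" for i j
  proof (cases "X $$ (i, j) = 0")
    case False
    with that have e: "(i, j) \<in> E" by (auto simp: E_def)
    from w[OF False] have "X $$ (i, j) = rf_lin a powi val (i, j) * snd (w (X $$ (i, j)))"
      and np: "\<not> has_pole (snd (w (X $$ (i, j)))) a" by (auto simp: ok_def val_def)
    then have "rf_lin a powi (- v) * X $$ (i, j)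
        = rf_lin a powi (val (i, j) - v) * snd (w (X $$ (i, j)))"
      by (simp add: power_int_diff power_int_minus field_simps)
    then show ?thesis using min[OF e] np by (simp add: no_pole_mult no_pole_rf_lin_powi)
  qed simp
  then have "no_pole_mat a (rf_lin a powi (- v) \<cdot>\<^sub>m X)" using X by (auto simp: no_pole_mat_def)
  moreover have "X $$ (i, j) = rf_lin a powi v * snd (w (X $$ (i, j)))" "snd (w (X $$ (i, j))) \<noteq> 0"
    "\<not> has_pole (inverse (snd (w (X $$ (i, j))))) a" "\<not> has_pole (snd (w (X $$ (i, j)))) a" "i < p" "j < m"
    using w[of "X $$ (i, j)"] ij by (auto simp: E_def ok_def val_def)
  ultimately show ?thesis using that by blast
qed

context
  notes One_nat_def [simp del]
begin

text \<open>Block elimination with a pivot of size one: two shears around the pivot and its Schur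
  complement. \<open>One_nat_def\<close> is switched off so that the dimension \<open>1\<close>
  keeps its form and the block rules still match.\<close>

lemma pivot_elimination:
  fixes E b c :: "'b::field mat"
  assumes "b \<in> carrier_mat 1 m" "c \<in> carrier_mat p 1" "E \<in> carrier_mat p m" "w \<noteq> 0"
  shows "four_block_mat (w \<cdot>\<^sub>m 1\<^sub>m 1) b c E
    = four_block_mat (1\<^sub>m 1) (0\<^sub>m 1 p) (inverse w \<cdot>\<^sub>m c) (1\<^sub>m p) *
      diag2 (w \<cdot>\<^sub>m 1\<^sub>m 1) (E - inverse w \<cdot>\<^sub>m (c * b)) *
      four_block_mat (1\<^sub>m 1) (inverse w \<cdot>\<^sub>m b) (0\<^sub>m m 1) (1\<^sub>m m)"
proof -
  let ?W = "w \<cdot>\<^sub>m 1\<^sub>m 1 :: 'b mat" and ?E = "E - inverse w \<cdot>\<^sub>m (c * b)"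
  have E: "?E \<in> carrier_mat p m" using assms by auto
  have [simp]: "inverse w \<cdot>\<^sub>m c * ?W = c" "?W * (inverse w \<cdot>\<^sub>m b) = b"
    "c * (inverse w \<cdot>\<^sub>m b) = inverse w \<cdot>\<^sub>m (c * b)"
    using assms by (auto simp: mult_smult_distrib[of _ p 1 _ 1] mult_smult_distrib[of _ 1 1 _ m]
        mult_smult_assoc_mat[of _ p 1 _ 1] mult_smult_assoc_mat[of _ 1 1 _ m] mult_smult_distrib[of c p 1 _ m]
        intro!: eq_matI)
  have "four_block_mat (1\<^sub>m 1) (0\<^sub>m 1 p) (inverse w \<cdot>\<^sub>m c) (1\<^sub>m p) * diag2 ?W ?E
      = four_block_mat ?W (0\<^sub>m 1 m) c ?E"
    using assms E mult_four_block_mat[of "1\<^sub>m 1" 1 1 "0\<^sub>m 1 p" p "inverse w \<cdot>\<^sub>m c" p "1\<^sub>m p"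
        ?W 1 "0\<^sub>m 1 m" m "0\<^sub>m p 1" ?E]
    by (simp add: diag2_eq right_add_zero_mat[of _ p 1])
  moreover have "inverse w \<cdot>\<^sub>m (c * b) + ?E = E" using assms by (intro eq_matI) auto
  then have "four_block_mat ?W (0\<^sub>m 1 m) c ?E *
      four_block_mat (1\<^sub>m 1) (inverse w \<cdot>\<^sub>m b) (0\<^sub>m m 1) (1\<^sub>m m) = four_block_mat ?W b c E"
    using assms E mult_four_block_mat[of ?W 1 1 "0\<^sub>m 1 m" m c p ?E
        "1\<^sub>m 1" 1 "inverse w \<cdot>\<^sub>m b" m "0\<^sub>m m 1" "1\<^sub>m m"]
    by simp
  ultimately show ?thesis by simp
qed

end

text \<open>Elimination by induction on the number of rows. A pivot of least order \<open>v\<close>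
  makes the shears pole-free, and all entries of the Schur complement have order at least
  \<open>v\<close>, so putting \<open>v\<close> in front of the orders of that complement keeps the
  list sorted.\<close>

lemma smith_form_exists:
  obtains \<nu> where "sorted \<nu>" "smith_form a X \<nu>"
proof -
  have "X \<in> carrier_mat p m \<Longrightarrow> \<exists>\<nu>. sorted \<nu> \<and> smith_form a X \<nu>" for p m X
  proof (induction p arbitrary: m X)
    case 0
    then have "X = sdiag 0 m 0 (\<lambda>i. rf_lin a powi ([] ! i))" by (intro eq_matI) auto
    with 0 show ?case by (intro exI[of _ "[]"]) (auto simp: smith_form_def loc_equiv_refl)
  next
    case (Suc p)
    show ?case
    proof (cases "X = 0\<^sub>m (Suc p) m")
      case True
      then have "X = sdiag (Suc p) m 0 (\<lambda>i. rf_lin a powi ([] ! i))" by (intro eq_matI) auto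
      with Suc.prems show ?thesis by (intro exI[of _ "[]"]) (auto simp: smith_form_def loc_equiv_refl)
    next
      case False
      obtain i j v u where ij: "i < Suc p" "j < m" "X $$ (i, j) = rf_lin a powi v * u" "u \<noteq> 0"
        "\<not> has_pole (inverse u) a" "\<not> has_pole u a" and min: "no_pole_mat a (rf_lin a powi (- v) \<cdot>\<^sub>m X)"
        using minimal_order_entry[OF Suc.prems False] .
      define m' where "m' = m - 1"
      have m: "m = Suc m'" using ij(2) by (simp add: m'_def)
      define Y where "Y = swaprows_mat (Suc p) 0 i * X * swaprows_mat m 0 j"
      have Y: "Y \<in> carrier_mat (Suc p) m"
        unfolding Y_def by (rule mult_carrier_mat[OF mult_carrier_mat[OF _ Suc.prems]]) simp_all
      have XY: "loc_equiv a Y X"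
        using loc_equivI[OF loc_inverse_swaprows loc_inverse_swaprows Suc.prems Y_def] ij m by auto
      have npY: "no_pole_mat a (rf_lin a powi (- v) \<cdot>\<^sub>m Y)"
        by (rule no_pole_mat_loc_equiv[OF loc_equiv_smult[OF XY] min])
      define w where "w = rf_lin a powi v * u"
      have w: "w \<noteq> 0" using ij by (simp add: w_def)
      have Y00: "Y $$ (0, 0) = w"
      proof -
        have "swaprows_mat (Suc p) 0 i * X \<in> carrier_mat (Suc p) m"
          by (rule mult_carrier_mat[OF swaprows_mat_carrier Suc.prems])
        from swapcols_mat[OF this, of 0 j] ij m have "Y = swapcols 0 j (swaprows_mat (Suc p) 0 i * X)"
          by (simp only: Y_def)
        also have "swaprows_mat (Suc p) 0 i * X = swaprows 0 i X"
          using swaprows_mat[OF Suc.prems, of 0 i] ij by simp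
        finally have "Y = swapcols 0 j (swaprows 0 i X)" .
        then show ?thesis using ij m Suc.prems by (auto simp: w_def)
      qed
      define b c E where "b = mat 1 m' (\<lambda>(i, j). Y $$ (0, Suc j))"
        and "c = mat p 1 (\<lambda>(i, j). Y $$ (Suc i, 0))" and "E = mat p m' (\<lambda>(i, j). Y $$ (Suc i, Suc j))"
      have bcE: "b \<in> carrier_mat 1 m'" "c \<in> carrier_mat p 1" "E \<in> carrier_mat p m'"
        by (auto simp: b_def c_def E_def)
      have Yblock: "Y = four_block_mat (w \<cdot>\<^sub>m 1\<^sub>m 1) b c E"
        using Y Y00 by (intro eq_matI) (auto simp: b_def c_def E_def m)
      have inv_w: "inverse w = inverse u * rf_lin a powi (- v)"
        by (simp add: w_def power_int_minus)
      have entry: "\<not> has_pole (rf_lin a powi (- v) * Y $$ (k, l)) a" if "k < Suc p" "l < m" for k l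
        using no_pole_matD[OF npY, of k l] that Y by simp
      \<comment> \<open>The minimality of \<open>v\<close> is used here: dividing by the pivot
        \<open>w\<close> creates no pole, so the two shears of \<open>pivot_elimination\<close> are
        invertible over the local ring.\<close>
      then have div: "\<not> has_pole (inverse w * Y $$ (k, l)) a" if "k < Suc p" "l < m" for k l
        using no_pole_mult(1)[OF ij(5) entry[OF that]] by (simp add: inv_w mult.assoc)
      have np_bc: "no_pole_mat a (inverse w \<cdot>\<^sub>m b)" "no_pole_mat a (inverse w \<cdot>\<^sub>m c)"
        using div by (auto simp: no_pole_mat_def b_def c_def m)
      define F where "F = E - inverse w \<cdot>\<^sub>m (c * b)"
      have F: "F \<in> carrier_mat p m'" using bcE by (auto simp: F_def)
      \<comment> \<open>In the correction term the power \<open>rf_lin a powi (- v)\<close> is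
        absorbed by the entry from the first column, while \<open>inverse w\<close> is absorbed by
        the entry from the first row.\<close>
      have "\<not> has_pole (rf_lin a powi (- v) * F $$ (k, l)) a" if "k < p" "l < m'" for k l
      proof -
        have F: "F $$ (k, l) = Y $$ (Suc k, Suc l) - inverse w * (Y $$ (Suc k, 0) * Y $$ (0, Suc l))"
          using that by (simp add: F_def E_def c_def b_def scalar_prod_def)
        have "rf_lin a powi (- v) * F $$ (k, l) = rf_lin a powi (- v) * Y $$ (Suc k, Suc l) -
            (rf_lin a powi (- v) * Y $$ (Suc k, 0)) * (inverse w * Y $$ (0, Suc l))"
          unfolding F by (simp add: right_diff_distrib mult_ac)
        with entry[of "Suc k" "Suc l"] entry[of "Suc k" 0] div[of 0 "Suc l"] that show ?thesis
          by (simp add: m no_pole_diff no_pole_mult)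
      qed
      then have npF: "no_pole_mat a (rf_lin a powi (- v) \<cdot>\<^sub>m F)"
        using F by (auto simp: no_pole_mat_def)
      obtain \<mu> where \<mu>: "sorted \<mu>" "smith_form a F \<mu>" using Suc.IH[OF F] by auto
      have vle: "v \<le> l" if "l \<in> set \<mu>" for l by (rule smith_form_lower_bound[OF \<mu>(2) npF that])
      let ?S = "sdiag p m' (length \<mu>) (\<lambda>i. rf_lin a powi (\<mu> ! i))"
      have "loc_equiv a F ?S" and len: "length \<mu> \<le> p" "length \<mu> \<le> m'"
        using \<mu>(2) F by (auto simp: smith_form_def)
      from this(1) sdiag_carrier obtain P P' Q Q' where PQ: "loc_inverse a p P P'"
        "loc_inverse a m' Q Q'" "F = P * ?S * Q" by (rule loc_equivE)
      \<comment> \<open>The unit part \<open>u\<close> of the pivot goes into the left factor, so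
        that a pure power of \<open>rf_lin a\<close> remains on the diagonal.\<close>
      have "loc_inverse a 1 (u \<cdot>\<^sub>m 1\<^sub>m 1) (inverse u \<cdot>\<^sub>m 1\<^sub>m 1)"
        using ij(4-6) by (auto simp: loc_inverse_def no_pole_mat_def scalar_prod_def intro!: eq_matI)
      note U = loc_inverse_diag2[OF this PQ(1)]
      note V = loc_inverse_diag2[OF loc_inverse_1[of a 1] PQ(2)]
      let ?T = "diag2 (rf_lin a powi v \<cdot>\<^sub>m 1\<^sub>m 1) ?S"
      have T: "?T \<in> carrier_mat (1 + p) (1 + m')" by (rule diag2_carrier) simp_all
      note PQC = loc_inverseD(1)[OF PQ(1)] loc_inverseD(1)[OF PQ(2)]
      have "diag2 (u \<cdot>\<^sub>m 1\<^sub>m 1) P * ?T = diag2 ((u \<cdot>\<^sub>m 1\<^sub>m 1) * (rf_lin a powi v \<cdot>\<^sub>m 1\<^sub>m 1)) (P * ?S)"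
        using PQC by (intro diag2_mult[of _ 1 1 _ p p _ 1 _ m']) simp_all
      also have "(u \<cdot>\<^sub>m 1\<^sub>m 1) * (rf_lin a powi v \<cdot>\<^sub>m 1\<^sub>m 1) = w \<cdot>\<^sub>m 1\<^sub>m 1"
        by (rule eq_matI) (auto simp: w_def scalar_prod_def)
      also have "diag2 (w \<cdot>\<^sub>m 1\<^sub>m 1) (P * ?S) * diag2 (1\<^sub>m 1) Q = diag2 (w \<cdot>\<^sub>m 1\<^sub>m 1 * 1\<^sub>m 1) (P * ?S * Q)"
        using PQC by (intro diag2_mult[of _ 1 1 _ p m' _ 1 _ m']) simp_all
      finally have "diag2 (w \<cdot>\<^sub>m 1\<^sub>m 1) F = diag2 (u \<cdot>\<^sub>m 1\<^sub>m 1) P * ?T * diag2 (1\<^sub>m 1) Q"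
        using PQ(3) by simp
      then have FT: "loc_equiv a (diag2 (w \<cdot>\<^sub>m 1\<^sub>m 1) F) ?T" by (rule loc_equivI[OF U V T])
      have YF: "loc_equiv a Y (diag2 (w \<cdot>\<^sub>m 1\<^sub>m 1) F)"
        unfolding Yblock pivot_elimination[OF bcE w] F_def[symmetric]
        using bcE F by (intro loc_equivI[OF loc_inverse_lower[OF _ np_bc(2)] loc_inverse_upper[OF _ np_bc(1)] _ refl]
            diag2_carrier) simp_all
      have TS: "?T = sdiag (Suc p) m (length (v # \<mu>)) (\<lambda>i. rf_lin a powi ((v # \<mu>) ! i))"
        by (rule eq_matI) (auto simp: diag2_eq m nth_Cons')
      have "loc_equiv a X Y" by (rule loc_equiv_sym[OF XY])
      also note YF
      also note FT
      finally have "loc_equiv a X (sdiag (Suc p) m (length (v # \<mu>)) (\<lambda>i. rf_lin a powi ((v # \<mu>) ! i)))"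
        unfolding TS .
      moreover have "sorted (v # \<mu>)" using \<mu>(1) vle by simp
      ultimately show ?thesis using Suc.prems len m
        by (intro exI[of _ "v # \<mu>"]) (auto simp: smith_form_def)
    qed
  qed
  then show ?thesis using that by blast
qed

section \<open>Invariant orders\<close>

lemma smith_formI:
  assumes "X \<in> carrier_mat p m" "length \<nu> \<le> p" "length \<nu> \<le> m"
    "loc_equiv a X (sdiag p m (length \<nu>) (\<lambda>i. rf_lin a powi (\<nu> ! i)))"
  shows "smith_form a X \<nu>"
  using assms by (auto simp: smith_form_def)

lemma smith_formD:
  assumes "smith_form a X \<nu>" "X \<in> carrier_mat p m"
  shows "length \<nu> \<le> p" "length \<nu> \<le> m"
    "loc_equiv a X (sdiag p m (length \<nu>) (\<lambda>i. rf_lin a powi (\<nu> ! i)))"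
  using assms by (auto simp: smith_form_def)

text \<open>The rank condition on the left bounds the length of \<open>\<nu>\<close> by both
  dimensions, as the comparison with some existing form \<open>\<mu>\<close> shows; under that bound
  the truncated subtractions in the zero block are exact and the block matrix is an
  \<open>sdiag\<close>.\<close>

lemma local_smith_mcmillan_iff: "local_smith_mcmillan a G \<nu> \<longleftrightarrow> sorted \<nu> \<and> smith_form a G \<nu>"
proof -
  have G: "G \<in> carrier_mat (dim_row G) (dim_col G)" by simp
  obtain \<mu> where \<mu>: "smith_form a G \<mu>" by (rule smith_form_exists)
  let ?E = "\<exists>R1 \<in> carrier_mat (dim_row G) (dim_row G). \<exists>R2 \<in> carrier_mat (dim_col G) (dim_col G).
        regular_at a R1 \<and> regular_at a R2 \<and>
        G = R1 * diag2 (mat_diag (length \<nu>) (\<lambda>i. rf_lin a powi (\<nu> ! i)))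
                       (0\<^sub>m (dim_row G - length \<nu>) (dim_col G - length \<nu>)) * R2"
  let ?S = "sdiag (dim_row G) (dim_col G) (length \<nu>) (\<lambda>i. rf_lin a powi (\<nu> ! i))"
  have *: "?E \<longleftrightarrow> loc_equiv a G ?S" if "length \<nu> \<le> dim_row G" "length \<nu> \<le> dim_col G"
    unfolding loc_equiv_regular[OF sdiag_carrier] diag2_mat_diag[OF that] ..
  show ?thesis
  proof
    assume "local_smith_mcmillan a G \<nu>"
    note l = this[unfolded local_smith_mcmillan_def]
    note l = conjunct1[OF l] conjunct1[OF conjunct2[OF l]] conjunct2[OF conjunct2[OF l]]
    from l(1) have len: "length \<nu> \<le> dim_row G" "length \<nu> \<le> dim_col G"
      using mat_rank_smith_form[OF \<mu>] smith_formD(1,2)[OF \<mu> G] by simp_all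
    from l(2) smith_formI[OF G len] *[OF len] l(3) show "sorted \<nu> \<and> smith_form a G \<nu>" by simp
  next
    assume r: "sorted \<nu> \<and> smith_form a G \<nu>"
    then have len: "length \<nu> \<le> dim_row G" "length \<nu> \<le> dim_col G" and "loc_equiv a G ?S"
      using smith_formD[OF _ G, of a \<nu>] by simp_all
    then have ?E using *[OF len] by simp
    with r mat_rank_smith_form[of a G \<nu>] show "local_smith_mcmillan a G \<nu>"
      unfolding local_smith_mcmillan_def by (intro conjI) simp_all
  qed
qed

lemma sorted_mset_unique: "sorted xs \<Longrightarrow> sorted ys \<Longrightarrow> mset xs = mset ys \<Longrightarrow> xs = ys"
  by (metis properties_for_sort)

text \<open>Existence and uniqueness justify the \<open>THE\<close> in the definition, since a
  sorted list is determined by its multiset.\<close>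

lemma invariant_orders: "sorted (invariant_orders a G)" "smith_form a G (invariant_orders a G)"
proof -
  obtain \<nu> where "sorted \<nu>" "smith_form a G \<nu>" by (rule smith_form_exists)
  then have "\<exists>!\<nu>. local_smith_mcmillan a G \<nu>"
    unfolding local_smith_mcmillan_iff by (metis smith_form_unique sorted_mset_unique)
  from theI'[OF this, folded invariant_orders_def]
  show "sorted (invariant_orders a G)" "smith_form a G (invariant_orders a G)"
    by (auto simp: local_smith_mcmillan_iff)
qed

lemma mset_invariant_orders: "smith_form a G \<nu> \<Longrightarrow> mset (invariant_orders a G) = mset \<nu>"
  using smith_form_unique invariant_orders(2) by blast

lemma length_invariant_orders: "length (invariant_orders a G) = mat_rank G"
  using mat_rank_smith_form[OF invariant_orders(2)[of a G]] by simp

text \<open>Each matrix is equivalent to the diagonal of its own orders, and sorted lists with the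
  same multiset coincide; so the orders are a complete invariant.\<close>

lemma loc_equiv_iff_invariant_orders:
  assumes "X \<in> carrier_mat p m" "Y \<in> carrier_mat p m"
  shows "loc_equiv a X Y \<longleftrightarrow> mset (invariant_orders a X) = mset (invariant_orders a Y)"
proof
  note X = smith_formD[OF invariant_orders(2)[of a] assms(1)]
  note Y = smith_formD[OF invariant_orders(2)[of a] assms(2)]
  {
    assume "loc_equiv a X Y"
    from smith_formI[OF assms(1) Y(1,2) loc_equiv_trans[OF this Y(3)]]
    show "mset (invariant_orders a X) = mset (invariant_orders a Y)" by (rule mset_invariant_orders)
  next
    assume "mset (invariant_orders a X) = mset (invariant_orders a Y)"
    then have "invariant_orders a X = invariant_orders a Y"
      using sorted_mset_unique invariant_orders(1) by blast
    with X(3) have "loc_equiv a X (sdiag p m (length (invariant_orders a Y)) (\<lambda>i. rf_lin a powi (invariant_orders a Y ! i)))"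
      by simp
    then show "loc_equiv a X Y" using loc_equiv_trans[OF _ loc_equiv_sym[OF Y(3)]] by blast
  }
qed

lemma invariant_orders_sdiag:
  assumes "loc_equiv a X (sdiag p m r (\<lambda>i. rf_lin a powi (f i)))" "r \<le> p" "r \<le> m"
  shows "mset (invariant_orders a X) = mset (map f [0..<r])"
proof (rule mset_invariant_orders, rule smith_formI)
  show "X \<in> carrier_mat p m" using loc_equiv_carrier[OF assms(1)] by simp
  have "sdiag p m r (\<lambda>i. rf_lin a powi (f i))
      = sdiag p m (length (map f [0..<r])) (\<lambda>i. rf_lin a powi (map f [0..<r] ! i))"
    by (auto intro!: eq_matI)
  with assms(1) show "loc_equiv a X (sdiag p m (length (map f [0..<r])) (\<lambda>i. rf_lin a powi (map f [0..<r] ! i)))"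
    by simp
qed (use assms in auto)

text \<open>The added ones are powers with exponent \<open>0\<close>. The resulting list of
  exponents need not be sorted, which is harmless for \<open>smith_form\<close>.\<close>

lemma invariant_orders_diag2:
  "mset (invariant_orders a (diag2 (1\<^sub>m k) X)) = replicate_mset k 0 + mset (invariant_orders a X)"
proof -
  define \<nu> where "\<nu> = invariant_orders a X"
  have X: "X \<in> carrier_mat (dim_row X) (dim_col X)" by simp
  note \<nu> = smith_formD[OF invariant_orders(2)[of a] X, folded \<nu>_def]
  have "diag2 (1\<^sub>m k) (sdiag (dim_row X) (dim_col X) (length \<nu>) (\<lambda>i. rf_lin a powi (\<nu> ! i)))
    = sdiag (k + dim_row X) (k + dim_col X) (k + length \<nu>) (\<lambda>i. rf_lin a powi (if i < k then 0 else \<nu> ! (i - k)))"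
    unfolding diag2_1_sdiag by (rule sdiag_cong) simp
  from loc_equiv_diag2[OF \<nu>(3), where k = k, unfolded this]
  have "mset (invariant_orders a (diag2 (1\<^sub>m k) X))
      = mset (map (\<lambda>i. if i < k then 0 else \<nu> ! (i - k)) [0..<k + length \<nu>])"
    by (rule invariant_orders_sdiag) (use \<nu>(1,2) in simp_all)
  also have "map (\<lambda>i. if i < k then 0 else \<nu> ! (i - k)) [0..<k + length \<nu>] = replicate k 0 @ \<nu>"
    by (rule nth_equalityI) (auto simp: nth_append)
  finally show ?thesis by (simp add: \<nu>_def)
qed

section \<open>Coprime fractions\<close>

text \<open>The factor is \<open>U = E1 * D0\<close>, a priori only rational since \<open>E1\<close>
  may have poles. Multiplying the Bezout identity of the second fraction by it gives
  \<open>U = X1 * N0 + Y1 * D0\<close>, which has no pole. The local fact \<open>quotient\<close> is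
  applied a second time with the roles exchanged, which gives the same for the inverse
  \<open>E0 * D1\<close>.\<close>

lemma coprime_fraction_unique:
  fixes S :: "'a::field ratfun mat"
  assumes S: "S \<in> carrier_mat q t"
    and N: "N0 \<in> carrier_mat q t" "N1 \<in> carrier_mat q t" "no_pole_mat a N0" "no_pole_mat a N1"
    and D: "D0 \<in> carrier_mat t t" "D1 \<in> carrier_mat t t" "no_pole_mat a D0" "no_pole_mat a D1"
    and SD: "S * D0 = N0" "S * D1 = N1"
    and E: "E0 \<in> carrier_mat t t" "E1 \<in> carrier_mat t t" "D0 * E0 = 1\<^sub>m t" "D1 * E1 = 1\<^sub>m t"
    and X: "X0 \<in> carrier_mat t q" "X1 \<in> carrier_mat t q" "no_pole_mat a X0" "no_pole_mat a X1"
    and Y: "Y0 \<in> carrier_mat t t" "Y1 \<in> carrier_mat t t" "no_pole_mat a Y0" "no_pole_mat a Y1"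
    and bezout: "X0 * N0 + Y0 * D0 = 1\<^sub>m t" "X1 * N1 + Y1 * D1 = 1\<^sub>m t"
  obtains U U' where "loc_inverse a t U U'" "N0 = N1 * U" "D0 = D1 * U"
proof -
  have E': "E0 * D0 = 1\<^sub>m t" "E1 * D1 = 1\<^sub>m t"
    using mat_mult_left_right_inverse[OF D(1) E(1,3)] mat_mult_left_right_inverse[OF D(2) E(2,4)] by auto
  have quotient: "D' * (F' * D) = D \<and> N' * (F' * D) = N \<and> no_pole_mat a (F' * D)"
    if *: "D \<in> carrier_mat t t" "D' \<in> carrier_mat t t" "F' \<in> carrier_mat t t" "D' * F' = 1\<^sub>m t"
      "S * D = N" "S * D' = N'" "N' \<in> carrier_mat q t" "N \<in> carrier_mat q t" 
      "X' \<in> carrier_mat t q" "Y' \<in> carrier_mat t t" "X' * N' + Y' * D' = 1\<^sub>m t"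
      "no_pole_mat a N" "no_pole_mat a D" "no_pole_mat a X'" "no_pole_mat a Y'"
    for D D' F' N N' X' Y'
  proof -
    have U: "F' * D \<in> carrier_mat t t" using * by simp
    have 1: "D' * (F' * D) = D" by (rule inverse_mult_cancel[OF *(2,3,4,1)])
    have 2: "N' * (F' * D) = N"
      unfolding *(6)[symmetric] assoc_mult_mat[OF S *(2) U] 1 by (rule *(5))
    have "F' * D = (X' * N' + Y' * D') * (F' * D)" unfolding *(11) left_mult_one_mat[OF U] ..
    also have "\<dots> = X' * N' * (F' * D) + Y' * D' * (F' * D)"
      using * U by (intro add_mult_distrib_mat[of _ t t _ _ t]) (auto intro: mult_carrier_mat)
    also have "\<dots> = X' * N + Y' * D"
      unfolding assoc_mult_mat[OF *(9,7) U] assoc_mult_mat[OF *(10,2) U] 1 2 ..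
    finally have "no_pole_mat a (F' * D)"
      using no_pole_mat_add[OF mult_carrier_mat[OF *(9,8)] mult_carrier_mat[OF *(10,1)]
          no_pole_mat_mult(1)[OF *(9,8,14,12)] no_pole_mat_mult(1)[OF *(10,1,15,13)]] by simp
    with 1 2 show ?thesis by simp
  qed
  have 1: "D1 * (E1 * D0) = D0 \<and> N1 * (E1 * D0) = N0 \<and> no_pole_mat a (E1 * D0)"
    by (rule quotient[OF D(1,2) E(2,4) SD N(2,1) X(2) Y(2) bezout(2) N(3) D(3) X(4) Y(4)])
  have 2: "D0 * (E0 * D1) = D1 \<and> N0 * (E0 * D1) = N1 \<and> no_pole_mat a (E0 * D1)"
    by (rule quotient[OF D(2,1) E(1,3) SD(2,1) N(1,2) X(1) Y(1) bezout(1) N(4) D(4) X(3) Y(3)])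
  have "(E1 * D0) * (E0 * D1) = E1 * (D0 * (E0 * D1))" "(E0 * D1) * (E1 * D0) = E0 * (D1 * (E1 * D0))"
    using D E by (auto intro!: assoc_mult_mat mult_carrier_mat)
  with 1 2 E' have "(E1 * D0) * (E0 * D1) = 1\<^sub>m t" "(E0 * D1) * (E1 * D0) = 1\<^sub>m t" by simp_all
  with 1 2 D E have "loc_inverse a t (E1 * D0) (E0 * D1)" by (simp add: loc_inverse_def)
  moreover from 1 have "N0 = N1 * (E1 * D0)" "D0 = D1 * (E1 * D0)" by metis+
  ultimately show ?thesis by (rule that)
qed

text \<open>By uniqueness any coprime fraction can be exchanged for the obvious one of the diagonal
  form, which writes each power of \<open>rf_lin a\<close> as a numerator or as the inverse of a
  denominator according to the sign of its exponent.\<close>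

lemma coprime_fraction_invariant_orders:
  fixes H :: "'a::field ratfun mat"
  assumes H: "H \<in> carrier_mat q t"
    and N: "N \<in> carrier_mat q t" "no_pole_mat a N"
    and D: "D \<in> carrier_mat t t" "no_pole_mat a D"
    and HD: "H * D = N"
    and E: "E \<in> carrier_mat t t" "D * E = 1\<^sub>m t"
    and X: "X \<in> carrier_mat t q" "no_pole_mat a X"
    and Y: "Y \<in> carrier_mat t t" "no_pole_mat a Y"
    and bezout: "X * N + Y * D = 1\<^sub>m t"
  shows "mset (invariant_orders a N) = image_mset (\<lambda>k. max k 0) (mset (invariant_orders a H))"
    and "mset (invariant_orders a D) = image_mset (\<lambda>k. max (- k) 0) (mset (invariant_orders a H))
      + replicate_mset (t - length (invariant_orders a H)) 0"
proof -
  define \<nu> where "\<nu> = invariant_orders a H"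
  define r where "r = length \<nu>"
  let ?\<pi> = "\<lambda>k. rf_lin a powi k"
  let ?S = "sdiag q t r (\<lambda>i. ?\<pi> (\<nu> ! i))"
  note S = smith_formD[OF invariant_orders(2)[of a] H, folded \<nu>_def, folded r_def]
  from S(3) sdiag_carrier obtain P P' Q Q' where *: "loc_inverse a q P P'" "loc_inverse a t Q Q'"
    "H = P * ?S * Q" by (rule loc_equivE)
  note P = loc_inverseD[OF *(1)] and Q = loc_inverseD[OF *(2)]
  \<comment> \<open>Past the rank the diagonal form of \<open>H\<close> is zero, so the denominator
    is chosen as \<open>1\<close> there; this is the origin of the
    \<open>t - length (invariant_orders a H)\<close> additional zeros.\<close>
  define dexp where "dexp i = (if i < r then max (- (\<nu> ! i)) 0 else 0)" for i
  define N0 D0 E0 where "N0 = sdiag q t r (\<lambda>i. ?\<pi> (max (\<nu> ! i) 0))"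
    and "D0 = sdiag t t t (\<lambda>i. ?\<pi> (dexp i))" and "E0 = sdiag t t t (\<lambda>i. ?\<pi> (- dexp i))"
  \<comment> \<open>At every diagonal position either the numerator or the denominator is
    \<open>1\<close>; \<open>X0\<close> selects the numerator where the order is at most
    \<open>0\<close>, and \<open>Y0\<close> the denominator elsewhere, including past the
    rank.\<close>
  define X0 Y0 :: "'a ratfun mat" where "X0 = sdiag t q r (\<lambda>i. if \<nu> ! i \<le> 0 then 1 else 0)"
    and "Y0 = sdiag t t t (\<lambda>i. if i < r \<and> \<nu> ! i \<le> 0 then 0 else 1)"
  have dims: "N0 \<in> carrier_mat q t" "D0 \<in> carrier_mat t t" "E0 \<in> carrier_mat t t"
    "X0 \<in> carrier_mat t q" "Y0 \<in> carrier_mat t t"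
    by (simp_all add: N0_def D0_def E0_def X0_def Y0_def)
  have np: "no_pole_mat a N0" "no_pole_mat a D0" "no_pole_mat a X0" "no_pole_mat a Y0"
    by (auto simp: no_pole_mat_def N0_def D0_def X0_def Y0_def dexp_def no_pole_rf_lin_powi)
  have SD0: "?S * D0 = N0"
    unfolding D0_def N0_def using S(1,2)
    by (subst sdiag_mult[OF sdiag_carrier]) (auto intro!: eq_matI simp: dexp_def max_def simp flip: power_int_add)
  have DE0: "D0 * E0 = 1\<^sub>m t"
    unfolding D0_def E0_def by (subst sdiag_mult_sdiag) (auto intro!: eq_matI simp flip: power_int_add)
  have XN0: "X0 * N0 = sdiag t t r (\<lambda>i. if \<nu> ! i \<le> 0 then 1 else 0)"
    unfolding X0_def N0_def using S(1,2)
    by (subst sdiag_mult_sdiag) (auto intro!: sdiag_cong)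
  have YD0: "Y0 * D0 = sdiag t t t (\<lambda>i. if i < r \<and> \<nu> ! i \<le> 0 then 0 else 1)"
    unfolding Y0_def D0_def by (subst sdiag_mult_sdiag) (auto intro!: sdiag_cong simp: dexp_def)
  have bezout0: "X0 * N0 + Y0 * D0 = 1\<^sub>m t"
    unfolding XN0 YD0 by (auto intro!: eq_matI)
  \<comment> \<open>Since \<open>H = P * ?S * Q\<close>, the given fraction of \<open>H\<close>
    becomes the fraction of \<open>?S\<close> with numerator \<open>P' * N\<close>, denominator
    \<open>Q * D\<close> and Bezout coefficients \<open>X * P\<close> and
    \<open>Y * Q'\<close>.\<close>
  have PN: "P' * N \<in> carrier_mat q t" and QD: "Q * D \<in> carrier_mat t t"
    using P(2) N(1) Q(1) D(1) by auto
  have "P' * (P * (?S * Q)) = ?S * Q"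
    by (rule inverse_mult_cancel[OF P(2,1,6) mult_carrier_mat[OF sdiag_carrier Q(1)]])
  then have P'H: "P' * H = ?S * Q"
    unfolding *(3) assoc_mult_mat[OF P(1) sdiag_carrier Q(1)] .
  have SQD: "?S * (Q * D) = P' * N"
    unfolding assoc_mult_mat[OF sdiag_carrier Q(1) D(1), symmetric] P'H[symmetric]
      assoc_mult_mat[OF P(2) H D(1)] HD ..
  have E1: "Q * D * (E * Q') = 1\<^sub>m t"
    unfolding assoc_mult_mat[OF Q(1) D(1) mult_carrier_mat[OF E(1) Q(2)]]
      inverse_mult_cancel[OF D(1) E Q(2)] by (rule Q(5))
  have b1: "X * P * (P' * N) = X * N"
    unfolding assoc_mult_mat[OF X(1) P(1) PN] inverse_mult_cancel[OF P(1,2,5) N(1)] ..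
  have b2: "Y * Q' * (Q * D) = Y * D"
    unfolding assoc_mult_mat[OF Y(1) Q(2) QD] inverse_mult_cancel[OF Q(2,1,6) D(1)] ..
  obtain U U' where U: "loc_inverse a t U U'" "N0 = P' * N * U" "D0 = Q * D * U"
  proof (rule coprime_fraction_unique[OF sdiag_carrier dims(1) PN np(1) _ dims(2) QD np(2) _ SD0 SQD
        dims(3) _ DE0 E1 dims(4) _ np(3) _ dims(5) _ np(4)  _ bezout0])
    show "X * P * (P' * N) + Y * Q' * (Q * D) = 1\<^sub>m t" unfolding b1 b2 by (rule bezout)
  qed (use P Q N D E X Y in \<open>auto intro: no_pole_mat_mult(1) mult_carrier_mat\<close>)
  have "loc_equiv a N0 N"
    unfolding U(2) using loc_equivI[OF loc_inverse_sym[OF *(1)] U(1) N(1)] by simp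
  with loc_equiv_sym have "loc_equiv a N N0" by blast
  then have "mset (invariant_orders a N) = mset (map (\<lambda>i. max (\<nu> ! i) 0) [0..<r])"
    unfolding N0_def using S(1,2) by (rule invariant_orders_sdiag)
  also have "map (\<lambda>i. max (\<nu> ! i) 0) [0..<r] = map (\<lambda>k. max k 0) \<nu>"
    by (rule nth_equalityI) (auto simp: r_def)
  finally show "mset (invariant_orders a N) = image_mset (\<lambda>k. max k 0) (mset (invariant_orders a H))"
    by (simp add: \<nu>_def)
  have "loc_equiv a D0 D"
    unfolding U(3) using loc_equivI[OF *(2) U(1) D(1)] by simp
  with loc_equiv_sym have "loc_equiv a D D0" by blast
  then have "mset (invariant_orders a D) = mset (map dexp [0..<t])"
    unfolding D0_def by (rule invariant_orders_sdiag) simp_all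
  also have "map dexp [0..<t] = map (\<lambda>k. max (- k) 0) \<nu> @ replicate (t - r) 0"
    using S(2) by (intro nth_equalityI) (auto simp: r_def dexp_def nth_append)
  finally show "mset (invariant_orders a D) = image_mset (\<lambda>k. max (- k) 0) (mset (invariant_orders a H))
      + replicate_mset (t - length (invariant_orders a H)) 0"
    by (simp add: \<nu>_def r_def)
qed

section \<open>Minimal realizations\<close>

text \<open>
  The ring laws with dimensions instead of carriers as side conditions, which the simplifier can
  discharge for nested products.
\<close>

lemma mat_ring_dim:
  fixes A B C :: "'b::ring_1 mat"
  shows "dim_col A = dim_row B \<Longrightarrow> dim_col B = dim_row C \<Longrightarrow> A * B * C = A * (B * C)"
    and "dim_col A = dim_row B \<Longrightarrow> dim_row B = dim_row C \<Longrightarrow> dim_col B = dim_col C \<Longrightarrow> A * (B + C) = A * B + A * C"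
    and "dim_row A = dim_row B \<Longrightarrow> dim_col A = dim_col B \<Longrightarrow> dim_col B = dim_row C \<Longrightarrow> (A + B) * C = A * C + B * C"
    and "dim_row A = n \<Longrightarrow> 1\<^sub>m n * A = A" "dim_col A = n \<Longrightarrow> A * 1\<^sub>m n = A"
    and "dim_row A = dim_row B \<Longrightarrow> dim_col A = dim_col B \<Longrightarrow> dim_row B = dim_row C \<Longrightarrow> dim_col B = dim_col C \<Longrightarrow>
      A + B + C = A + (B + C)"
proof -
  assume d: "dim_col A = dim_row B" "dim_col B = dim_row C"
  show "A * B * C = A * (B * C)"
    by (rule assoc_mult_mat[of _ "dim_row A" "dim_col A" _ "dim_col B" _ "dim_col C"])
      (use d in \<open>auto intro: carrier_matI\<close>)
next
  assume d: "dim_col A = dim_row B" "dim_row B = dim_row C" "dim_col B = dim_col C"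
  show "A * (B + C) = A * B + A * C"
    by (rule mult_add_distrib_mat[of _ "dim_row A" "dim_col A" _ "dim_col B"])
      (use d in \<open>auto intro: carrier_matI\<close>)
next
  assume d: "dim_row A = dim_row B" "dim_col A = dim_col B" "dim_col B = dim_row C"
  show "(A + B) * C = A * C + B * C"
    by (rule add_mult_distrib_mat[of _ "dim_row A" "dim_col A" _ _ "dim_col C"])
      (use d in \<open>auto intro: carrier_matI\<close>)
qed (auto intro!: left_mult_one_mat right_mult_one_mat carrier_matI assoc_add_mat)

lemma four_block_mat_inject:
  assumes "A \<in> carrier_mat p m" "B \<in> carrier_mat p m'" "C \<in> carrier_mat p' m" "D \<in> carrier_mat p' m'"
    and "A' \<in> carrier_mat p m" "B' \<in> carrier_mat p m'" "C' \<in> carrier_mat p' m" "D' \<in> carrier_mat p' m'"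
    and eq: "four_block_mat A B C D = four_block_mat A' B' C' D'"
  shows "A = A' \<and> B = B' \<and> C = C' \<and> D = D'"
proof (intro conjI)
  have *: "four_block_mat A B C D $$ (i, j) = four_block_mat A' B' C' D' $$ (i, j)" for i j
    by (simp only: eq)
  show "A = A'"
  proof (rule eq_matI)
    fix i j assume "i < dim_row A'" "j < dim_col A'"
    then show "A $$ (i, j) = A' $$ (i, j)" using *[of i j] assms(1-8) by auto
  qed (use assms in auto)
  show "B = B'"
  proof (rule eq_matI)
    fix i j assume "i < dim_row B'" "j < dim_col B'"
    then show "B $$ (i, j) = B' $$ (i, j)" using *[of i "m + j"] assms(1-8) by auto
  qed (use assms in auto)
  show "C = C'"
  proof (rule eq_matI)
    fix i j assume "i < dim_row C'" "j < dim_col C'"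
    then show "C $$ (i, j) = C' $$ (i, j)" using *[of "p + i" j] assms(1-8) by auto
  qed (use assms in auto)
  show "D = D'"
  proof (rule eq_matI)
    fix i j assume "i < dim_row D'" "j < dim_col D'"
    then show "D $$ (i, j) = D' $$ (i, j)" using *[of "p + i" "m + j"] assms(1-8) by auto
  qed (use assms in auto)
qed

lemma four_block_mat_cases:
  assumes "M \<in> carrier_mat (p + p') (m + m')"
  obtains A B C D where "A \<in> carrier_mat p m" "B \<in> carrier_mat p m'" "C \<in> carrier_mat p' m"
    "D \<in> carrier_mat p' m'" "M = four_block_mat A B C D"
proof (rule that[of "mat p m (\<lambda>(i, j). M $$ (i, j))" "mat p m' (\<lambda>(i, j). M $$ (i, m + j))"
      "mat p' m (\<lambda>(i, j). M $$ (p + i, j))" "mat p' m' (\<lambda>(i, j). M $$ (p + i, m + j))"])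
  show "M = four_block_mat (mat p m (\<lambda>(i, j). M $$ (i, j))) (mat p m' (\<lambda>(i, j). M $$ (i, m + j)))
      (mat p' m (\<lambda>(i, j). M $$ (p + i, j))) (mat p' m' (\<lambda>(i, j). M $$ (p + i, m + j)))"
    using assms by (intro eq_matI) auto
qed simp_all

text \<open>
  If \<open>[A B]\<close> is completed to a unimodular matrix with inverse \<open>T\<close>, then multiplying the system
  matrix from the right by \<open>T\<close> leaves the identity and a coprime fraction \<open>N D\<^sub>r\<inverse>\<close> of the transfer
  function, where \<open>D\<^sub>r\<close> is the lower right block of \<open>T\<close>.
\<close>

lemma realization_invariant_orders:
  fixes A B C D H :: "'a::field ratfun mat"
  assumes A: "A \<in> carrier_mat n n" and B: "B \<in> carrier_mat n t" and C: "C \<in> carrier_mat q n"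
    and D: "D \<in> carrier_mat q t" and H: "H \<in> carrier_mat q t"
    and np: "no_pole_mat a A" "no_pole_mat a B" "no_pole_mat a C" "no_pole_mat a D"
    and Ai: "Ai \<in> carrier_mat n n" "A * Ai = 1\<^sub>m n"
    and H_eq: "H + C * (Ai * B) = D"
    and W: "W21 \<in> carrier_mat t n" "W22 \<in> carrier_mat t t"
      "loc_inverse a (n + t) (four_block_mat A B W21 W22) T"
    and X: "X \<in> carrier_mat n n" "Y \<in> carrier_mat n q" "no_pole_mat a X" "no_pole_mat a Y"
      "X * A + Y * C = 1\<^sub>m n"
  shows "replicate_mset t 0 + mset (invariant_orders a A) = replicate_mset n 0 +
      (image_mset (\<lambda>k. max (- k) 0) (mset (invariant_orders a H))
      + replicate_mset (t - length (invariant_orders a H)) 0)"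
    and "mset (invariant_orders a (four_block_mat A B C D)) = replicate_mset n 0 +
      image_mset (\<lambda>k. max k 0) (mset (invariant_orders a H))"
proof -
  note WT = loc_inverseD[OF W(3)]
  have "T \<in> carrier_mat (n + t) (n + t)" by (rule WT(2))
  then obtain T11 T12 T21 T22 where T: "T11 \<in> carrier_mat n n" "T12 \<in> carrier_mat n t"
    "T21 \<in> carrier_mat t n" "T22 \<in> carrier_mat t t" "T = four_block_mat T11 T12 T21 T22"
    by (rule four_block_mat_cases)
  note dims [simp] = A[THEN carrier_matD(1)] A[THEN carrier_matD(2)] B[THEN carrier_matD(1)] B[THEN carrier_matD(2)]
    C[THEN carrier_matD(1)] C[THEN carrier_matD(2)] D[THEN carrier_matD(1)] D[THEN carrier_matD(2)]
    H[THEN carrier_matD(1)] H[THEN carrier_matD(2)]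
    Ai(1)[THEN carrier_matD(1)] Ai(1)[THEN carrier_matD(2)]
    W(1)[THEN carrier_matD(1)] W(1)[THEN carrier_matD(2)] W(2)[THEN carrier_matD(1)] W(2)[THEN carrier_matD(2)]
    X(1)[THEN carrier_matD(1)] X(1)[THEN carrier_matD(2)] X(2)[THEN carrier_matD(1)] X(2)[THEN carrier_matD(2)]
    T(1)[THEN carrier_matD(1)] T(1)[THEN carrier_matD(2)] T(2)[THEN carrier_matD(1)] T(2)[THEN carrier_matD(2)]
    T(3)[THEN carrier_matD(1)] T(3)[THEN carrier_matD(2)] T(4)[THEN carrier_matD(1)] T(4)[THEN carrier_matD(2)]
  note mat_ring_dim [simp]
  have npT: "no_pole_mat a T11" "no_pole_mat a T12" "no_pole_mat a T21" "no_pole_mat a T22"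
    using WT(4) T no_pole_mat_four_block[OF T(1-4)] by auto
  have npW: "no_pole_mat a W21" "no_pole_mat a W22"
    using WT(3) no_pole_mat_four_block[OF A B W(1,2)] by auto
  have "four_block_mat (A * T11 + B * T21) (A * T12 + B * T22) (W21 * T11 + W22 * T21) (W21 * T12 + W22 * T22)
      = four_block_mat (1\<^sub>m n) (0\<^sub>m n t) (0\<^sub>m t n) (1\<^sub>m t)"
    using WT(5) unfolding T(5) mult_four_block_mat[OF A B W(1,2) T(1-4)] by simp
  from four_block_mat_inject[OF _ _ _ _ _ _ _ _ this, of n n t t]
  have wt: "A * T11 + B * T21 = 1\<^sub>m n" "A * T12 + B * T22 = 0\<^sub>m n t" "W21 * T12 + W22 * T22 = 1\<^sub>m t"
    by (simp_all add: carrier_matI)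
  have "four_block_mat (T11 * A + T12 * W21) (T11 * B + T12 * W22) (T21 * A + T22 * W21) (T21 * B + T22 * W22)
      = four_block_mat (1\<^sub>m n) (0\<^sub>m n t) (0\<^sub>m t n) (1\<^sub>m t)"
    using WT(6) unfolding T(5) mult_four_block_mat[OF T(1-4) A B W(1,2)] by simp
  from four_block_mat_inject[OF _ _ _ _ _ _ _ _ this, of n n t t]
  have tw: "T21 * A + T22 * W21 = 0\<^sub>m t n" "T21 * B + T22 * W22 = 1\<^sub>m t"
    by (simp_all add: carrier_matI)
  define N where "N = C * T12 + D * T22"
  have N: "N \<in> carrier_mat q t" by (auto simp: N_def intro!: carrier_matI)
  have npN: "no_pole_mat a N"
    unfolding N_def using no_pole_mat_mult(1)[OF C T(2) np(3) npT(2)] no_pole_mat_mult(1)[OF D T(4) np(4) npT(4)]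
    by (intro no_pole_mat_add[of _ q t]) (auto intro!: carrier_matI)
  have AiA: "Ai * A = 1\<^sub>m n" using mat_mult_left_right_inverse[OF A Ai] .

  \<comment> \<open>By \<open>wt(2)\<close>, \<open>T12\<close> equals \<open>- A^-1 B T22\<close>,
    so \<open>N\<close> is the Schur complement \<open>D - C A^-1 B\<close> times
    \<open>T22\<close>. That complement is \<open>H\<close>: here \<open>C\<close> is the lower left
    block itself, without the sign of \<open>system_matrix\<close>.\<close>
  have "C * T12 + C * (Ai * (B * T22)) = C * (Ai * (A * T12 + B * T22))"
    using inverse_mult_cancel[OF Ai(1) A AiA T(2)] by simp
  also have "\<dots> = 0\<^sub>m q t" unfolding wt(2) by (simp add: right_mult_zero_mat[OF Ai(1)] right_mult_zero_mat[OF C])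
  finally have "C * T12 + C * (Ai * (B * T22)) = 0\<^sub>m q t" .
  moreover have "N = H * T22 + (C * T12 + C * (Ai * (B * T22)))"
    unfolding N_def H_eq[symmetric] by (auto intro!: eq_matI)
  ultimately have HN: "H * T22 = N"
    by (auto intro!: eq_matI)

  \<comment> \<open>The lower right block of an inverse is inverted by a Schur complement:
    \<open>E\<close> is that of \<open>A\<close> in the completed matrix. It may have poles, as it
    contains \<open>Ai\<close>.\<close>
  define E where "E = W22 + - (W21 * (Ai * B))"
  have E: "E \<in> carrier_mat t t" by (auto simp: E_def intro!: carrier_matI)
  have "T22 * (W21 * (Ai * B)) = (T21 * A + T22 * W21) * (Ai * B) + - (T21 * B)"
    using inverse_mult_cancel[OF A Ai B] by (auto intro!: eq_matI)
  also have "\<dots> = - (T21 * B)" unfolding tw(1) by (auto intro!: eq_matI)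
  finally have "T22 * E = T21 * B + T22 * W22"
    unfolding E_def by (auto intro!: eq_matI simp: uminus_mult_right_mat)
  then have TE: "T22 * E = 1\<^sub>m t" by (simp add: tw(2))

  \<comment> \<open>The identity \<open>W21 T12 + W22 T22 = 1\<close> from \<open>wt(3)\<close> is
    already a Bezout identity, but with \<open>T12\<close> in place of \<open>N\<close>. The left
    inverse expresses \<open>T12\<close> through \<open>N\<close> and \<open>T22\<close>;
    substituting this gives the coefficients \<open>W21 * Y\<close> and \<open>Yb\<close>.\<close>
  define Yb where "Yb = W22 + - (W21 * (X * B + Y * D))"
  have Yb: "Yb \<in> carrier_mat t t" by (auto simp: Yb_def intro!: carrier_matI)
  have np1: "no_pole_mat a (W21 * Y)" by (rule no_pole_mat_mult(1)[OF W(1) X(2) npW(1) X(4)])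
  have "no_pole_mat a (X * B + Y * D)"
    by (rule no_pole_mat_add[OF mult_carrier_mat[OF X(1) B] mult_carrier_mat[OF X(2) D]
          no_pole_mat_mult(1)[OF X(1) B X(3) np(2)] no_pole_mat_mult(1)[OF X(2) D X(4) np(4)]])
  moreover have "X * B + Y * D \<in> carrier_mat n t" by (auto intro!: carrier_matI)
  ultimately have "no_pole_mat a (W21 * (X * B + Y * D))"
    by (intro no_pole_mat_mult(1)[OF W(1) _ npW(1)])
  then have npYb: "no_pole_mat a Yb"
    unfolding Yb_def by (intro no_pole_mat_add[OF W(2) _ npW(2)] no_pole_mat_uminus) (auto intro!: carrier_matI)
  have "T12 = (X * A + Y * C) * T12" unfolding X(5) by simp
  also have "\<dots> = X * (A * T12 + B * T22) + (Y * N + - ((X * B + Y * D) * T22))"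
    unfolding N_def by (auto intro!: eq_matI)
  also have "\<dots> = Y * N + - ((X * B + Y * D) * T22)"
    unfolding wt(2) right_mult_zero_mat[OF X(1)] by (auto intro!: eq_matI)
  finally have T12: "T12 = Y * N + - ((X * B + Y * D) * T22)" .
  have "1\<^sub>m t = W21 * T12 + W22 * T22" using wt(3) by simp
  also have "W21 * T12 = W21 * (Y * N) + - (W21 * ((X * B + Y * D) * T22))"
    by (subst T12) (simp add: uminus_mult_right_mat carrier_matD[OF N])
  finally have bezout: "W21 * Y * N + Yb * T22 = 1\<^sub>m t"
    using carrier_matD[OF N] unfolding Yb_def by (auto intro!: eq_matI)

  note orders = coprime_fraction_invariant_orders[OF H N npN T(4) npT(4) HN E TE
      mult_carrier_mat[OF W(1) X(2)] np1 Yb npYb bezout]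
  have WT1: "loc_inverse a (n + t) T (four_block_mat A B W21 W22)" by (rule loc_inverse_sym[OF W(3)])

  \<comment> \<open>The state matrix is compared with the denominator through the chain
    \<open>diag(A, 1)\<close>, \<open>[A B; 0 1]\<close>, \<open>[1 0; T21 T22]\<close>,
    \<open>diag(1, T22)\<close>; the middle step is multiplication by \<open>T\<close>, and the
    outer steps are shears.\<close>
  have "loc_equiv a (four_block_mat A B (0\<^sub>m t n) (1\<^sub>m t)) (diag2 A (1\<^sub>m t))"
  proof -
    have "four_block_mat (1\<^sub>m n) B (0\<^sub>m t n) (1\<^sub>m t) * diag2 A (1\<^sub>m t) = four_block_mat A B (0\<^sub>m t n) (1\<^sub>m t)"
      using A B mult_four_block_mat[of "1\<^sub>m n" n n B t "0\<^sub>m t n" t "1\<^sub>m t" A n "0\<^sub>m n t" t "0\<^sub>m t n" "1\<^sub>m t"]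
      by (simp add: diag2_eq)
    with loc_equiv_left[OF loc_inverse_upper[OF B np(2)] diag2_carrier[OF A one_carrier_mat]] show ?thesis by simp
  qed
  from loc_equiv_sym[OF this]
  have "loc_equiv a (diag2 A (1\<^sub>m t)) (four_block_mat A B (0\<^sub>m t n) (1\<^sub>m t))" .
  also have "loc_equiv a \<dots> (four_block_mat (1\<^sub>m n) (0\<^sub>m n t) T21 T22)"
  proof -
    have "four_block_mat A B (0\<^sub>m t n) (1\<^sub>m t) * T = four_block_mat (1\<^sub>m n) (0\<^sub>m n t) T21 T22"
      using T wt A B mult_four_block_mat[of A n n B t "0\<^sub>m t n" t "1\<^sub>m t" T11 n T12 t T21 T22]
      by simp
    with loc_equiv_sym[OF loc_equiv_right[OF WT1 four_block_carrier_mat[OF A one_carrier_mat, of B "0\<^sub>m t n"]]]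
    show ?thesis by simp
  qed
  also have "loc_equiv a \<dots> (diag2 (1\<^sub>m n) T22)"
  proof -
    have "four_block_mat (1\<^sub>m n) (0\<^sub>m n t) T21 (1\<^sub>m t) * diag2 (1\<^sub>m n) T22 = four_block_mat (1\<^sub>m n) (0\<^sub>m n t) T21 T22"
      using T mult_four_block_mat[of "1\<^sub>m n" n n "0\<^sub>m n t" t T21 t "1\<^sub>m t" "1\<^sub>m n" n "0\<^sub>m n t" t "0\<^sub>m t n" T22]
      by (simp add: diag2_eq)
    with loc_equiv_left[OF loc_inverse_lower[OF T(3) npT(3)] diag2_carrier[OF one_carrier_mat T(4)]] show ?thesis by simp
  qed
  finally have "loc_equiv a (diag2 A (1\<^sub>m t)) (diag2 (1\<^sub>m n) T22)" .
  from loc_equiv_trans[OF loc_equiv_sym[OF loc_equiv_diag2_swap] this]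
  have "loc_equiv a (diag2 (1\<^sub>m t) A) (diag2 (1\<^sub>m n) T22)" .
  moreover have "diag2 (1\<^sub>m t) A \<in> carrier_mat (n + t) (n + t)"
    using diag2_carrier[OF one_carrier_mat[of t] A] by (simp add: add.commute)
  ultimately have "mset (invariant_orders a (diag2 (1\<^sub>m t) A)) = mset (invariant_orders a (diag2 (1\<^sub>m n) T22))"
    using loc_equiv_iff_invariant_orders[OF _ diag2_carrier[OF one_carrier_mat T(4)]] by blast
  then show "replicate_mset t 0 + mset (invariant_orders a A) = replicate_mset n 0 +
      (image_mset (\<lambda>k. max (- k) 0) (mset (invariant_orders a H))
      + replicate_mset (t - length (invariant_orders a H)) 0)"
    unfolding invariant_orders_diag2 orders(2) .

  \<comment> \<open>The system matrix times \<open>T\<close> is \<open>[1 0; Z N]\<close>, and as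
    \<open>Z\<close> has no pole a shear removes it.\<close>
  define Z where "Z = C * T11 + D * T21"
  have Z: "Z \<in> carrier_mat q n" by (auto simp: Z_def intro!: carrier_matI)
  have npZ: "no_pole_mat a Z"
    unfolding Z_def using no_pole_mat_mult(1)[OF C T(1) np(3) npT(1)] no_pole_mat_mult(1)[OF D T(3) np(4) npT(3)]
    by (intro no_pole_mat_add[of _ q n]) (auto intro!: carrier_matI)
  have "four_block_mat (1\<^sub>m n) (0\<^sub>m n q) Z (1\<^sub>m q) * diag2 (1\<^sub>m n) N = four_block_mat (1\<^sub>m n) (0\<^sub>m n t) Z N"
    using Z N mult_four_block_mat[of "1\<^sub>m n" n n "0\<^sub>m n q" q Z q "1\<^sub>m q" "1\<^sub>m n" n "0\<^sub>m n t" t "0\<^sub>m q n" N]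
    by (simp add: diag2_eq)
  moreover have "four_block_mat A B C D * T = four_block_mat (1\<^sub>m n) (0\<^sub>m n t) Z N"
    unfolding T(5) mult_four_block_mat[OF A B C D T(1-4)] wt Z_def N_def ..
  ultimately have "loc_equiv a (four_block_mat A B C D * T) (diag2 (1\<^sub>m n) N)"
    using loc_equiv_left[OF loc_inverse_lower[OF Z npZ] diag2_carrier[OF one_carrier_mat N]] by simp
  from loc_equiv_trans[OF loc_equiv_sym[OF loc_equiv_right[OF WT1 four_block_carrier_mat[OF A D]]] this]
  have "mset (invariant_orders a (four_block_mat A B C D)) = mset (invariant_orders a (diag2 (1\<^sub>m n) N))"
    using loc_equiv_iff_invariant_orders[OF four_block_carrier_mat[OF A D] diag2_carrier[OF one_carrier_mat N]] by blast
  then show "mset (invariant_orders a (four_block_mat A B C D)) = replicate_mset n 0 +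
      image_mset (\<lambda>k. max k 0) (mset (invariant_orders a H))"
    unfolding invariant_orders_diag2 orders(1) .
qed

text \<open>A polynomial matrix has nonnegative orders. Evaluating its diagonal form at
  \<open>a\<close> turns powers with exponent \<open>0\<close> into ones and kills the others, so
  the rank of the value counts the zero orders. If that rank is as large as one of the dimensions,
  no other orders exist.\<close>

lemma full_rank_loc_equiv:
  assumes P: "P \<in> carrier_mat p m" and rank: "mat_rank (eval_pmat P a) = r" and full: "p \<le> r \<or> m \<le> r"
  shows "loc_equiv a (rat_mat P) (sdiag p m r (\<lambda>_. 1))"
proof -
  let ?ev = "map_mat (\<lambda>f. rf_eval f a)"
  have RP: "rat_mat P \<in> carrier_mat p m" using P by simp
  obtain \<nu> where \<nu>: "sorted \<nu>" "smith_form a (rat_mat P) \<nu>" by (rule smith_form_exists)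
  note sf = smith_formD[OF \<nu>(2) RP]
  have "no_pole_mat a (rf_lin a powi (- 0) \<cdot>\<^sub>m rat_mat P)" by (auto simp: no_pole_mat_def)
  note nonneg = smith_form_lower_bound[OF \<nu>(2) this]
  \<comment> \<open>The orders are sorted and nonnegative, so the zeros form an initial segment, and
    \<open>z\<close> is its length.\<close>
  define z where "z = length (takeWhile (\<lambda>k. k = 0) \<nu>)"
  have z: "z \<le> length \<nu>" by (simp add: z_def length_takeWhile_le)
  have zero: "\<nu> ! i = 0" if "i < z" for i
    using that takeWhile_nth[of i "\<lambda>k. k = 0" \<nu>] set_takeWhileD[OF nth_mem[of i "takeWhile (\<lambda>k. k = 0) \<nu>"]]
    by (auto simp: z_def)
  have pos: "\<nu> ! i > 0" if "z \<le> i" "i < length \<nu>" for i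
  proof -
    have "\<nu> ! z \<noteq> 0" using nth_length_takeWhile[of "\<lambda>k. k = 0" \<nu>] that by (simp add: z_def)
    with nonneg[of "\<nu> ! z"] that have "\<nu> ! z > 0" by auto
    with sorted_nth_mono[OF \<nu>(1) that] show ?thesis by simp
  qed
  have zero_iff: "\<nu> ! i = 0 \<longleftrightarrow> i < z" if "i < length \<nu>" for i
    using zero[of i] pos[of i] that by (cases "i < z") auto
  have ev_iff: "rf_eval (rf_lin a powi (\<nu> ! i)) a = (if i < z then 1 else 0)" if "i < length \<nu>" for i
    using rf_eval_rf_lin_powi[OF nonneg[OF nth_mem[OF that]]] zero_iff[OF that]
    by (cases "i < z") (auto simp: power_int_0_left)
  let ?S = "sdiag p m (length \<nu>) (\<lambda>i. rf_lin a powi (\<nu> ! i))"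
  from sf(3) sdiag_carrier obtain U U' V V' where *: "loc_inverse a p U U'" "loc_inverse a m V V'"
    "rat_mat P = U * ?S * V" by (rule loc_equivE)
  note U = loc_inverseD[OF *(1)] and V = loc_inverseD[OF *(2)]
  have npS: "no_pole_mat a ?S"
    using nonneg by (auto simp: no_pole_mat_def no_pole_rf_lin_powi)
  have "?ev ?S = sdiag p m (length \<nu>) (\<lambda>i. rf_eval (rf_lin a powi (\<nu> ! i)) a)"
    by (rule map_mat_sdiag) simp
  also have "\<dots> = sdiag p m z (\<lambda>_. 1)"
    using ev_iff z by (intro eq_matI) auto
  finally have evS: "?ev ?S = sdiag p m z (\<lambda>_. 1)" .
  have "eval_pmat P a = ?ev (rat_mat P)" by (auto intro!: eq_matI)
  also have "\<dots> = ?ev U * sdiag p m z (\<lambda>_. 1) * ?ev V"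
    unfolding *(3) no_pole_mat_mult(2)[OF mult_carrier_mat[OF U(1) sdiag_carrier] V(1)
        no_pole_mat_mult(1)[OF U(1) sdiag_carrier U(3) npS] V(3)]
      no_pole_mat_mult(2)[OF U(1) sdiag_carrier U(3) npS] evS ..
  finally have eval: "eval_pmat P a = ?ev U * sdiag p m z (\<lambda>_. 1) * ?ev V" .
  have ev1: "?ev (1\<^sub>m k) = 1\<^sub>m k" for k by (auto intro!: eq_matI)
  have "?ev U' * ?ev U = 1\<^sub>m p" "?ev V * ?ev V' = 1\<^sub>m m"
    using no_pole_mat_mult(2)[OF U(2,1,4,3)] no_pole_mat_mult(2)[OF V(1,2,3,4)] U(6) V(5) ev1 by simp_all
  then have "mat_rank (eval_pmat P a) = z"
    using U V z sf(1,2) by (intro mat_rank_diagonalization[OF _ _ _ _ _ _ eval]) auto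
  with rank z full sf(1,2) have r: "length \<nu> = r" "z = r" by auto
  have "?S = sdiag p m r (\<lambda>_. 1)"
    unfolding r(1) using zero r(2) by (intro sdiag_cong) simp
  with sf(3) show ?thesis by simp
qed

text \<open>Full rank at \<open>a\<close> gives \<open>[A B] = U [1 0] V\<close> with local units
  \<open>U\<close> and \<open>V\<close>. As \<open>U [1 0] = [1 0] diag(U, 1)\<close>, the unit
  \<open>diag(U, 1) V\<close> has \<open>[A B]\<close> as its upper block row.\<close>

lemma minimal_right_completion:
  fixes A B :: "'a::field poly mat"
  assumes A: "A \<in> carrier_mat n n" and B: "B \<in> carrier_mat n t"
    and rank: "mat_rank (four_block_mat (eval_pmat A a) (eval_pmat B a) (0\<^sub>m 0 n) (0\<^sub>m 0 t)) = n"
  obtains W21 W22 T where "W21 \<in> carrier_mat t n" "W22 \<in> carrier_mat t t"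
    "loc_inverse a (n + t) (four_block_mat (rat_mat A) (rat_mat B) W21 W22) T"
proof -
  define M where "M = four_block_mat A B (0\<^sub>m 0 n) (0\<^sub>m 0 t)"
  have M: "M \<in> carrier_mat n (n + t)"
    unfolding M_def using four_block_carrier_mat[OF A zero_carrier_mat[of 0 t]] by simp
  have "eval_pmat M a = four_block_mat (eval_pmat A a) (eval_pmat B a) (0\<^sub>m 0 n) (0\<^sub>m 0 t)"
    unfolding M_def using A B by (intro eq_matI) auto
  with rank have "mat_rank (eval_pmat M a) = n" by simp
  from full_rank_loc_equiv[OF M this] have "loc_equiv a (rat_mat M) (sdiag n (n + t) n (\<lambda>_. 1))" by simp
  then obtain U U' V V' where *: "loc_inverse a n U U'" "loc_inverse a (n + t) V V'"
    "rat_mat M = U * sdiag n (n + t) n (\<lambda>_. 1) * V" using sdiag_carrier by (rule loc_equivE)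
  note U = loc_inverseD[OF *(1)] and V = loc_inverseD[OF *(2)]
  define W where "W = diag2 U (1\<^sub>m t) * V"
  have inv: "loc_inverse a (n + t) W (V' * diag2 U' (1\<^sub>m t))"
    unfolding W_def by (rule loc_inverse_mult[OF loc_inverse_diag2[OF *(1) loc_inverse_1] *(2)])
  note W = loc_inverseD(1)[OF inv]
  have UI: "diag2 U (1\<^sub>m t) \<in> carrier_mat (n + t) (n + t)" by (rule diag2_carrier[OF U(1) one_carrier_mat])
  have "sdiag n (n + t) n (\<lambda>_. 1) * diag2 U (1\<^sub>m t) = U * sdiag n (n + t) n (\<lambda>_. 1)"
    using U(1) UI by (subst sdiag_mult[OF UI], simp, simp, subst mult_sdiag[OF U(1)])
      (auto simp: diag2_eq intro!: eq_matI)
  then have "sdiag n (n + t) n (\<lambda>_. 1) * W = rat_mat M"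
    unfolding W_def *(3) assoc_mult_mat[OF sdiag_carrier UI V(1), symmetric] by simp
  then have top: "W $$ (i, j) = rat_mat M $$ (i, j)" if "i < n" "j < n + t" for i j
    using that by (simp add: sdiag_mult[OF W] flip: \<open>sdiag n (n + t) n (\<lambda>_. 1) * W = rat_mat M\<close>)
  from W obtain W11 W12 W21 W22 where blocks: "W11 \<in> carrier_mat n n" "W12 \<in> carrier_mat n t"
    "W21 \<in> carrier_mat t n" "W22 \<in> carrier_mat t t" "W = four_block_mat W11 W12 W21 W22"
    by (rule four_block_mat_cases)
  have "W11 = rat_mat A"
  proof (rule eq_matI)
    fix i j assume "i < dim_row (rat_mat A)" "j < dim_col (rat_mat A)"
    then show "W11 $$ (i, j) = rat_mat A $$ (i, j)"
      using top[of i j] A B blocks by (simp add: M_def)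
  qed (use A blocks in auto)
  moreover have "W12 = rat_mat B"
  proof (rule eq_matI)
    fix i j assume "i < dim_row (rat_mat B)" "j < dim_col (rat_mat B)"
    then show "W12 $$ (i, j) = rat_mat B $$ (i, j)"
      using top[of i "n + j"] A B blocks by (simp add: M_def)
  qed (use B blocks in auto)
  ultimately have "W = four_block_mat (rat_mat A) (rat_mat B) W21 W22" using blocks(5) by simp
  from inv[unfolded this] show ?thesis by (rule that[OF blocks(3,4)])
qed

text \<open>Full rank at \<open>a\<close> gives \<open>[A; C] = U [1; 0] V\<close> with local units
  \<open>U\<close> and \<open>V\<close>, so \<open>V^-1 [1 0] U^-1\<close> is a pole-free left
  inverse; \<open>X\<close> and \<open>Y\<close> are its column blocks.\<close>

lemma minimal_left_inverse:
  fixes A C :: "'a::field poly mat"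
  assumes A: "A \<in> carrier_mat n n" and C: "C \<in> carrier_mat q n"
    and rank: "mat_rank (eval_pmat A a @\<^sub>r eval_pmat C a) = n"
  obtains X Y where "X \<in> carrier_mat n n" "Y \<in> carrier_mat n q" "no_pole_mat a X" "no_pole_mat a Y"
    "X * rat_mat A + Y * rat_mat C = 1\<^sub>m n"
proof -
  define M where "M = A @\<^sub>r C"
  have M: "M \<in> carrier_mat (n + q) n" unfolding M_def by (rule carrier_append_rows[OF A C])
  have "eval_pmat M a = eval_pmat A a @\<^sub>r eval_pmat C a"
    unfolding M_def append_rows_def using A C by (intro eq_matI) auto
  with rank have "mat_rank (eval_pmat M a) = n" by simp
  from full_rank_loc_equiv[OF M this] have "loc_equiv a (rat_mat M) (sdiag (n + q) n n (\<lambda>_. 1))" by simp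
  then obtain U U' V V' where *: "loc_inverse a (n + q) U U'" "loc_inverse a n V V'"
    "rat_mat M = U * sdiag (n + q) n n (\<lambda>_. 1) * V" using sdiag_carrier by (rule loc_equivE)
  note U = loc_inverseD[OF *(1)] and V = loc_inverseD[OF *(2)]
  let ?S = "sdiag n (n + q) n (\<lambda>_. 1) :: 'a ratfun mat" and ?S' = "sdiag (n + q) n n (\<lambda>_. 1) :: 'a ratfun mat"
  have S: "?S * ?S' = 1\<^sub>m n" by (subst sdiag_mult_sdiag) (auto intro!: eq_matI)
  define Z where "Z = V' * (?S * U')"
  have Z: "Z \<in> carrier_mat n (n + q)"
    unfolding Z_def by (rule mult_carrier_mat[OF V(2) mult_carrier_mat[OF sdiag_carrier U(2)]])
  have npZ: "no_pole_mat a Z"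
    unfolding Z_def
    by (rule no_pole_mat_mult(1)[OF V(2) mult_carrier_mat[OF sdiag_carrier U(2)] V(4)
          no_pole_mat_mult(1)[OF sdiag_carrier U(2) _ U(4)]]) (auto simp: no_pole_mat_def)
  have SV: "?S' * V \<in> carrier_mat (n + q) n" by (rule mult_carrier_mat[OF sdiag_carrier V(1)])
  have "Z * rat_mat M = V' * ((?S * U') * (U * (?S' * V)))"
    unfolding Z_def *(3) assoc_mult_mat[OF U(1) sdiag_carrier V(1)]
    by (rule assoc_mult_mat[OF V(2) mult_carrier_mat[OF sdiag_carrier U(2)] mult_carrier_mat[OF U(1) SV]])
  also have "(?S * U') * (U * (?S' * V)) = ?S * (U' * (U * (?S' * V)))"
    by (rule assoc_mult_mat[OF sdiag_carrier U(2) mult_carrier_mat[OF U(1) SV]])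
  also have "U' * (U * (?S' * V)) = ?S' * V" by (rule inverse_mult_cancel[OF U(2,1,6) SV])
  also have "?S * (?S' * V) = V"
    unfolding assoc_mult_mat[OF sdiag_carrier sdiag_carrier V(1), symmetric] S using V(1) by simp
  also have "V' * V = 1\<^sub>m n" by (rule V(6))
  finally have ZM: "Z * rat_mat M = 1\<^sub>m n" .
  \<comment> \<open>An empty second block row, and later empty second block columns, bring
    \<open>Z\<close> and \<open>M\<close> into the format of the multiplication rule for two by two
    blocks.\<close>
  have "Z \<in> carrier_mat (n + 0) (n + q)" using Z by simp
  then obtain X Y X0 Y0 where blocks: "X \<in> carrier_mat n n" "Y \<in> carrier_mat n q"
    "X0 \<in> carrier_mat 0 n" "Y0 \<in> carrier_mat 0 q" "Z = four_block_mat X Y X0 Y0"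
    by (rule four_block_mat_cases)
  have RA: "rat_mat A \<in> carrier_mat n n" and RC: "rat_mat C \<in> carrier_mat q n" using A C by auto
  have RM: "rat_mat M = four_block_mat (rat_mat A) (0\<^sub>m n 0) (rat_mat C) (0\<^sub>m q 0)"
    unfolding M_def append_rows_def using A C by (intro eq_matI) auto
  have "four_block_mat (X * rat_mat A + Y * rat_mat C) (X * 0\<^sub>m n 0 + Y * 0\<^sub>m q 0)
      (X0 * rat_mat A + Y0 * rat_mat C) (X0 * 0\<^sub>m n 0 + Y0 * 0\<^sub>m q 0) = Z * rat_mat M"
    unfolding blocks(5) RM
    by (rule mult_four_block_mat[OF blocks(1-4) RA zero_carrier_mat RC zero_carrier_mat, symmetric])
  also have "\<dots> = four_block_mat (1\<^sub>m n) (0\<^sub>m n 0) (0\<^sub>m 0 n) (0\<^sub>m 0 0)"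
    unfolding ZM by (auto intro!: eq_matI)
  finally have "four_block_mat (X * rat_mat A + Y * rat_mat C) (X * 0\<^sub>m n 0 + Y * 0\<^sub>m q 0)
      (X0 * rat_mat A + Y0 * rat_mat C) (X0 * 0\<^sub>m n 0 + Y0 * 0\<^sub>m q 0)
    = four_block_mat (1\<^sub>m n) (0\<^sub>m n 0) (0\<^sub>m 0 n) (0\<^sub>m 0 0)" .
  from four_block_mat_inject[OF _ _ _ _ _ _ _ _ this, of n n 0 0]
  have "X * rat_mat A + Y * rat_mat C = 1\<^sub>m n"
    by (simp add: carrier_matI blocks(1-4)[THEN carrier_matD(1)] blocks(1-4)[THEN carrier_matD(2)]
        A[THEN carrier_matD(2)] C[THEN carrier_matD(2)])
  moreover have "no_pole_mat a X" "no_pole_mat a Y"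
    using npZ no_pole_mat_four_block[OF blocks(1-4)] blocks(5) by auto
  ultimately show ?thesis by (intro that[OF blocks(1,2)])
qed

section \<open>From multisets of orders to elementary divisors and ranks\<close>

lemma filter_replicate_mset: "filter_mset P (replicate_mset k x) = (if P x then replicate_mset k x else {#})"
  by (induction k) auto

text \<open>The multiplicity of \<open>0\<close> is what remains of the size after removing the
  negative and the positive part. For invariant orders the size is the normal rank.\<close>

lemma mset_sign_decomposition:
  fixes M N :: "int multiset"
  shows "M = N \<longleftrightarrow> filter_mset (\<lambda>k. k < 0) M = filter_mset (\<lambda>k. k < 0) N \<and>
    filter_mset (\<lambda>k. k > 0) M = filter_mset (\<lambda>k. k > 0) N \<and> size M = size N"
    (is "_ \<longleftrightarrow> ?r")
proof
  assume ?r
  have dec: "M = filter_mset (\<lambda>k. k < 0) M + filter_mset (\<lambda>k. k > 0) M +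
      replicate_mset (size M - size (filter_mset (\<lambda>k. k < 0) M) - size (filter_mset (\<lambda>k. k > 0) M)) 0"
    for M :: "int multiset"
  proof -
    have "M = filter_mset (\<lambda>k. k < 0) M + filter_mset (\<lambda>k. k > 0) M + replicate_mset (count M 0) 0"
      by (rule multiset_eqI) auto
    moreover from arg_cong[OF this, of size]
    have "count M 0 = size M - size (filter_mset (\<lambda>k. k < 0) M) - size (filter_mset (\<lambda>k. k > 0) M)" by simp
    ultimately show ?thesis by simp
  qed
  from \<open>?r\<close> show "M = N" by (subst dec, subst (2) dec) simp
qed simp

lemma image_mset_eq_iff_inj: "inj f \<Longrightarrow> image_mset f M = image_mset f N \<longleftrightarrow> M = N"
proof
  assume f: "inj f" and "image_mset f M = image_mset f N"
  then have "image_mset (inv_into UNIV f) (image_mset f M) = image_mset (inv_into UNIV f) (image_mset f N)" by simp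
  with f show "M = N" by (simp add: multiset.map_comp)
qed simp

text \<open>Distinct exponents give distinct powers of \<open>rf_lin a\<close>, so the divisors
  determine the nonzero orders; the added zeros are visible in the rank only.\<close>

lemma elementary_divisors_eq_iff:
  fixes X Y :: "'a::field ratfun mat"
  shows "mset (invariant_orders a X) = replicate_mset s 0 + mset (invariant_orders a Y) \<longleftrightarrow>
    mat_rank X = mat_rank Y + s \<and> pole_elementary_divisors a Y = pole_elementary_divisors a X \<and>
    zero_elementary_divisors a Y = zero_elementary_divisors a X"
proof -
  have "inj (\<lambda>k. rf_lin a powi (- k))" "inj (\<lambda>k. rf_lin a powi k)"
    by (auto intro!: injI simp: rf_lin_powi_inj)
  then show ?thesis
    unfolding pole_elementary_divisors_def zero_elementary_divisors_def
    by (subst mset_sign_decomposition)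
      (auto simp: image_mset_eq_iff_inj filter_replicate_mset length_invariant_orders)
qed

text \<open>Serves systems with \<open>n = 0\<close>: they are minimal by convention, and the two
  rank conditions on which the completions rely are here actually true.\<close>

lemma mat_rank_empty:
  fixes M :: "'b::field mat"
  assumes "M \<in> carrier_mat p m" "p = 0 \<or> m = 0"
  shows "mat_rank M = 0"
proof -
  have "M = 1\<^sub>m p * sdiag p m 0 (\<lambda>_. 1) * 1\<^sub>m m"
    using assms by (intro eq_matI) auto
  then show ?thesis
    by (intro mat_rank_diagonalization[of "1\<^sub>m p" p "1\<^sub>m p" "1\<^sub>m m" m "1\<^sub>m m"]) auto
qed

text \<open>The zeros that pad both identities of \<open>realization_invariant_orders\<close>
  disappear when nonzero orders are filtered out; taking sizes in the second identity gives the
  rank.\<close>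

theorem minimal_realization_elementary_divisors:
  fixes A B C D :: "'a::field poly mat"
  assumes A: "A \<in> carrier_mat n n" and B: "B \<in> carrier_mat n t" and C: "C \<in> carrier_mat q n"
    and D: "D \<in> carrier_mat q t"
    and Ai: "Ai \<in> carrier_mat n n" "rat_mat A * Ai = 1\<^sub>m n"
    and H: "H \<in> carrier_mat q t" "H = rat_mat D + rat_mat C * (Ai * rat_mat B)"
    and minimal: "minimal_at a A B C D"
  shows "pole_elementary_divisors a H = elementary_divisors a A"
    and "zero_elementary_divisors a H = elementary_divisors a (system_matrix A B C D)"
    and "mat_rank (rat_mat (system_matrix A B C D)) = mat_rank H + n"
proof -
  have eA: "eval_pmat A a \<in> carrier_mat n n" and eB: "eval_pmat B a \<in> carrier_mat n t"
    and eC: "eval_pmat C a \<in> carrier_mat q n" using A B C by auto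
  have ranks: "mat_rank (eval_pmat A a @\<^sub>r eval_pmat C a) = n \<and>
    mat_rank (four_block_mat (eval_pmat A a) (eval_pmat B a) (0\<^sub>m 0 n) (0\<^sub>m 0 t)) = n"
  proof (cases "n = 0")
    case True
    have "mat_rank (eval_pmat A a @\<^sub>r eval_pmat C a) = 0"
      using mat_rank_empty[OF carrier_append_rows[OF eA eC]] True by simp
    moreover have "mat_rank (four_block_mat (eval_pmat A a) (eval_pmat B a) (0\<^sub>m 0 n) (0\<^sub>m 0 t)) = 0"
      using mat_rank_empty[OF four_block_carrier_mat[OF eA zero_carrier_mat[of 0 t]]] True by simp
    ultimately show ?thesis using True by simp
  next
    case False
    with minimal A B show ?thesis by (simp add: minimal_at_def)
  qed
  from minimal_left_inverse[OF A C conjunct1[OF ranks]] obtain X Y where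
    X: "X \<in> carrier_mat n n" "Y \<in> carrier_mat n q" "no_pole_mat a X" "no_pole_mat a Y"
    "X * rat_mat A + Y * rat_mat C = 1\<^sub>m n" .
  from minimal_right_completion[OF A B conjunct2[OF ranks]] obtain W21 W22 T where
    W: "W21 \<in> carrier_mat t n" "W22 \<in> carrier_mat t t"
    "loc_inverse a (n + t) (four_block_mat (rat_mat A) (rat_mat B) W21 W22) T" .
  have RA: "rat_mat A \<in> carrier_mat n n" and RB: "rat_mat B \<in> carrier_mat n t"
    and RC: "rat_mat C \<in> carrier_mat q n" and RD: "rat_mat D \<in> carrier_mat q t"
    using A B C D by auto
  have RC': "- rat_mat C \<in> carrier_mat q n" "no_pole_mat a (- rat_mat C)"
    using RC by (simp_all add: no_pole_mat_uminus)
  have Y': "- Y \<in> carrier_mat n q" "no_pole_mat a (- Y)" using X by (simp_all add: no_pole_mat_uminus)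
  \<comment> \<open>The lower left block is \<open>- C\<close>, so the sign of the corresponding
    coefficient changes with it and the Bezout identity is kept.\<close>
  have "Y * rat_mat C = - Y * - rat_mat C"
    using X(2) RC by (auto intro!: eq_matI)
  with X(5) have bezout: "X * rat_mat A + - Y * - rat_mat C = 1\<^sub>m n" by simp
  have CE: "rat_mat C * (Ai * rat_mat B) \<in> carrier_mat q t"
    by (rule mult_carrier_mat[OF RC mult_carrier_mat[OF Ai(1) RB]])
  have HD: "H + - rat_mat C * (Ai * rat_mat B) = rat_mat D"
  proof -
    have "- rat_mat C * (Ai * rat_mat B) = - (rat_mat C * (Ai * rat_mat B))"
      using RC Ai(1) by (intro uminus_mult_left_mat) simp
    then show ?thesis unfolding H(2) using CE RD C B by (auto intro!: eq_matI)
  qed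
  define \<nu> where "\<nu> = mset (invariant_orders a H)"
  note orders = realization_invariant_orders[OF RA RB RC'(1) RD H(1) no_pole_mat_rat_mat no_pole_mat_rat_mat
      RC'(2) no_pole_mat_rat_mat Ai HD W X(1) Y'(1) X(3) Y'(2) bezout, folded \<nu>_def]
  have sys: "rat_mat (system_matrix A B C D) = four_block_mat (rat_mat A) (rat_mat B) (- rat_mat C) (rat_mat D)"
    unfolding system_matrix_def using A B C D by (intro eq_matI) auto
  have neg: "filter_mset (\<lambda>k. k \<noteq> 0) (image_mset (\<lambda>k. max (- k) 0) M) = image_mset uminus (filter_mset (\<lambda>k. k < 0) M)"
    and pos: "filter_mset (\<lambda>k. k \<noteq> 0) (image_mset (\<lambda>k. max k 0) M) = filter_mset (\<lambda>k. k > 0) M" for M :: "int multiset"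
    by (induction M) auto
  have "filter_mset (\<lambda>k. k \<noteq> 0) (mset (invariant_orders a (rat_mat A))) = image_mset uminus (filter_mset (\<lambda>k. k < 0) \<nu>)"
    using arg_cong[OF orders(1), of "filter_mset (\<lambda>k. k \<noteq> 0)"] by (simp add: filter_replicate_mset neg)
  then show "pole_elementary_divisors a H = elementary_divisors a A"
    unfolding pole_elementary_divisors_def elementary_divisors_def \<nu>_def
    by (simp add: multiset.map_comp comp_def)
  have "filter_mset (\<lambda>k. k \<noteq> 0) (mset (invariant_orders a (rat_mat (system_matrix A B C D)))) = filter_mset (\<lambda>k. k > 0) \<nu>"
    using arg_cong[OF orders(2), of "filter_mset (\<lambda>k. k \<noteq> 0)"] unfolding sys by (simp add: filter_replicate_mset pos)
  then show "zero_elementary_divisors a H = elementary_divisors a (system_matrix A B C D)"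
    unfolding zero_elementary_divisors_def elementary_divisors_def \<nu>_def by simp
  show "mat_rank (rat_mat (system_matrix A B C D)) = mat_rank H + n"
    using arg_cong[OF orders(2), of size] 
    by (simp only: sys \<nu>_def size_union size_replicate_mset size_image_mset size_mset length_invariant_orders add.commute)
qed

section \<open>Reversal\<close>

interpretation rf_recip: comm_ring_hom "rf_recip :: 'a::field ratfun \<Rightarrow> 'a ratfun"
proof
  show "rf_recip 0 = (0 :: 'a ratfun)" using rf_recip_to_fract[of "0 :: 'a poly"] by (simp add: poly_recip_0)
  show "rf_recip 1 = (1 :: 'a ratfun)"
  proof -
    have "poly_recip 1 = (1 :: 'a ratfun)"
      by (simp add: poly_recip_def one_pCons map_poly_pCons rf_const_hom)
    with rf_recip_to_fract[of "1 :: 'a poly"] show ?thesis by simp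
  qed
  fix f h :: "'a ratfun"
  obtain p q where f: "f = Fraction_Field.Fract p q" "q \<noteq> 0" by (cases f)
  obtain p' q' where h: "h = Fraction_Field.Fract p' q'" "q' \<noteq> 0" by (cases h)
  show "rf_recip (f * h) = rf_recip f * rf_recip h"
    using f h by (simp add: rf_recip_Fract poly_recip_mult)
  show "rf_recip (f + h) = rf_recip f + rf_recip h"
    using f h by (simp add: rf_recip_Fract poly_recip_mult poly_recip_add poly_recip_eq_0_iff add_frac_eq)
qed

interpretation to_fract: comm_ring_hom "to_fract :: 'a::idom \<Rightarrow> 'a fract"
  by unfold_locales simp_all

lemma rf_recip_nonzero: "f \<noteq> 0 \<Longrightarrow> rf_recip f \<noteq> 0"
  using rf_recip.hom_mult[of f "inverse f"] by auto

lemma rev_rmat_smult: "rev_rmat g M = rf_var powi g \<cdot>\<^sub>m map_mat rf_recip M"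
  by (auto simp: rev_rmat_def rf_rev_def intro!: eq_matI)

text \<open>The substitution of \<open>1/\<lambda>\<close> is a ring homomorphism that keeps nonzero
  elements nonzero, so it carries a diagonalization to one with the same number of nonzero diagonal
  entries. Any point would do for the diagonalization; \<open>0\<close> is an arbitrary
  choice.\<close>

lemma mat_rank_rev_rmat: "mat_rank (rev_rmat g G) = mat_rank G"
proof -
  define p m where "p = dim_row G" "m = dim_col G"
  then have G: "G \<in> carrier_mat p m" by auto
  obtain \<nu> where \<nu>: "smith_form 0 G \<nu>" by (rule smith_form_exists)
  let ?S = "sdiag p m (length \<nu>) (\<lambda>i. rf_lin 0 powi (\<nu> ! i))"
  note sf = smith_formD[OF \<nu> G]
  from sf(3) sdiag_carrier obtain P P' Q Q' where *: "loc_inverse 0 p P P'" "loc_inverse 0 m Q Q'"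
    "G = P * ?S * Q" by (rule loc_equivE)
  note P = loc_inverseD[OF *(1)] and Q = loc_inverseD[OF *(2)]
  let ?r = "map_mat rf_recip"
  let ?S' = "sdiag p m (length \<nu>) (\<lambda>i. rf_var powi g * rf_recip (rf_lin 0 powi (\<nu> ! i)))"
  have P': "?r P \<in> carrier_mat p p" "?r P' \<in> carrier_mat p p" and Q': "?r Q \<in> carrier_mat m m" "?r Q' \<in> carrier_mat m m"
    using P Q by auto
  have "?r G = ?r P * ?r ?S * ?r Q"
    unfolding *(3) rf_recip.mat_hom_mult[OF mult_carrier_mat[OF P(1) sdiag_carrier] Q(1)]
      rf_recip.mat_hom_mult[OF P(1) sdiag_carrier] ..
  also have "?r ?S = sdiag p m (length \<nu>) (\<lambda>i. rf_recip (rf_lin 0 powi (\<nu> ! i)))"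
    by (rule map_mat_sdiag) simp
  finally have "?r G = ?r P * sdiag p m (length \<nu>) (\<lambda>i. rf_recip (rf_lin 0 powi (\<nu> ! i))) * ?r Q" .
  then have "rev_rmat g G = ?r P * (rf_var powi g \<cdot>\<^sub>m sdiag p m (length \<nu>) (\<lambda>i. rf_recip (rf_lin 0 powi (\<nu> ! i)))) * ?r Q"
    unfolding rev_rmat_smult mult_smult_distrib[OF P'(1) sdiag_carrier]
      mult_smult_assoc_mat[OF mult_carrier_mat[OF P'(1) sdiag_carrier] Q'(1)] by simp
  also have "rf_var powi g \<cdot>\<^sub>m sdiag p m (length \<nu>) (\<lambda>i. rf_recip (rf_lin 0 powi (\<nu> ! i))) = ?S'"
    by (auto intro!: eq_matI)
  finally have rev: "rev_rmat g G = ?r P * ?S' * ?r Q" .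
  have "?r P' * ?r P = 1\<^sub>m p" "?r Q * ?r Q' = 1\<^sub>m m"
    using rf_recip.mat_hom_mult[OF P(2,1)] rf_recip.mat_hom_mult[OF Q(1,2)] P(6) Q(5)
    by (simp_all add: rf_recip.mat_hom_one)
  then have "mat_rank (rev_rmat g G) = length \<nu>"
    by (rule mat_rank_diagonalization[OF P' _ Q' _ rev sf(1,2)]) (simp add: rf_var_nonzero rf_recip_nonzero)
  then show ?thesis using mat_rank_smith_form[OF \<nu>] by simp
qed

section \<open>Degrees, inverses and the reversed transfer function\<close>

lemma degree_le_mat_degree:
  assumes "i < dim_row P" "j < dim_col P"
  shows "degree (P $$ (i, j)) \<le> mat_degree P"
proof (cases "P $$ (i, j) = 0")
  case False
  let ?Z = "0\<^sub>m (dim_row P) (dim_col P)"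
  have nz: "coeff_mat P k \<noteq> ?Z" if "coeff (P $$ (i, j)) k \<noteq> 0" for k
  proof
    assume "coeff_mat P k = ?Z"
    then have "coeff_mat P k $$ (i, j) = ?Z $$ (i, j)" by simp
    with assms that show False by (simp add: coeff_mat_def)
  qed
  \<comment> \<open>\<open>GREATEST\<close> is meaningful only on a bounded set; the sum of the
    degrees of all entries is a convenient bound.\<close>
  have "k \<le> (\<Sum>(i, j)\<in>{..<dim_row P} \<times> {..<dim_col P}. degree (P $$ (i, j)))" if "coeff_mat P k \<noteq> ?Z" for k
  proof -
    from that obtain i j where ij: "i < dim_row P" "j < dim_col P" "coeff (P $$ (i, j)) k \<noteq> 0"
      by (force simp: coeff_mat_def intro!: eq_matI)
    then have "k \<le> degree (P $$ (i, j))" by (intro le_degree)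
    also have "\<dots> \<le> (\<Sum>(i, j)\<in>{..<dim_row P} \<times> {..<dim_col P}. degree (P $$ (i, j)))"
      using ij member_le_sum[of "(i, j)" "{..<dim_row P} \<times> {..<dim_col P}" "\<lambda>(i, j). degree (P $$ (i, j))"] by auto
    finally show ?thesis .
  qed
  then have "degree (P $$ (i, j)) \<le> (GREATEST k. coeff_mat P k \<noteq> ?Z)"
    using nz[of "degree (P $$ (i, j))"] False by (intro Greatest_le_nat) auto
  moreover have "P \<noteq> ?Z" using False assms by (metis index_zero_mat(1))
  ultimately show ?thesis by (simp add: mat_degree_def)
qed simp

lemma rat_mat_rev_pmat:
  assumes "\<And>i j. i < dim_row P \<Longrightarrow> j < dim_col P \<Longrightarrow> degree (P $$ (i, j)) \<le> d"
  shows "rat_mat (rev_pmat d P) = rev_rmat (int d) (rat_mat P)"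
  using assms by (auto simp: rev_pmat_def rev_rmat_def to_fract_rev_poly intro!: eq_matI)

lemma matrix_inverse_exists:
  fixes M :: "'b::field mat"
  assumes M: "M \<in> carrier_mat n n" and det: "det M \<noteq> 0"
  shows "the (mat_inverse M) \<in> carrier_mat n n" "M * the (mat_inverse M) = 1\<^sub>m n"
proof -
  have "mat_inverse M \<noteq> None"
    \<comment> \<open>The instance \<open>()\<close> fixes the free last argument of
      \<open>ring_mat\<close>, so that both facts speak of the same group of units.\<close>
    using mat_inverse(1)[OF M, of "()"] det_non_zero_imp_unit[OF M det, of "()"] by auto
  then obtain N where "mat_inverse M = Some N" by auto
  with mat_inverse(2)[OF M this] show "the (mat_inverse M) \<in> carrier_mat n n" "M * the (mat_inverse M) = 1\<^sub>m n"
    by simp_all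
qed

text \<open>With \<open>x\<close> the \<open>d\<close>-th power of \<open>rf_var\<close>, each
  reversed block is \<open>x\<close> times its substituted block, and the inverse of the reversed
  state matrix is \<open>inverse x\<close> times the substituted inverse. Two of the three powers in
  the product cancel, leaving the single \<open>x\<close> that \<open>rev_rmat\<close> puts in
  front.\<close>

lemma rev_transfer_function:
  fixes A B C D :: "'a::field poly mat"
  assumes A: "A \<in> carrier_mat n n" and B: "B \<in> carrier_mat n t" and C: "C \<in> carrier_mat q n"
    and D: "D \<in> carrier_mat q t" and det: "det A \<noteq> 0"
    and deg: "mat_degree (system_matrix A B C D) \<le> d"
  obtains Ai where "Ai \<in> carrier_mat n n" "rat_mat (rev_pmat d A) * Ai = 1\<^sub>m n"
    "rev_rmat (int d) (transfer_function A B C D) =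
      rat_mat (rev_pmat d D) + rat_mat (rev_pmat d C) * (Ai * rat_mat (rev_pmat d B))"
    "rat_mat (rev_pmat d (system_matrix A B C D)) = rev_rmat (int d) (rat_mat (system_matrix A B C D))"
proof -
  let ?L = "system_matrix A B C D"
  have dimL: "dim_row ?L = n + q" "dim_col ?L = n + t" using A D by (auto simp: system_matrix_def)
  have degL: "degree (?L $$ (i, j)) \<le> d" if "i < n + q" "j < n + t" for i j
    using degree_le_mat_degree[of i ?L j] that dimL deg by simp
  \<comment> \<open>All blocks are reversed at the common grade \<open>d\<close>, which may exceed
    the degree of a single block; the bound is inherited from the whole system matrix.\<close>
  have degs: "i < n \<Longrightarrow> j < n \<Longrightarrow> degree (A $$ (i, j)) \<le> d" "i < n \<Longrightarrow> j < t \<Longrightarrow> degree (B $$ (i, j)) \<le> d"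
    "i < q \<Longrightarrow> j < n \<Longrightarrow> degree (C $$ (i, j)) \<le> d" "i < q \<Longrightarrow> j < t \<Longrightarrow> degree (D $$ (i, j)) \<le> d" for i j
    using degL[of i j] degL[of i "n + j"] degL[of "n + i" j] degL[of "n + i" "n + j"] A B C D
    by (simp_all add: system_matrix_def)
  define x where "x = (rf_var :: 'a ratfun) ^ d"
  have x: "x \<noteq> 0" by (simp add: x_def rf_var_nonzero)
  let ?r = "map_mat rf_recip"
  have rev: "rat_mat (rev_pmat d M) = x \<cdot>\<^sub>m ?r (rat_mat M)"
    if "\<And>i j. i < dim_row M \<Longrightarrow> j < dim_col M \<Longrightarrow> degree (M $$ (i, j)) \<le> d" for M :: "'a poly mat"
    using rat_mat_rev_pmat[OF that] by (simp add: rev_rmat_smult x_def)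
  define I where "I = the (mat_inverse (rat_mat A))"
  have RA: "rat_mat A \<in> carrier_mat n n" and RB: "rat_mat B \<in> carrier_mat n t"
    and RC: "rat_mat C \<in> carrier_mat q n" and RD: "rat_mat D \<in> carrier_mat q t" using A B C D by auto
  have "det (rat_mat A) \<noteq> 0" using det by (simp add: to_fract.hom_det)
  from matrix_inverse_exists[OF RA this] have I: "I \<in> carrier_mat n n" "rat_mat A * I = 1\<^sub>m n"
    by (simp_all add: I_def)
  note r = map_carrier_mat[THEN iffD2, of _ _ _ rf_recip]
  note rA = r[OF RA] and rB = r[OF RB] and rC = r[OF RC] and rD = r[OF RD] and rI = r[OF I(1)]
  define Ai where "Ai = inverse x \<cdot>\<^sub>m ?r I"
  have Ai: "Ai \<in> carrier_mat n n" using rI by (simp add: Ai_def)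
  have "?r (rat_mat A) * ?r I = 1\<^sub>m n"
    using rf_recip.mat_hom_mult[OF RA I(1)] I(2) by (simp add: rf_recip.mat_hom_one)
  then have inv: "rat_mat (rev_pmat d A) * Ai = 1\<^sub>m n"
    using x rA rI A degs(1)
    by (subst rev) (auto simp: Ai_def mult_smult_distrib[of _ n n _ n] mult_smult_assoc_mat[of _ n n _ n] intro!: eq_matI)
  have CIB: "rat_mat C * (I * rat_mat B) \<in> carrier_mat q t"
    by (rule mult_carrier_mat[OF RC mult_carrier_mat[OF I(1) RB]])
  have "rev_rmat (int d) (transfer_function A B C D) = x \<cdot>\<^sub>m ?r (rat_mat D + rat_mat C * (I * rat_mat B))"
    unfolding transfer_function_def I_def[symmetric] assoc_mult_mat[OF RC I(1) RB]
    by (simp add: rev_rmat_smult x_def)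
  also have "?r (rat_mat D + rat_mat C * (I * rat_mat B)) = ?r (rat_mat D) + ?r (rat_mat C * (I * rat_mat B))"
    using C B D CIB by (intro eq_matI) (auto simp: rf_recip.hom_add)
  also have "?r (rat_mat C * (I * rat_mat B)) = ?r (rat_mat C) * (?r I * ?r (rat_mat B))"
    unfolding rf_recip.mat_hom_mult[OF RC mult_carrier_mat[OF I(1) RB]] rf_recip.mat_hom_mult[OF I(1) RB] ..
  also have "x \<cdot>\<^sub>m (?r (rat_mat D) + ?r (rat_mat C) * (?r I * ?r (rat_mat B)))
      = x \<cdot>\<^sub>m ?r (rat_mat D) + x \<cdot>\<^sub>m (?r (rat_mat C) * (?r I * ?r (rat_mat B)))"
    by (rule add_smult_distrib_left_mat[OF rD mult_carrier_mat[OF rC mult_carrier_mat[OF rI rB]]])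
  also have "x \<cdot>\<^sub>m (?r (rat_mat C) * (?r I * ?r (rat_mat B)))
      = (x \<cdot>\<^sub>m ?r (rat_mat C)) * (Ai * (x \<cdot>\<^sub>m ?r (rat_mat B)))"
  proof -
    have "Ai * (x \<cdot>\<^sub>m ?r (rat_mat B)) = ?r I * ?r (rat_mat B)"
      unfolding Ai_def mult_smult_assoc_mat[OF rI smult_carrier_mat[OF rB]] mult_smult_distrib[OF rI rB]
      using x by (auto intro!: eq_matI)
    then show ?thesis using mult_smult_assoc_mat[OF rC mult_carrier_mat[OF rI rB]] by simp
  qed
  finally have tf: "rev_rmat (int d) (transfer_function A B C D) =
      rat_mat (rev_pmat d D) + rat_mat (rev_pmat d C) * (Ai * rat_mat (rev_pmat d B))"
    using rev[of B] rev[of C] rev[of D] degs B C D by simp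
  have "rat_mat (rev_pmat d ?L) = rev_rmat (int d) (rat_mat ?L)"
    by (rule rat_mat_rev_pmat) (simp add: dimL degL)
  from that[OF Ai inv tf this] show ?thesis .
qed

text \<open>The dimension conditions force \<open>s1 = s + s2\<close>. The identity blocks
  contribute \<open>s1\<close> and \<open>s2\<close> zero orders to the two sides, and cancelling
  the common \<open>s2\<close> leaves a condition free of both numbers.\<close>

lemma linearization_iff_invariant_orders:
  fixes A B C D :: "'a::field poly mat"
  assumes G: "G \<in> carrier_mat p m" and A: "A \<in> carrier_mat n n" and D: "D \<in> carrier_mat (p + s) (m + s)"
    and H: "rev_rmat (int d) (transfer_function A B C D) \<in> carrier_mat (p + s) (m + s)"
    and d: "d = mat_degree (system_matrix A B C D)"
    and lin: "linear_system_matrix n (p + s) (m + s) A B C D" "rev_minimal_at d 0 A B C D"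
  shows "linearization_at_infinity A B C D G g \<longleftrightarrow>
    mset (invariant_orders 0 (rev_rmat (int d) (transfer_function A B C D)))
      = replicate_mset s 0 + mset (invariant_orders 0 (rev_rmat g G))"
proof -
  let ?G = "rev_rmat g G" and ?H = "rev_rmat (int d) (transfer_function A B C D)"
  have RG: "?G \<in> carrier_mat p m" using G by (simp add: rev_rmat_def)
  have swap: "mset (invariant_orders 0 (diag2 X (1\<^sub>m k))) = replicate_mset k 0 + mset (invariant_orders 0 X)"
    for X :: "'a ratfun mat" and k
  proof -
    have "diag2 X (1\<^sub>m k) \<in> carrier_mat (dim_row X + k) (dim_col X + k)"
      "diag2 (1\<^sub>m k) X \<in> carrier_mat (dim_row X + k) (dim_col X + k)"
      by (auto simp: diag2_eq intro!: carrier_matI)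
    from loc_equiv_iff_invariant_orders[OF this] loc_equiv_diag2_swap[of 0 X k]
    show ?thesis by (simp add: invariant_orders_diag2)
  qed
  define E where "E s1 s2 \<longleftrightarrow> (\<exists>Q1 \<in> carrier_mat (p + s1) (p + s1). \<exists>Q2 \<in> carrier_mat (m + s1) (m + s1).
        regular_at 0 Q1 \<and> regular_at 0 Q2 \<and> Q1 * diag2 ?G (1\<^sub>m s1) * Q2 = diag2 ?H (1\<^sub>m s2))" for s1 s2
  have step: "E s1 s2 \<longleftrightarrow> mset (invariant_orders 0 ?H) = replicate_mset s 0 + mset (invariant_orders 0 ?G)"
    if "s1 = s + s2" for s1 s2
  proof -
    have dG: "diag2 ?G (1\<^sub>m s1) \<in> carrier_mat (p + s1) (m + s1)"
      by (rule diag2_carrier[OF RG one_carrier_mat])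
    have dH: "diag2 ?H (1\<^sub>m s2) \<in> carrier_mat (p + s1) (m + s1)"
      using diag2_carrier[OF H one_carrier_mat[of s2]] that by (simp add: add.assoc)
    have "E s1 s2 \<longleftrightarrow>
        loc_equiv 0 (diag2 ?H (1\<^sub>m s2)) (diag2 ?G (1\<^sub>m s1))"
      unfolding E_def loc_equiv_regular[OF dG] by (simp only: eq_commute[of "diag2 ?H (1\<^sub>m s2)"])
    also have "\<dots> \<longleftrightarrow> replicate_mset s2 0 + mset (invariant_orders 0 ?H)
        = replicate_mset s1 0 + mset (invariant_orders 0 ?G)"
      unfolding loc_equiv_iff_invariant_orders[OF dH dG] swap ..
    also have "replicate_mset s1 (0 :: int) = replicate_mset s2 0 + replicate_mset s 0"
      unfolding that by (rule multiset_eqI) simp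
    finally show ?thesis by (simp add: add.assoc)
  qed
  have dims: "dim_row A = n" "dim_row D = p + s" "dim_col D = m + s" "dim_row G = p" "dim_col G = m"
    using A D G by auto
  have "linearization_at_infinity A B C D G g \<longleftrightarrow> (\<exists>s1 s2. s1 = s + s2 \<and> E s1 s2)"
  proof -
    have "int s1 - int s2 = int (p + s) - int p \<and> int s1 - int s2 = int (m + s) - int m \<longleftrightarrow> s1 = s + s2"
      for s1 s2 by auto
    then show ?thesis
      unfolding E_def linearization_at_infinity_def Let_def dims d[symmetric]
      using lin by (simp only: conj_assoc[symmetric] simp_thms)
  qed
  \<comment> \<open>As \<open>step\<close> has the same right-hand side for all admissible
    \<open>s1\<close> and \<open>s2\<close>, the existential collapses; \<open>s1 = s\<close> and
    \<open>s2 = 0\<close> serve as witnesses.\<close>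
  also have "\<dots> \<longleftrightarrow> mset (invariant_orders 0 ?H) = replicate_mset s 0 + mset (invariant_orders 0 ?G)"
    using step[of s 0] step by (metis add_0_right)
  finally show ?thesis .
qed

theorem theorem4p16:
  fixes G :: "'a::alg_closed_field poly fract mat"
    and g :: int and p m n s d :: nat
    and A1 A0 B1 B0 C1 C0 D1 D0 :: "'a mat"
    and A B C D L :: "'a poly mat"
  assumes "G \<in> carrier_mat p m"
    and "A1 \<in> carrier_mat n n" "A0 \<in> carrier_mat n n"
    and "B1 \<in> carrier_mat n (m + s)" "B0 \<in> carrier_mat n (m + s)"
    and "C1 \<in> carrier_mat (p + s) n" "C0 \<in> carrier_mat (p + s) n"
    and "D1 \<in> carrier_mat (p + s) (m + s)" "D0 \<in> carrier_mat (p + s) (m + s)"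
    and "A = pencil A1 A0" "B = pencil B1 B0" "C = pencil C1 C0" "D = pencil D1 D0"
    and "L = system_matrix A B C D"
    and "linear_system_matrix n (p + s) (m + s) A B C D"
    and "d = mat_degree L"
    and "rev_minimal_at d 0 A B C D"
  shows "linearization_at_infinity A B C D G g \<longleftrightarrow>
      mat_rank (rat_mat L) = mat_rank G + n + s \<and>
      pole_elementary_divisors 0 (rev_rmat g G) = elementary_divisors 0 (rev_pmat d A) \<and>
      zero_elementary_divisors 0 (rev_rmat g G) = elementary_divisors 0 (rev_pmat d L)"
proof -
  note G = assms(1) and L = assms(14) and lin = assms(15) and d = assms(16)[unfolded L] and minimal = assms(17)
  have A: "A \<in> carrier_mat n n" and B: "B \<in> carrier_mat n (m + s)" and C: "C \<in> carrier_mat (p + s) n"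
    and D: "D \<in> carrier_mat (p + s) (m + s)" and det: "det A \<noteq> 0"
    using lin by (simp_all add: linear_system_matrix_def polynomial_system_matrix_def)
  define H where "H = rev_rmat (int d) (transfer_function A B C D)"
  obtain Ai where Ai: "Ai \<in> carrier_mat n n" "rat_mat (rev_pmat d A) * Ai = 1\<^sub>m n"
    and H: "H = rat_mat (rev_pmat d D) + rat_mat (rev_pmat d C) * (Ai * rat_mat (rev_pmat d B))"
    and rL: "rat_mat (rev_pmat d L) = rev_rmat (int d) (rat_mat L)"
    using rev_transfer_function[OF A B C D det eq_refl[OF d[symmetric]]] unfolding H_def L by blast
  have rA: "rev_pmat d A \<in> carrier_mat n n" and rB: "rev_pmat d B \<in> carrier_mat n (m + s)"
    and rC: "rev_pmat d C \<in> carrier_mat (p + s) n" and rD: "rev_pmat d D \<in> carrier_mat (p + s) (m + s)"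
    using A B C D by (simp_all add: rev_pmat_def)
  have HC: "H \<in> carrier_mat (p + s) (m + s)"
    unfolding H using rA rB rC rD Ai(1) by (auto intro!: carrier_matI)
  note realization = minimal_realization_elementary_divisors[OF rA rB rC rD Ai HC H
      minimal[unfolded rev_minimal_at_def], folded rev_pmat_system_matrix[OF A B C D] L]
  \<comment> \<open>Condition (a) concerns \<open>L\<close>, while the realization theorem was
    applied to its reversal; reversal preserves the normal rank.\<close>
  have "mat_rank (rat_mat L) = mat_rank (rat_mat (rev_pmat d L))"
    unfolding rL by (simp add: mat_rank_rev_rmat)
  then have rank: "mat_rank (rat_mat L) = mat_rank H + n" using realization(3) by simp
  have "linearization_at_infinity A B C D G g \<longleftrightarrow>
      mset (invariant_orders 0 H) = replicate_mset s 0 + mset (invariant_orders 0 (rev_rmat g G))"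
    unfolding H_def by (rule linearization_iff_invariant_orders[OF G A D HC[unfolded H_def] d lin minimal])
  also have "\<dots> \<longleftrightarrow> mat_rank H = mat_rank G + s \<and>
      pole_elementary_divisors 0 (rev_rmat g G) = elementary_divisors 0 (rev_pmat d A) \<and>
      zero_elementary_divisors 0 (rev_rmat g G) = elementary_divisors 0 (rev_pmat d L)"
    unfolding elementary_divisors_eq_iff mat_rank_rev_rmat realization(1,2) ..
  finally show ?thesis unfolding rank by simp
qed

end
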